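(* Let $C$ be a clutter with finite vertex set $X$ and let $\Bbbk$ be a field. For every $s\in\mathbb{N}$, $$\mathcal{P}_s(I(C))=\langle x_{1,i_1}\cdots x_{r,i_r}\colon \{x_1,\dots,x_r\}\in E(C),\ 0\le i_1,\dots,i_r\le s\rangle,$$ and this generating set is minimal.
   Context: $\mathbb{N}$ includes $0$. A clutter $C$ with vertex set $X$ is a family $E(C)$ of subsets of $X$ (edges), none of which is contained in another. $\Bbbk[X]$ is the polynomial ring with the elements of $X$ as variables; the edge ideal $I(C)\subseteq\Bbbk[X]$ is generated by the monomials $x_1\cdots x_r$ with $\{x_1,\dots,x_r\}\in E(C)$. For $s\in\mathbb{N}$ let $\mathcal{J}_s(X)=\bigcup_{x\in X}\{x_0,\dots,x_s\}$ (new distinct variables; for an element denoted $x_j\in X$ the new variables are $x_{j,0},\dots,x_{j,s}$). Let $\phi_s\colon\Bbbk[X]\to\Bbbk[\mathcal{J}_s(X)][t]/\langle t^{s+1}\rangle$ be the $\Bbbk$-algebra homomorphism with $\phi_s(x)=\sum_{j=0}^s x_jt^j$. For an ideal $I=\langle f_1,\dots,f_r\rangle$ of $\Bbbk[X]$, the ideal of $s$-jets $\mathcal{J}_s(I)\subseteq\Bbbk[\mathcal{J}_s(X)]$ is generated by the $f_{i,j}$ determined by $\phi_s(f_i)=\sum_{j=0}^s f_{i,j}t^j$. Ideal of principal $s$-jets: for an ideal $I$ of $\Bbbk[X]$, let $Z$ be the vanishing locus of $I$ in $\mathbb{A}^{|X|}_\Bbbk=\operatorname{Spec}\Bbbk[X]$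 with its reduced structure, $Z_{\text{sing}}$ its singular locus, and write $\mathbb{I}(\cdot)$ for the ideal of polynomials vanishing on a subset of affine space (so $\mathbb{I}(Z)=\sqrt I$). The jet scheme $\mathcal{J}_s(\mathbb{A}^{|X|}_\Bbbk)$ is $\operatorname{Spec}\Bbbk[\mathcal{J}_s(X)]$, $\mathcal{J}_s(Z)$ is the vanishing locus in it of $\mathcal{J}_s(\mathbb{I}(Z))$, and $\pi_s\colon\mathcal{J}_s(\mathbb{A}^{|X|}_\Bbbk)\to\mathbb{A}^{|X|}_\Bbbk$ is the projection corresponding to $x\mapsto x_0$. Then $$\mathcal{P}_s(I)=\mathbb{I}\Bigl(\overline{\mathcal{J}_s(Z)\setminus\pi_s^{-1}(Z_{\text{sing}})}\Bigr)\subseteq\Bbbk[\mathcal{J}_s(X)],$$ the bar denoting Zariski closure. *)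

theory Defs
  imports
    "HOL-Library.Poly_Mapping"
    "HOL-Library.Extended_Nat"
    "HOL-Computational_Algebra.Polynomial"
    "HOL-Algebra.Ring_Divisibility"
    "HOL-Analysis.Abstract_Topology"
begin

section \<open>Spectra, localization and regularity\<close>

definition Spec :: "('a, 'b) ring_scheme \<Rightarrow> 'a set set"
  where "Spec R = {p. primeideal p R}"

definition zero_locus :: "('a, 'b) ring_scheme \<Rightarrow> 'a set \<Rightarrow> 'a set set"
  where "zero_locus R S = {p \<in> Spec R. S \<subseteq> p}"

definition zariski :: "('a, 'b) ring_scheme \<Rightarrow> 'a set topology"
  where "zariski R = topology (\<lambda>U. \<exists>S. S \<subseteq> carrier R \<and> U = Spec R - zero_locus R S)"

text \<open>An element \<open>f\<close> vanishes at the point \<open>p\<close> if its image in the residue field at \<open>p\<close> is zero,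
  that is, if it lies in \<open>p\<close>.\<close>

definition vanishing_ideal :: "('a, 'b) ring_scheme \<Rightarrow> 'a set set \<Rightarrow> 'a set"
  where "vanishing_ideal R Y = {f \<in> carrier R. \<forall>p\<in>Y. f \<in> p}"

definition krull_dim :: "('a, 'b) ring_scheme \<Rightarrow> enat"
  where "krull_dim R =
    (SUP n \<in> {n. \<exists>c. (\<forall>i\<le>n. c i \<in> Spec R) \<and> (\<forall>i<n. c i \<subset> c (Suc i))}. enat n)"

definition frac_rel :: "('a, 'b) ring_scheme \<Rightarrow> 'a set \<Rightarrow> (('a \<times> 'a) \<times> ('a \<times> 'a)) set"
  where "frac_rel R P =
    {((a, s), (b, t)). a \<in> carrier R \<and> b \<in> carrier R \<and> s \<in> carrier R - P \<and> t \<in> carrier R - P \<and>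
      (\<exists>u \<in> carrier R - P. u \<otimes>\<^bsub>R\<^esub> (a \<otimes>\<^bsub>R\<^esub> t \<ominus>\<^bsub>R\<^esub> b \<otimes>\<^bsub>R\<^esub> s) = \<zero>\<^bsub>R\<^esub>)}"

definition frac_class :: "('a, 'b) ring_scheme \<Rightarrow> 'a set \<Rightarrow> 'a \<Rightarrow> 'a \<Rightarrow> ('a \<times> 'a) set"
  where "frac_class R P a s = frac_rel R P `` {(a, s)}"

text \<open>The localization of \<open>R\<close> at the prime \<open>P\<close>. The unions below are over all choices of
  representatives; all of them contribute the same class.\<close>

definition localization :: "('a, 'b) ring_scheme \<Rightarrow> 'a set \<Rightarrow> ('a \<times> 'a) set ring"
  where "localization R P =
    \<lparr>carrier = (carrier R \<times> (carrier R - P)) // frac_rel R P,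
     mult = (\<lambda>x y. \<Union>(a, s)\<in>x. \<Union>(b, t)\<in>y. frac_class R P (a \<otimes>\<^bsub>R\<^esub> b) (s \<otimes>\<^bsub>R\<^esub> t)),
     one = frac_class R P \<one>\<^bsub>R\<^esub> \<one>\<^bsub>R\<^esub>,
     zero = frac_class R P \<zero>\<^bsub>R\<^esub> \<one>\<^bsub>R\<^esub>,
     add = (\<lambda>x y. \<Union>(a, s)\<in>x. \<Union>(b, t)\<in>y.
              frac_class R P (a \<otimes>\<^bsub>R\<^esub> t \<oplus>\<^bsub>R\<^esub> b \<otimes>\<^bsub>R\<^esub> s) (s \<otimes>\<^bsub>R\<^esub> t))\<rparr>"

text \<open>A regular local ring: Noetherian, local, with maximal ideal generated by as many elements
  as the Krull dimension.\<close>

definition regular_local_ring :: "('a, 'b) ring_scheme \<Rightarrow> bool"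
  where "regular_local_ring A \<longleftrightarrow>
    cring A \<and> noetherian_ring A \<and> (\<exists>!m. maximalideal m A) \<and>
    (\<exists>m G. maximalideal m A \<and> G \<subseteq> carrier A \<and> finite G \<and> m = Idl\<^bsub>A\<^esub> G \<and>
           enat (card G) = krull_dim A)"

definition Spec_sing :: "('a, 'b) ring_scheme \<Rightarrow> 'a set set"
  where "Spec_sing A = {P \<in> Spec A. \<not> regular_local_ring (localization A P)}"

text \<open>The singular locus of a closed set \<open>Z\<close> with its reduced structure, i.e. of the spectrum of
  \<open>R Quot vanishing_ideal R Z\<close>, viewed inside \<open>Spec R\<close>.\<close>

definition sing_locus :: "('a, 'b) ring_scheme \<Rightarrow> 'a set set \<Rightarrow> 'a set set"
  where "sing_locus R Z =
    {p \<in> Z. (\<lambda>a. vanishing_ideal R Z +>\<^bsub>R\<^esub> a) ` p \<in> Spec_sing (R Quot vanishing_ideal R Z)}"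

definition minimal_generating_set :: "('a, 'b) ring_scheme \<Rightarrow> 'a set \<Rightarrow> 'a set \<Rightarrow> bool"
  where "minimal_generating_set R I G \<longleftrightarrow>
    G \<subseteq> carrier R \<and> I = Idl\<^bsub>R\<^esub> G \<and> (\<forall>H. H \<subset> G \<longrightarrow> I \<noteq> Idl\<^bsub>R\<^esub> H)"

lemma openin_zariski:
  assumes "cring R"
  shows "openin (zariski R) U \<longleftrightarrow> (\<exists>S. S \<subseteq> carrier R \<and> U = Spec R - zero_locus R S)"
proof -
  interpret cring R by fact
  let ?L = "\<lambda>U. \<exists>S. S \<subseteq> carrier R \<and> U = Spec R - zero_locus R S"
  have inter: "?L (U \<inter> V)" if "?L U" "?L V" for U V
  proof -
    from that obtain S T where S: "S \<subseteq> carrier R" "U = Spec R - zero_locus R S"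
      and T: "T \<subseteq> carrier R" "V = Spec R - zero_locus R T" by auto
    let ?ST = "{a \<otimes>\<^bsub>R\<^esub> b | a b. a \<in> S \<and> b \<in> T}"
    have "?ST \<subseteq> p \<longleftrightarrow> S \<subseteq> p \<or> T \<subseteq> p" if "p \<in> Spec R" for p
    proof -
      from that interpret primeideal p R by (simp add: Spec_def)
      show ?thesis
      proof
        assume ST: "?ST \<subseteq> p"
        show "S \<subseteq> p \<or> T \<subseteq> p"
        proof (rule ccontr)
          assume "\<not> (S \<subseteq> p \<or> T \<subseteq> p)"
          then obtain a b where ab: "a \<in> S" "a \<notin> p" "b \<in> T" "b \<notin> p" by blast
          then have "a \<otimes>\<^bsub>R\<^esub> b \<in> p" using ST by blast
          then show False using ab S(1) T(1) I_prime[of a b] by blast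
        qed
      next
        assume "S \<subseteq> p \<or> T \<subseteq> p"
        then show "?ST \<subseteq> p" using S(1) T(1) I_l_closed I_r_closed by blast
      qed
    qed
    then have "U \<inter> V = Spec R - zero_locus R ?ST"
      unfolding S(2) T(2) zero_locus_def by blast
    moreover have "?ST \<subseteq> carrier R" using S(1) T(1) by auto
    ultimately show ?thesis by (intro exI[of _ ?ST] conjI)
  qed
  have union: "?L (\<Union>\<K>)" if K: "\<forall>K\<in>\<K>. ?L K" for \<K>
  proof -
    from K obtain S where S: "\<forall>K\<in>\<K>. S K \<subseteq> carrier R \<and> K = Spec R - zero_locus R (S K)" by metis
    have "p \<in> K \<longleftrightarrow> p \<in> Spec R \<and> \<not> S K \<subseteq> p" if "K \<in> \<K>" for p K
    proof -
      from S that have "K = Spec R - zero_locus R (S K)" by blast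
      then have "p \<in> K \<longleftrightarrow> p \<in> Spec R - zero_locus R (S K)" by simp
      then show ?thesis by (simp add: zero_locus_def) blast
    qed
    then have "p \<in> \<Union>\<K> \<longleftrightarrow> p \<in> Spec R - zero_locus R (\<Union>(S ` \<K>))" for p
      by (simp add: zero_locus_def UN_subset_iff) blast
    then have "\<Union>\<K> = Spec R - zero_locus R (\<Union>(S ` \<K>))" by blast
    moreover have "\<Union>(S ` \<K>) \<subseteq> carrier R" using S by blast
    ultimately show ?thesis by (intro exI[of _ "\<Union>(S ` \<K>)"] conjI)
  qed
  have "istopology ?L"
    unfolding istopology_def by (intro conjI allI impI) (rule inter union; assumption)+
  then show ?thesis
    unfolding zariski_def by (simp only: topology_inverse')
qed


section \<open>Polynomial rings and edge ideals\<close>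

type_synonym ('x, 'k) mpoly = "('x \<Rightarrow>\<^sub>0 nat) \<Rightarrow>\<^sub>0 'k"

definition Var :: "'x \<Rightarrow> ('x, 'k::field) mpoly"
  where "Var x = Poly_Mapping.single (Poly_Mapping.single x 1) 1"

definition Const :: "'k \<Rightarrow> ('x, 'k::field) mpoly"
  where "Const c = Poly_Mapping.single 0 c"

definition indets :: "('x, 'k::field) mpoly \<Rightarrow> 'x set"
  where "indets f = (\<Union>m\<in>Poly_Mapping.keys f. Poly_Mapping.keys m)"

definition mpoly_ring :: "'x set \<Rightarrow> ('x, 'k::field) mpoly ring"
  where "mpoly_ring X =
    \<lparr>carrier = {f. indets f \<subseteq> X}, mult = (*), one = 1, zero = 0, add = (+)\<rparr>"

text \<open>The value of \<open>f\<close> under the homomorphism that sends each coefficient \<open>c\<close> to \<open>h c\<close> and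
  each variable \<open>x\<close> to \<open>v x\<close>.\<close>

definition mpoly_eval ::
    "('k \<Rightarrow> 'b) \<Rightarrow> ('x \<Rightarrow> 'b) \<Rightarrow> ('x, 'k::field) mpoly \<Rightarrow> 'b::comm_semiring_1"
  where "mpoly_eval h v f =
    (\<Sum>m\<in>Poly_Mapping.keys f. h (Poly_Mapping.lookup f m) * (\<Prod>x\<in>Poly_Mapping.keys m. v x ^ Poly_Mapping.lookup m x))"

definition clutter :: "'x set \<Rightarrow> 'x set set \<Rightarrow> bool"
  where "clutter X E \<longleftrightarrow> E \<subseteq> Pow X \<and> (\<forall>e\<in>E. \<forall>e'\<in>E. e \<subseteq> e' \<longrightarrow> e = e')"

definition edge_ideal :: "'x set \<Rightarrow> 'x set set \<Rightarrow> ('x, 'k::field) mpoly set"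
  where "edge_ideal X E = Idl\<^bsub>mpoly_ring X\<^esub> {\<Prod>x\<in>e. Var x | e. e \<in> E}"


section \<open>Jets and principal jets\<close>

text \<open>The jet variable \<open>x\<^sub>j\<close> is encoded as the pair \<open>(x, j)\<close>.\<close>

definition jet_vars :: "nat \<Rightarrow> 'x set \<Rightarrow> ('x \<times> nat) set"
  where "jet_vars s X = X \<times> {0..s}"

text \<open>The polynomial \<open>jet_subst s f\<close> in \<open>t\<close> lifts \<open>\<phi>\<^sub>s(f)\<close>; modulo \<open>t\<^sup>s\<^sup>+\<^sup>1\<close> exactly its
  coefficients of index at most \<open>s\<close> survive.\<close>

definition jet_subst :: "nat \<Rightarrow> ('x, 'k::field) mpoly \<Rightarrow> ('x \<times> nat, 'k) mpoly poly"
  where "jet_subst s f =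
    mpoly_eval (\<lambda>c. [:Const c:]) (\<lambda>x. \<Sum>j=0..s. Polynomial.monom (Var (x, j)) j) f"

definition jet_coeff :: "nat \<Rightarrow> ('x, 'k::field) mpoly \<Rightarrow> nat \<Rightarrow> ('x \<times> nat, 'k) mpoly"
  where "jet_coeff s f j = Polynomial.coeff (jet_subst s f) j"

text \<open>All elements of \<open>I\<close> are used as generators; by lemma \<open>jet_ideal_genideal\<close> below any
  generating set of \<open>I\<close> gives the same ideal.\<close>

definition jet_ideal :: "nat \<Rightarrow> 'x set \<Rightarrow> ('x, 'k::field) mpoly set \<Rightarrow> ('x \<times> nat, 'k) mpoly set"
  where "jet_ideal s X I =
    Idl\<^bsub>mpoly_ring (jet_vars s X)\<^esub> {jet_coeff s f j | f j. f \<in> I \<and> j \<le> s}"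

text \<open>The map \<open>\<pi>\<^sub>s\<close> on points: contraction of primes along \<open>x \<mapsto> x\<^sub>0\<close>.\<close>

definition jet_proj :: "'x set \<Rightarrow> ('x \<times> nat, 'k::field) mpoly set \<Rightarrow> ('x, 'k) mpoly set"
  where "jet_proj X q =
    {f \<in> carrier (mpoly_ring X). mpoly_eval Const (\<lambda>x. Var (x, 0)) f \<in> q}"

definition principal_jets ::
    "nat \<Rightarrow> 'x set \<Rightarrow> ('x, 'k::field) mpoly set \<Rightarrow> ('x \<times> nat, 'k) mpoly set"
  where "principal_jets s X I =
    (let R = mpoly_ring X;
         J = mpoly_ring (jet_vars s X);
         Z = zero_locus R I;
         JZ = zero_locus J (jet_ideal s X (vanishing_ideal R Z))
     in vanishing_ideal J
          (zariski J closure_of (JZ - {q \<in> Spec J. jet_proj X q \<in> sing_locus R Z})))"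

lemma indets_add: "indets (f + g) \<subseteq> indets f \<union> indets g"
  using keys_add[of f g] by (auto simp: indets_def)

lemma indets_mult: "indets (f * g) \<subseteq> indets f \<union> indets g"
proof
  fix x assume "x \<in> indets (f * g)"
  then obtain k where k: "k \<in> Poly_Mapping.keys (f * g)" "x \<in> Poly_Mapping.keys k"
    by (auto simp: indets_def)
  from k(1) obtain m n where "m \<in> Poly_Mapping.keys f" "n \<in> Poly_Mapping.keys g" "k = m + n"
    using keys_mult[of f g] by blast
  with k(2) show "x \<in> indets f \<union> indets g"
    using keys_add[of m n] by (auto simp: indets_def)
qed

lemma indets_uminus: "indets (- f) = indets f"
proof -
  have "Poly_Mapping.keys (- f) = Poly_Mapping.keys f" by (auto simp: in_keys_iff)
  then show ?thesis by (simp add: indets_def)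
qed

lemma indets_0 [simp]: "indets 0 = {}"
  by (simp add: indets_def)

lemma indets_1 [simp]: "indets 1 = {}"
  by (simp add: indets_def)

lemma indets_Const [simp]: "indets (Const c) = {}"
  by (auto simp: indets_def Const_def split: if_splits)

lemma indets_Var [simp]: "indets (Var x :: ('x, 'k::field) mpoly) = {x}"
  by (simp add: indets_def Var_def)

lemma indets_sum: "(\<And>i. i \<in> A \<Longrightarrow> indets (f i) \<subseteq> X) \<Longrightarrow> indets (sum f A) \<subseteq> X"
proof (induction A rule: infinite_finite_induct)
  case (insert i A)
  then show ?case using indets_add[of "f i" "sum f A"] by fastforce
qed auto

lemma mpoly_ring_simps [simp]:
  "carrier (mpoly_ring X) = {f. indets f \<subseteq> X}"
  "f \<otimes>\<^bsub>mpoly_ring X\<^esub> g = f * g" "f \<oplus>\<^bsub>mpoly_ring X\<^esub> g = f + g"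
  "\<one>\<^bsub>mpoly_ring X\<^esub> = 1" "\<zero>\<^bsub>mpoly_ring X\<^esub> = 0"
  by (simp_all add: mpoly_ring_def)

lemma cring_mpoly_ring: "cring (mpoly_ring X)"
proof (rule cringI)
  show "abelian_group (mpoly_ring X :: ('a, 'b) mpoly ring)"
  proof (rule abelian_groupI)
    fix f :: "('a, 'b) mpoly" assume "f \<in> carrier (mpoly_ring X)"
    then have "- f \<in> carrier (mpoly_ring X)" by (simp add: indets_uminus)
    then show "\<exists>g\<in>carrier (mpoly_ring X). g \<oplus>\<^bsub>mpoly_ring X\<^esub> f = \<zero>\<^bsub>mpoly_ring X\<^esub>"
      by (intro bexI[of _ "- f"]) auto
  next
    fix f g :: "('a, 'b) mpoly"
    assume "f \<in> carrier (mpoly_ring X)" "g \<in> carrier (mpoly_ring X)"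
    then show "f \<oplus>\<^bsub>mpoly_ring X\<^esub> g \<in> carrier (mpoly_ring X)"
      using indets_add[of f g] by auto
  qed (auto simp: add_ac)
  show "comm_monoid (mpoly_ring X :: ('a, 'b) mpoly ring)"
  proof (rule comm_monoidI)
    fix f g :: "('a, 'b) mpoly"
    assume "f \<in> carrier (mpoly_ring X)" "g \<in> carrier (mpoly_ring X)"
    then show "f \<otimes>\<^bsub>mpoly_ring X\<^esub> g \<in> carrier (mpoly_ring X)"
      using indets_mult[of f g] by auto
  qed (auto simp: mult_ac)
qed (auto simp: algebra_simps)

lemma mpoly_eval_superset:
  assumes "h 0 = 0" "finite A" "Poly_Mapping.keys f \<subseteq> A"
  shows "mpoly_eval h v f = (\<Sum>m\<in>A. h (Poly_Mapping.lookup f m) * (\<Prod>x\<in>Poly_Mapping.keys m. v x ^ Poly_Mapping.lookup m x))"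
  unfolding mpoly_eval_def by (rule sum.mono_neutral_left) (use assms in \<open>auto simp: in_keys_iff\<close>)

lemma mpoly_eval_add:
  assumes "h 0 = 0" "\<And>a b. h (a + b) = h a + h b"
  shows "mpoly_eval h v (f + g) = mpoly_eval h v f + mpoly_eval h v g"
proof -
  let ?A = "Poly_Mapping.keys f \<union> Poly_Mapping.keys g"
  have "Poly_Mapping.keys (f + g) \<subseteq> ?A" by (rule keys_add)
  then show ?thesis
    using assms(2)
    by (simp add: mpoly_eval_superset[of h ?A, OF assms(1)] lookup_add sum.distrib distrib_right)
qed

lemma monomial_eval_add:
  fixes v :: "'x \<Rightarrow> 'b::comm_semiring_1"
  shows "(\<Prod>x\<in>Poly_Mapping.keys (m + n). v x ^ Poly_Mapping.lookup (m + n) x) =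
         (\<Prod>x\<in>Poly_Mapping.keys m. v x ^ Poly_Mapping.lookup m x) * (\<Prod>x\<in>Poly_Mapping.keys n. v x ^ Poly_Mapping.lookup n x)"
proof -
  let ?A = "Poly_Mapping.keys m \<union> Poly_Mapping.keys n"
  have eq: "(\<Prod>x\<in>Poly_Mapping.keys k. v x ^ Poly_Mapping.lookup k x) = (\<Prod>x\<in>?A. v x ^ Poly_Mapping.lookup k x)"
    if "Poly_Mapping.keys k \<subseteq> ?A" for k :: "'x \<Rightarrow>\<^sub>0 nat"
    by (rule prod.mono_neutral_left) (use that in \<open>auto simp: in_keys_iff\<close>)
  show ?thesis
    unfolding eq[OF keys_add] eq[OF Un_upper1] eq[OF Un_upper2]
    by (simp add: lookup_add power_add prod.distrib)
qed

lemma mpoly_expand: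
  fixes f :: "('x, 'k::field) mpoly"
  shows "f = (\<Sum>m\<in>Poly_Mapping.keys f. Poly_Mapping.single m (Poly_Mapping.lookup f m))"
proof (rule poly_mapping_eqI)
  fix k
  have "(\<Sum>m\<in>Poly_Mapping.keys f. Poly_Mapping.lookup f m when m = k) = Poly_Mapping.lookup f k"
    by (cases "k \<in> Poly_Mapping.keys f") (auto simp: when_def in_keys_iff)
  then show "Poly_Mapping.lookup f k = Poly_Mapping.lookup (\<Sum>m\<in>Poly_Mapping.keys f. Poly_Mapping.single m (Poly_Mapping.lookup f m)) k"
    by (simp add: lookup_sum lookup_single)
qed

lemma mpoly_eval_mult:
  fixes h :: "'k::field \<Rightarrow> 'b::comm_semiring_1"
  assumes h: "h 0 = 0" "\<And>a b. h (a + b) = h a + h b" "\<And>a b. h (a * b) = h a * h b"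
  shows "mpoly_eval h v (f * g) = mpoly_eval h v f * mpoly_eval h v g"
proof -
  have sum: "mpoly_eval h v (sum F A) = (\<Sum>i\<in>A. mpoly_eval h v (F i))"
    for F :: "'i \<Rightarrow> ('a, 'k) mpoly" and A
    by (induction A rule: infinite_finite_induct)
       (simp_all add: mpoly_eval_add[OF h(1,2)], simp_all add: mpoly_eval_def)
  have single: "mpoly_eval h v (Poly_Mapping.single m c) = h c * (\<Prod>x\<in>Poly_Mapping.keys m. v x ^ Poly_Mapping.lookup m x)"
    for m and c
    by (cases "c = 0") (simp_all add: mpoly_eval_def h)
  have "f * g = (\<Sum>m\<in>Poly_Mapping.keys f. \<Sum>n\<in>Poly_Mapping.keys g.
      Poly_Mapping.single m (Poly_Mapping.lookup f m) * Poly_Mapping.single n (Poly_Mapping.lookup g n))"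
    by (subst mpoly_expand[of f], subst mpoly_expand[of g]) (simp add: sum_product)
  also have "mpoly_eval h v \<dots> = (\<Sum>m\<in>Poly_Mapping.keys f. \<Sum>n\<in>Poly_Mapping.keys g.
      (h (Poly_Mapping.lookup f m) * (\<Prod>x\<in>Poly_Mapping.keys m. v x ^ Poly_Mapping.lookup m x)) *
      (h (Poly_Mapping.lookup g n) * (\<Prod>x\<in>Poly_Mapping.keys n. v x ^ Poly_Mapping.lookup n x)))"
    by (simp add: sum single mult_single monomial_eval_add h mult_ac)
  also have "\<dots> = mpoly_eval h v f * mpoly_eval h v g"
    by (simp add: mpoly_eval_def sum_product)
  finally show ?thesis .
qed

lemma Const_add: "Const (a + b) = Const a + Const b"
  by (simp add: Const_def single_add)

lemma Const_mult: "Const (a * b) = Const a * Const b"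
  by (simp add: Const_def mult_single)

lemma Const_0 [simp]: "Const 0 = 0"
  by (simp add: Const_def)

lemma jet_coeff_add: "jet_coeff s (f + g) j = jet_coeff s f j + jet_coeff s g j"
  by (simp add: jet_coeff_def jet_subst_def mpoly_eval_add Const_add)

lemma jet_coeff_mult: "jet_coeff s (f * g) j = (\<Sum>i\<le>j. jet_coeff s f i * jet_coeff s g (j - i))"
  by (simp add: jet_coeff_def jet_subst_def mpoly_eval_mult Const_add Const_mult Polynomial.coeff_mult)

lemma jet_coeff_0 [simp]: "jet_coeff s 0 j = 0"
  by (simp add: jet_coeff_def jet_subst_def mpoly_eval_def)

lemma jet_coeff_uminus: "jet_coeff s (- f) j = - jet_coeff s f j"
  using jet_coeff_add[of s f "- f" j] by (simp add: eq_neg_iff_add_eq_0 add.commute)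

lemma indets_jet_coeff:
  fixes f :: "('x, 'k::field) mpoly"
  assumes "indets f \<subseteq> X"
  shows "indets (jet_coeff s f j) \<subseteq> jet_vars s X"
proof -
  let ?P = "{p :: ('x \<times> nat, 'k) mpoly poly. \<forall>j. indets (Polynomial.coeff p j) \<subseteq> jet_vars s X}"
  have mult: "p * q \<in> ?P" if "p \<in> ?P" "q \<in> ?P" for p q
    unfolding Polynomial.coeff_mult mem_Collect_eq
  proof (intro allI indets_sum)
    fix j i
    show "indets (Polynomial.coeff p i * Polynomial.coeff q (j - i)) \<subseteq> jet_vars s X"
      using that indets_mult[of "Polynomial.coeff p i" "Polynomial.coeff q (j - i)"] by blast
  qed
  have one: "1 \<in> ?P" by (auto simp: Polynomial.coeff_1)
  have pow: "p ^ n \<in> ?P" if "p \<in> ?P" for p and n :: nat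
  proof (induction n)
    case (Suc n)
    show ?case unfolding power_Suc by (rule mult[OF that Suc.IH])
  qed (simp only: power_0 one)
  have prod: "prod F A \<in> ?P" if "\<And>i. i \<in> A \<Longrightarrow> F i \<in> ?P" for F :: "'i \<Rightarrow> _" and A
    using that
  proof (induction A rule: infinite_finite_induct)
    case (insert i A)
    have "F i * prod F A \<in> ?P" by (intro mult insert.IH insert.prems) simp_all
    then show ?case by (simp only: prod.insert[OF insert.hyps])
  next
    case (infinite A)
    show ?case unfolding prod.infinite[OF infinite.hyps] by (rule one)
  next
    case empty
    show ?case unfolding prod.empty by (rule one)
  qed
  have sum: "sum F A \<in> ?P" if "\<And>i. i \<in> A \<Longrightarrow> F i \<in> ?P" for F :: "'i \<Rightarrow> _" and A
    using that unfolding mem_Collect_eq Polynomial.coeff_sum by (intro allI indets_sum) blast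
  have "jet_subst s f \<in> ?P"
    unfolding jet_subst_def mpoly_eval_def
  proof (intro sum mult prod pow)
    show "[:Const c:] \<in> ?P" for c by (auto simp: Polynomial.coeff_pCons split: nat.splits)
  next
    fix m x i assume "m \<in> Poly_Mapping.keys f" "x \<in> Poly_Mapping.keys m" "i \<in> {0..s}"
    then show "Polynomial.monom (Var (x, i)) i \<in> ?P"
      using assms by (auto simp: indets_def[of f] jet_vars_def)
  qed
  then show ?thesis by (simp add: jet_coeff_def)
qed

lemma jet_ideal_genideal:
  fixes F :: "('x, 'k::field) mpoly set"
  assumes F: "F \<subseteq> carrier (mpoly_ring X)"
  shows "jet_ideal s X (Idl\<^bsub>mpoly_ring X\<^esub> F) =
    Idl\<^bsub>mpoly_ring (jet_vars s X)\<^esub> {jet_coeff s f j | f j. f \<in> F \<and> j \<le> s}"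
proof -
  define R where "R = (mpoly_ring X :: ('x, 'k) mpoly ring)"
  define S where "S = (mpoly_ring (jet_vars s X) :: ('x \<times> nat, 'k) mpoly ring)"
  define G where "G = {jet_coeff s f j | f j. f \<in> F \<and> j \<le> s}"
  define J where "J = Idl\<^bsub>S\<^esub> G"
  define K where "K = {f \<in> carrier R. \<forall>j\<le>s. jet_coeff s f j \<in> J}"
  interpret R: cring R unfolding R_def by (rule cring_mpoly_ring)
  interpret S: cring S unfolding S_def by (rule cring_mpoly_ring)
  have R_simps: "f \<oplus>\<^bsub>R\<^esub> g = f + g" "f \<otimes>\<^bsub>R\<^esub> g = f * g" "\<zero>\<^bsub>R\<^esub> = 0" for f g
    by (simp_all add: R_def)
  have S_simps: "f \<oplus>\<^bsub>S\<^esub> g = f + g" "f \<otimes>\<^bsub>S\<^esub> g = f * g" "\<zero>\<^bsub>S\<^esub> = 0" for f g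
    by (simp_all add: S_def)
  have F': "F \<subseteq> carrier R" using F by (simp only: R_def)
  have carr: "jet_coeff s f j \<in> carrier S" if "f \<in> carrier R" for f j
    using that indets_jet_coeff[of f X s j] by (simp add: R_def S_def)
  have G: "G \<subseteq> carrier S" unfolding G_def using carr F' by blast
  interpret J: ideal J S unfolding J_def by (rule S.genideal_ideal[OF G])
  have Fcarr: "Idl\<^bsub>R\<^esub> F \<subseteq> carrier R"
    using R.genideal_ideal[OF F'] R.genideal_minimal[OF R.oneideal F'] by blast
  have zero: "0 \<in> J" using J.zero_closed by (simp only: S_simps)
  have add: "f + g \<in> J" if "f \<in> J" "g \<in> J" for f g
    using J.a_closed[OF that] by (simp only: S_simps)
  have mul: "g * f \<in> J" if "f \<in> J" "g \<in> carrier S" for f g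
    using J.I_l_closed[OF that] by (simp only: S_simps)
  have sum: "sum h A \<in> J" if "\<And>i. i \<in> A \<Longrightarrow> h i \<in> J" for h :: "nat \<Rightarrow> _" and A
    using that by (induction A rule: infinite_finite_induct) (simp_all add: zero add)
  have K_mult: "g * f \<in> K" if f: "f \<in> K" and g: "g \<in> carrier R" for f g
  proof -
    have "jet_coeff s (g * f) j \<in> J" if "j \<le> s" for j
      unfolding jet_coeff_mult
    proof (intro sum mul carr g)
      fix i
      show "jet_coeff s f (j - i) \<in> J" using f \<open>j \<le> s\<close> by (simp add: K_def)
    qed
    moreover have "g * f \<in> carrier R"
      using R.m_closed[of g f] f g by (simp add: K_def R_simps)
    ultimately show ?thesis by (simp add: K_def)
  qed
  have "ideal K R"
  proof (rule idealI)
    show "ring R" by (rule R.ring_axioms)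
    show "subgroup K (add_monoid R)"
    proof (rule group.subgroupI[OF R.a_group])
      show "K \<subseteq> carrier (add_monoid R)" by (simp add: K_def)
      have "0 \<in> K" using zero R.zero_closed by (simp add: K_def R_simps)
      then show "K \<noteq> {}" by blast
    next
      fix f assume f: "f \<in> K"
      have "Const (-1) \<in> carrier R" by (simp add: R_def)
      from K_mult[OF f this] have neg: "- f \<in> K"
        by (simp add: Const_def single_uminus)
      then have "\<ominus>\<^bsub>R\<^esub> f = - f"
        using R.minus_equality[of "- f" f] f by (simp add: R_simps K_def)
      then show "inv\<^bsub>add_monoid R\<^esub> f \<in> K" using neg by (simp add: a_inv_def)
    next
      fix f g assume f: "f \<in> K" and g: "g \<in> K"
      have "f + g \<in> carrier R"
        using R.a_closed[of f g] f g by (simp add: K_def R_simps)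
      then have "f + g \<in> K" using f g by (simp add: K_def jet_coeff_add add)
      then show "f \<otimes>\<^bsub>add_monoid R\<^esub> g \<in> K" by (simp add: R_simps)
    qed
  next
    fix f g assume "f \<in> K" "g \<in> carrier R"
    from K_mult[OF this] show "g \<otimes>\<^bsub>R\<^esub> f \<in> K" "f \<otimes>\<^bsub>R\<^esub> g \<in> K"
      by (simp_all add: R_simps mult.commute)
  qed
  moreover have "F \<subseteq> K"
    using F' S.genideal_self[OF G] unfolding K_def J_def G_def by blast
  ultimately have "Idl\<^bsub>R\<^esub> F \<subseteq> K" by (rule R.genideal_minimal)
  then have "{jet_coeff s f j | f j. f \<in> Idl\<^bsub>R\<^esub> F \<and> j \<le> s} \<subseteq> J" unfolding K_def by blast
  then have "Idl\<^bsub>S\<^esub> {jet_coeff s f j | f j. f \<in> Idl\<^bsub>R\<^esub> F \<and> j \<le> s} \<subseteq> J"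
    by (rule S.genideal_minimal[OF J.ideal_axioms])
  moreover have "J \<subseteq> Idl\<^bsub>S\<^esub> {jet_coeff s f j | f j. f \<in> Idl\<^bsub>R\<^esub> F \<and> j \<le> s}"
    unfolding J_def
  proof (rule S.subset_Idl_subset)
    show "{jet_coeff s f j | f j. f \<in> Idl\<^bsub>R\<^esub> F \<and> j \<le> s} \<subseteq> carrier S"
      using carr Fcarr by blast
    show "G \<subseteq> {jet_coeff s f j | f j. f \<in> Idl\<^bsub>R\<^esub> F \<and> j \<le> s}"
      unfolding G_def using R.genideal_self[OF F'] by blast
  qed
  ultimately show ?thesis
    unfolding jet_ideal_def J_def G_def R_def S_def by (rule subset_antisym)
qed

end

theory Submission
  imports Defs
begin

text \<open>For a minimal vertex cover \<open>W\<close> let \<open>P\<^sub>W = \<langle>x : x \<in> W\<rangle>\<close>; then \<open>I(C) = \<Inter>\<^sub>W P\<^sub>W\<close>. The local ring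
  of \<open>Z\<close> at \<open>P\<^sub>W\<close> is a field, so the prime \<open>Q\<^sub>W = \<langle>x\<^sub>j : x \<in> W, j \<le> s\<rangle>\<close> lies over a nonsingular point of
  \<open>Z\<close> and is a jet of \<open>Z\<close>; hence \<open>P\<^sub>s(I(C)) \<subseteq> \<Inter>\<^sub>W Q\<^sub>W\<close>, which is the monomial ideal of the theorem.

  Conversely, let \<open>q\<close> be a jet of \<open>Z\<close> over a nonsingular point \<open>p\<close>, and let \<open>e\<close> be an edge. If some
  \<open>x \<in> e\<close> and \<open>u \<notin> p\<close> satisfy \<open>u x \<in> I(C)\<close>, then the jets of \<open>u x\<close> lie in \<open>q\<close> and \<open>u\<^sub>0 \<notin> q\<close>, so inductively
  all \<open>x\<^sub>j\<close> lie in \<open>q\<close>, and with them every \<open>\<Prod>\<^sub>x\<^sub>\<in>\<^sub>e x\<^bsub>i(x)\<^esub>\<close>. To find \<open>x\<close>, let \<open>(A, m)\<close> be the regular local ring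
  at \<open>p\<close>. By Krull's height theorem the bottom of a longest chain of primes of \<open>A\<close> contains no
  element of \<open>m - m\<^sup>2\<close>. This bottom prime contains some \<open>x \<in> e\<close>, so \<open>x \<in> m\<^sup>2\<close>. The derivation \<open>\<partial>/\<partial>x\<close> then
  does not map \<open>I(C)\<close> into \<open>p\<close>, which forces an edge whose only variable in \<open>p\<close> is \<open>x\<close>.\<close>

section \<open>Chains of prime ideals in Noetherian rings\<close>

text \<open>Regularity enters only as a count: \<open>m\<close> has \<open>dim A\<close> generators.
  The usual next step, that \<open>A\<close> is a domain, is bypassed. It suffices that one prime
  lies in every ideal containing the square of \<open>m\<close>, and a chain of primes attaining the
  Krull dimension provides it. Hence no dimension is computed except that of a field.

  Krull's theorems are proved inside \<open>R\<close>: quotients and localizations are replaced by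
  ideals saturated at a prime. The descending chain condition usually quoted for a Noetherian local
  ring with a single prime is derived there too.

  Derivations translate \<open>x \<in> m\<^sup>2\<close> into monomials. They send products of two
  elements of \<open>p\<close> into \<open>p\<close>, while the derivative of \<open>x\<close> is 1
  in every characteristic. A monomial divisible by a further variable from \<open>p\<close> keeps
  that factor when differentiated by \<open>x\<close>, so it cannot account for a derivative outside
  \<open>p\<close>.

  Points are primes, so the field is arbitrary. Upper bounds for the vanishing ideals come from
  testing at \<open>P\<^sub>W\<close> and \<open>Q\<^sub>W\<close> alone, where vanishing is a
  condition on supports of monomials; no Nullstellensatz is involved.\<close>

context cring
begin

lemma ideal_membership:
  assumes "ideal J R"
  shows "a \<in> J \<Longrightarrow> a \<in> carrier R"
    and "\<zero> \<in> J"
    and "a \<in> J \<Longrightarrow> b \<in> J \<Longrightarrow> a \<oplus> b \<in> J"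
    and "a \<in> J \<Longrightarrow> b \<in> J \<Longrightarrow> a \<ominus> b \<in> J"
    and "r \<in> carrier R \<Longrightarrow> a \<in> J \<Longrightarrow> r \<otimes> a \<in> J"
proof -
  interpret ideal J R by fact
  show "a \<in> J \<Longrightarrow> a \<in> carrier R" by (rule a_Hcarr)
  show "\<zero> \<in> J" by simp
  show "a \<in> J \<Longrightarrow> b \<in> J \<Longrightarrow> a \<oplus> b \<in> J" by (rule a_closed)
  show "a \<in> J \<Longrightarrow> b \<in> J \<Longrightarrow> a \<ominus> b \<in> J" by (simp add: a_minus_def)
  show "r \<in> carrier R \<Longrightarrow> a \<in> J \<Longrightarrow> r \<otimes> a \<in> J" by (rule I_l_closed)
qed

lemma ideal_intro:
  assumes "J \<subseteq> carrier R" "\<zero> \<in> J" "\<And>a b. a \<in> J \<Longrightarrow> b \<in> J \<Longrightarrow> a \<oplus> b \<in> J"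
    and l: "\<And>r a. r \<in> carrier R \<Longrightarrow> a \<in> J \<Longrightarrow> r \<otimes> a \<in> J"
  shows "ideal J R"
proof (rule idealI)
  show "ring R" by (rule ring_axioms)
  show "subgroup J (add_monoid R)"
  proof (rule group.subgroupI[OF a_group])
    fix a assume a: "a \<in> J"
    then have "inv\<^bsub>add_monoid R\<^esub> a = (\<ominus> \<one>) \<otimes> a"
      using assms(1) by (simp add: a_inv_def[symmetric] l_minus subset_iff)
    then show "inv\<^bsub>add_monoid R\<^esub> a \<in> J" using l[of "\<ominus> \<one>" a] a by simp
  qed (use assms in auto)
  fix a r assume "a \<in> J" "r \<in> carrier R"
  then show "r \<otimes> a \<in> J" "a \<otimes> r \<in> J"
    using l assms(1) m_comm[of a r] by auto
qed

lemma primeideal_props: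
  assumes "primeideal P R"
  shows "ideal P R" "\<one> \<notin> P"
    and "a \<in> carrier R - P \<Longrightarrow> b \<in> carrier R - P \<Longrightarrow> a \<otimes> b \<in> carrier R - P"
proof -
  interpret primeideal P R by fact
  show "ideal P R" by (rule is_ideal)
  show "\<one> \<notin> P" using I_notcarr one_imp_carrier by blast
  show "a \<in> carrier R - P \<Longrightarrow> b \<in> carrier R - P \<Longrightarrow> a \<otimes> b \<in> carrier R - P"
    using I_prime[of a b] by blast
qed

text \<open>The elements \<open>a \<otimes> g \<oplus> h\<close> already form an ideal containing
  \<open>insert g S\<close>. Splitting off one generator in this way drives the inductions in
  \<open>nakayama_local\<close> and \<open>exchange_generator\<close>.\<close>

lemma Idl_insert:
  assumes "g \<in> carrier R" "S \<subseteq> carrier R" and z: "z \<in> Idl (insert g S)"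
  obtains a h where "a \<in> carrier R" "h \<in> Idl S" "z = a \<otimes> g \<oplus> h"
proof -
  let ?K = "{a \<otimes> g \<oplus> h | a h. a \<in> carrier R \<and> h \<in> Idl S}"
  have S: "ideal (Idl S) R" by (rule genideal_ideal[OF assms(2)])
  note mem = ideal_membership[OF S]
  have "ideal ?K R"
  proof (rule ideal_intro)
    show "?K \<subseteq> carrier R" using mem(1) assms(1) by auto
    show "\<zero> \<in> ?K" using mem(2) assms(1) by (intro CollectI exI[of _ \<zero>]) simp
  next
    fix x y assume "x \<in> ?K" "y \<in> ?K"
    then obtain a h b k where *: "a \<in> carrier R" "h \<in> Idl S" "x = a \<otimes> g \<oplus> h"
      "b \<in> carrier R" "k \<in> Idl S" "y = b \<otimes> g \<oplus> k" by blast
    have "x \<oplus> y = (a \<oplus> b) \<otimes> g \<oplus> (h \<oplus> k)"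
      using * mem(1)[of h] mem(1)[of k] assms(1) by algebra
    then show "x \<oplus> y \<in> ?K" using * mem(3) by blast
  next
    fix r x assume r: "r \<in> carrier R" and "x \<in> ?K"
    then obtain a h where *: "a \<in> carrier R" "h \<in> Idl S" "x = a \<otimes> g \<oplus> h" by blast
    have "r \<otimes> x = (r \<otimes> a) \<otimes> g \<oplus> (r \<otimes> h)"
      using * mem(1)[of h] assms(1) r by algebra
    then show "r \<otimes> x \<in> ?K" using * mem(5) r m_closed by blast
  qed
  moreover have "insert g S \<subseteq> ?K"
  proof
    fix x assume "x \<in> insert g S"
    then consider "x = g" | "x \<in> S" by blast
    then show "x \<in> ?K"
    proof cases
      case 1
      then show ?thesis using mem(2) assms(1) by (intro CollectI exI[of _ \<one>] exI[of _ \<zero>]) simp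
    next
      case 2
      then have "x \<in> Idl S" using genideal_self[OF assms(2)] by blast
      then show ?thesis using mem(1) assms(1) by (intro CollectI exI[of _ \<zero>] exI[of _ x]) simp
    qed
  qed
  ultimately have "z \<in> ?K" using z genideal_minimal by blast
  then show thesis using that by blast
qed

text \<open>The contraction of \<open>J + (x)\<close> from the localization at \<open>P\<close>.\<close>

definition sat_adj :: "'a set \<Rightarrow> 'a set \<Rightarrow> 'a \<Rightarrow> 'a set"
  where "sat_adj P J x =
    {b \<in> carrier R. \<exists>u \<in> carrier R - P. \<exists>r \<in> carrier R. u \<otimes> b \<ominus> r \<otimes> x \<in> J}"

lemma sat_adjI:
  "b \<in> carrier R \<Longrightarrow> u \<in> carrier R - P \<Longrightarrow> r \<in> carrier R \<Longrightarrow> u \<otimes> b \<ominus> r \<otimes> x \<in> J \<Longrightarrow> b \<in> sat_adj P J x"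
  unfolding sat_adj_def by blast

lemma sat_adjE:
  assumes "b \<in> sat_adj P J x"
  obtains u r where "u \<in> carrier R - P" "u \<in> carrier R" "r \<in> carrier R" "b \<in> carrier R" "u \<otimes> b \<ominus> r \<otimes> x \<in> J"
  using assms unfolding sat_adj_def by blast

text \<open>For an ideal \<open>J\<close> and a prime \<open>P\<close> this says that
  \<open>J\<close> is the contraction of its extension to the localization at \<open>P\<close>.
  Ideals of that local ring can thus be handled inside \<open>R\<close>, without fractions.\<close>

definition saturated :: "'a set \<Rightarrow> 'a set \<Rightarrow> bool"
  where "saturated P J \<longleftrightarrow> (\<forall>b \<in> carrier R. \<forall>u \<in> carrier R - P. u \<otimes> b \<in> J \<longrightarrow> b \<in> J)"

lemma saturatedD: "saturated P J \<Longrightarrow> u \<otimes> b \<in> J \<Longrightarrow> b \<in> carrier R \<Longrightarrow> u \<in> carrier R - P \<Longrightarrow> b \<in> J"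
  unfolding saturated_def by blast

context
  fixes P J x
  assumes P: "primeideal P R" and J: "ideal J R" and x: "x \<in> carrier R"
begin

lemma sat_adj_ideal: "ideal (sat_adj P J x) R"
proof (rule ideal_intro)
  note P' = primeideal_props[OF P] and J' = ideal_membership[OF J]
  show "sat_adj P J x \<subseteq> carrier R" by (auto simp: sat_adj_def)
  have "\<one> \<otimes> \<zero> \<ominus> \<zero> \<otimes> x = \<zero>" using x by algebra
  then show "\<zero> \<in> sat_adj P J x" using sat_adjI[of \<zero> \<one> P \<zero> x J] P' J' by simp
next
  note P' = primeideal_props[OF P] and J' = ideal_membership[OF J]
  fix a b assume "a \<in> sat_adj P J x" "b \<in> sat_adj P J x"
  then obtain u r v s where *: "u \<in> carrier R - P" "v \<in> carrier R - P" and
    c: "u \<in> carrier R" "r \<in> carrier R" "a \<in> carrier R" "v \<in> carrier R" "s \<in> carrier R" "b \<in> carrier R"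
    and m: "u \<otimes> a \<ominus> r \<otimes> x \<in> J" "v \<otimes> b \<ominus> s \<otimes> x \<in> J" by (elim sat_adjE)
  have "(u \<otimes> v) \<otimes> (a \<oplus> b) \<ominus> (v \<otimes> r \<oplus> u \<otimes> s) \<otimes> x
      = v \<otimes> (u \<otimes> a \<ominus> r \<otimes> x) \<oplus> u \<otimes> (v \<otimes> b \<ominus> s \<otimes> x)"
    using c x by algebra
  also have "\<dots> \<in> J" by (intro J'(3,5) m c)
  finally show "a \<oplus> b \<in> sat_adj P J x"
    using P'(3)[OF *] c by (intro sat_adjI[of _ "u \<otimes> v" _ "v \<otimes> r \<oplus> u \<otimes> s"]) auto
next
  note P' = primeideal_props[OF P] and J' = ideal_membership[OF J]
  fix w a assume w: "w \<in> carrier R" and "a \<in> sat_adj P J x"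
  then obtain u r where *: "u \<in> carrier R - P" and
    c: "u \<in> carrier R" "r \<in> carrier R" "a \<in> carrier R" 
    and m: "u \<otimes> a \<ominus> r \<otimes> x \<in> J" by (elim sat_adjE)
  have "u \<otimes> (w \<otimes> a) \<ominus> (w \<otimes> r) \<otimes> x = w \<otimes> (u \<otimes> a \<ominus> r \<otimes> x)"
    using c x w by algebra
  also have "\<dots> \<in> J" by (intro J'(5) m w)
  finally show "w \<otimes> a \<in> sat_adj P J x"
    using c w * by (intro sat_adjI[of _ u _ "w \<otimes> r"]) auto
qed

lemma sat_adj_saturated: "saturated P (sat_adj P J x)"
  unfolding saturated_def
proof (intro ballI impI)
  fix b v assume b: "b \<in> carrier R" and v: "v \<in> carrier R - P" and "v \<otimes> b \<in> sat_adj P J x"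
  then obtain u r where *: "u \<in> carrier R - P" and
    c: "u \<in> carrier R" "r \<in> carrier R" and m: "u \<otimes> (v \<otimes> b) \<ominus> r \<otimes> x \<in> J" by (elim sat_adjE)
  have "(u \<otimes> v) \<otimes> b \<ominus> r \<otimes> x \<in> J" using m b v c by (simp add: m_assoc)
  then show "b \<in> sat_adj P J x"
    using b c primeideal_props(3)[OF P * v] by (intro sat_adjI[of _ "u \<otimes> v" _ r])
qed

lemma sat_adj_superset: "J \<subseteq> sat_adj P J x"
proof
  fix b assume b: "b \<in> J"
  then have bc: "b \<in> carrier R" by (rule ideal_membership[OF J])
  have "\<one> \<otimes> b \<ominus> \<zero> \<otimes> x = b" using bc x by algebra
  then show "b \<in> sat_adj P J x"
    using b bc primeideal_props[OF P] by (intro sat_adjI[of _ \<one> _ \<zero>]) auto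
qed

lemma sat_adj_self: "x \<in> sat_adj P J x"
proof -
  have "\<one> \<otimes> x \<ominus> \<one> \<otimes> x = \<zero>" using x by algebra
  then have "\<one> \<otimes> x \<ominus> \<one> \<otimes> x \<in> J" using ideal_membership(2)[OF J] by (simp only:)
  then show "x \<in> sat_adj P J x"
    using x primeideal_props(2)[OF P] by (intro sat_adjI[of _ \<one> _ \<one>]) auto
qed

end

text \<open>Some multiple of \<open>b\<close> by an element outside \<open>P\<close> lies in
  \<open>J + (x)\<close>, and saturation of \<open>I\<close> removes the multiplier. So, for prime
  \<open>P\<close> and an ideal \<open>J\<close>, \<open>sat_adj P J x\<close> is the smallest
  \<open>P\<close>-saturated ideal containing \<open>J\<close> and \<open>x\<close>.\<close>

lemma sat_adj_least:
  assumes "ideal I R" "saturated P I" "J \<subseteq> I" "x \<in> I"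
  shows "sat_adj P J x \<subseteq> I"
proof
  fix b assume "b \<in> sat_adj P J x"
  then obtain u r where *: "u \<in> carrier R - P" and
    c: "u \<in> carrier R" "r \<in> carrier R" "b \<in> carrier R" and m: "u \<otimes> b \<ominus> r \<otimes> x \<in> J" by (elim sat_adjE)
  note I = ideal_membership[OF assms(1)]
  have "u \<otimes> b = (u \<otimes> b \<ominus> r \<otimes> x) \<oplus> r \<otimes> x" using c I(1)[OF assms(4)] by algebra
  also have "\<dots> \<in> I" by (intro I(3,5) subsetD[OF assms(3)] m assms(4) c)
  finally show "b \<in> I" using saturatedD[OF assms(2) _ c(3) *] by blast
qed

end

text \<open>The union of a nonempty chain of ideals is a member of the chain, by the Noetherian
  property, so Zorn's lemma applies to an arbitrary nonempty family.\<close>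

lemma (in noetherian_ring) maximal_ideal_in_family:
  assumes "\<F> \<noteq> {}" "\<And>I. I \<in> \<F> \<Longrightarrow> ideal I R"
  shows "\<exists>M\<in>\<F>. \<forall>I\<in>\<F>. M \<subseteq> I \<longrightarrow> I = M"
proof (rule subset_Zorn)
  fix C assume C: "subset.chain \<F> C"
  show "\<exists>U\<in>\<F>. \<forall>X\<in>C. X \<subseteq> U"
  proof (cases "C = {}")
    case True
    then show ?thesis using assms(1) by auto
  next
    case False
    have "subset.chain {I. ideal I R} C"
      using C assms(2) by (auto simp: subset_chain_def)
    then have "\<Union>C \<in> C" by (rule ideal_chain_is_trivial[OF False])
    moreover have "\<Union>C \<in> \<F>" using C calculation by (auto simp: subset_chain_def)
    ultimately show ?thesis by (intro bexI[of _ "\<Union>C"]) auto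
  qed
qed

section \<open>Nakayama's lemma, the principal ideal theorem and the height theorem\<close>

locale noetherian_cring = noetherian_ring + cring

text \<open>Read in the localization at \<open>P\<close>: if \<open>K\<close> is contained in
  \<open>x K + L\<close> with \<open>x\<close> in the maximal ideal, then \<open>K\<close> is
  contained in \<open>L\<close>. Generators are eliminated one at a time, so no determinants are
  needed.\<close>

lemma (in noetherian_cring) nakayama_local:
  assumes P: "primeideal P R" and x: "x \<in> P" and K: "ideal K R" and L: "ideal L R"
    and KL: "\<And>b. b \<in> K \<Longrightarrow> \<exists>u \<in> carrier R - P. \<exists>r \<in> K. u \<otimes> b \<ominus> x \<otimes> r \<in> L"
    and b: "b \<in> K"
  shows "\<exists>u \<in> carrier R - P. u \<otimes> b \<in> L"
proof -
  note P' = primeideal_props[OF P]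
  note PI = ideal_membership[OF P'(1)] and KI = ideal_membership[OF K] and LI = ideal_membership[OF L]
  have xc: "x \<in> carrier R" using x by (rule PI(1))
  \<comment> \<open>Up to factors outside \<open>P\<close>, the set \<open>G\<close> generates
    \<open>K\<close> modulo \<open>L\<close>. The induction shrinks \<open>G\<close>, and for empty
    \<open>G\<close> the assumption is the conclusion.\<close>
  have claim: "\<forall>b\<in>K. \<exists>u \<in> carrier R - P. u \<otimes> b \<in> L"
    if "finite G" "G \<subseteq> K" "\<forall>b\<in>K. \<exists>u \<in> carrier R - P. u \<otimes> b \<in> Idl (L \<union> G)" for G
    using that
  proof (induction G rule: finite_induct)
    case empty
    have "Idl (L \<union> {}) = L"
      using genideal_minimal[OF L, of L] genideal_self[of L] LI(1) by auto
    with empty show ?case by simp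
  next
    case (insert g H)
    have g: "g \<in> K" "g \<in> carrier R" and LH: "L \<union> H \<subseteq> carrier R"
      using insert.prems(1) KI(1) LI(1) by blast+
    note M = ideal_membership[OF genideal_ideal[OF LH]]
    have LM: "L \<subseteq> Idl (L \<union> H)" using genideal_self[OF LH] by blast
    have split: "\<exists>u a h. u \<in> carrier R - P \<and> a \<in> carrier R \<and> h \<in> Idl (L \<union> H) \<and> u \<otimes> c = a \<otimes> g \<oplus> h"
      if "c \<in> K" for c
    proof -
      from insert.prems(2) that obtain u where u: "u \<in> carrier R - P" "u \<otimes> c \<in> Idl (insert g (L \<union> H))"
        by auto
      from Idl_insert[OF g(2) LH u(2)] obtain a h
        where "a \<in> carrier R" "h \<in> Idl (L \<union> H)" "u \<otimes> c = a \<otimes> g \<oplus> h" .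
      with u(1) show ?thesis by blast
    qed
    from KL[OF g(1)] obtain u r where u: "u \<in> carrier R - P" and r: "r \<in> K" and ur: "u \<otimes> g \<ominus> x \<otimes> r \<in> L"
      by blast
    from split[OF r] obtain v a h where v: "v \<in> carrier R - P" and a: "a \<in> carrier R"
      and h: "h \<in> Idl (L \<union> H)" and vr: "v \<otimes> r = a \<otimes> g \<oplus> h" by blast
    have c: "u \<in> carrier R" "v \<in> carrier R" "r \<in> carrier R" "h \<in> carrier R"
      using u v KI(1)[OF r] M(1)[OF h] by auto
    \<comment> \<open>Inserting the expression for \<open>v \<otimes> r\<close> into the relation
      for \<open>u \<otimes> g\<close> puts \<open>w \<otimes> g\<close> into
      \<open>Idl (L \<union> H)\<close>. As \<open>x\<close> is in \<open>P\<close> and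
      \<open>v \<otimes> u\<close> is not, \<open>w\<close> is outside \<open>P\<close>, so
      \<open>g\<close> is redundant.\<close>
    define w where "w = v \<otimes> u \<ominus> x \<otimes> a"
    have wc: "w \<in> carrier R" unfolding w_def using c a xc by simp
    have "w \<notin> P"
    proof
      assume "w \<in> P"
      have "v \<otimes> u = w \<oplus> a \<otimes> x" unfolding w_def using c a xc by algebra
      also have "\<dots> \<in> P" by (intro PI(3,5) \<open>w \<in> P\<close> x a)
      finally show False using P'(3)[OF v u] by blast
    qed
    with wc have w: "w \<in> carrier R - P" by blast
    have "h = v \<otimes> r \<ominus> a \<otimes> g" unfolding vr using c a g by algebra
    then have "w \<otimes> g = v \<otimes> (u \<otimes> g \<ominus> x \<otimes> r) \<oplus> x \<otimes> h"
      unfolding w_def using c a g xc by algebra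
    also have "\<dots> \<in> Idl (L \<union> H)" by (intro M(3,5) subsetD[OF LM] ur h c xc)
    finally have wg: "w \<otimes> g \<in> Idl (L \<union> H)" .
    have step: "\<exists>u \<in> carrier R - P. u \<otimes> c \<in> Idl (L \<union> H)" if "c \<in> K" for c
    proof -
      from split[OF that] obtain v a h where v: "v \<in> carrier R - P" and a: "a \<in> carrier R"
        and h: "h \<in> Idl (L \<union> H)" and vc: "v \<otimes> c = a \<otimes> g \<oplus> h" by blast
      have cc: "c \<in> carrier R" "h \<in> carrier R" "v \<in> carrier R" using KI(1)[OF that] M(1)[OF h] v by auto
      have "(w \<otimes> v) \<otimes> c = w \<otimes> (v \<otimes> c)" using cc wc by algebra
      also have "\<dots> = a \<otimes> (w \<otimes> g) \<oplus> w \<otimes> h" unfolding vc using cc wc a g by algebra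
      also have "\<dots> \<in> Idl (L \<union> H)" by (intro M(3,5) wg h wc a)
      finally show ?thesis using P'(3)[OF w v] by (rule bexI)
    qed
    show ?case by (rule insert.IH) (use insert.prems(1) step in simp_all)
  qed
  obtain G where G: "G \<subseteq> carrier R" "finite G" "K = Idl G" using finetely_gen[OF K] by blast
  have GK: "G \<subseteq> K" using G genideal_self by blast
  have "\<exists>u \<in> carrier R - P. u \<otimes> b \<in> Idl (L \<union> G)" if "b \<in> K" for b
  proof (rule bexI[of _ \<one>])
    have LG: "L \<union> G \<subseteq> carrier R" using G LI(1) by blast
    then have "G \<subseteq> Idl (L \<union> G)" using genideal_self by blast
    then have "K \<subseteq> Idl (L \<union> G)" unfolding G(3) by (rule genideal_minimal[OF genideal_ideal[OF LG]])
    then show "\<one> \<otimes> b \<in> Idl (L \<union> G)" using that KI(1) by auto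
    show "\<one> \<in> carrier R - P" using P'(2) by blast
  qed
  with claim[OF G(2) GK] b show ?thesis by simp
qed

context noetherian_cring
begin

text \<open>The failing case of the prime insertion below: \<open>P2\<close> is the only prime between \<open>P0 + (x)\<close> and
  \<open>P2\<close>. Then \<open>P2\<close>-saturated ideals above \<open>P0 + (x)\<close> satisfy the descending chain condition,
  by Noetherian induction along one-dimensional socle extensions.\<close>

lemma descending_chain_stationary:
  assumes P2: "primeideal P2 R" 
    and only: "\<And>Q. primeideal Q R \<Longrightarrow> Q \<subseteq> P2 \<Longrightarrow> J \<subseteq> Q \<Longrightarrow> Q = P2"
    and J: "ideal J R" "saturated P2 J"
    and I: "\<And>n. ideal (I n) R" "\<And>n. saturated P2 (I n)" "\<And>n. J \<subseteq> I n" "\<And>n::nat. I (Suc n) \<subseteq> I n"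
  shows "\<exists>n. I (Suc n) = I n"
proof (rule ccontr)
  \<comment> \<open>The ideals above which the descending chain condition fails. A maximal one is
    chosen, so that the condition holds above every strictly larger saturated ideal.\<close>
  define \<F> where "\<F> = {K. ideal K R \<and> saturated P2 K \<and> J \<subseteq> K \<and>
     (\<exists>I::nat \<Rightarrow> 'a set. (\<forall>n. ideal (I n) R \<and> saturated P2 (I n) \<and> K \<subseteq> I n \<and> I (Suc n) \<subset> I n))}"
  note P2' = primeideal_props[OF P2]
  assume "\<nexists>n. I (Suc n) = I n"
  then have "\<And>n. I (Suc n) \<subset> I n" using I(4) by blast
  then have "J \<in> \<F>" using I J unfolding \<F>_def by blast
  then have "\<F> \<noteq> {}" by blast
  moreover have "ideal K R" if "K \<in> \<F>" for K using that by (simp add: \<F>_def)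
  ultimately have "\<exists>K\<in>\<F>. \<forall>L\<in>\<F>. K \<subseteq> L \<longrightarrow> L = K" by (rule maximal_ideal_in_family)
  then obtain K where K: "K \<in> \<F>" and Kmax: "\<forall>L\<in>\<F>. K \<subseteq> L \<longrightarrow> L = K"
    by (rule bexE)
  have Ki: "ideal K R" and Ks: "saturated P2 K" and JK: "J \<subseteq> K"
    using K by (simp_all add: \<F>_def)
  from K obtain I :: "nat \<Rightarrow> 'a set" where
    "\<forall>n. ideal (I n) R \<and> saturated P2 (I n) \<and> K \<subseteq> I n \<and> I (Suc n) \<subset> I n"
    unfolding \<F>_def mem_Collect_eq by (elim conjE exE)
  then have I: "\<And>n. ideal (I n) R" "\<And>n. saturated P2 (I n)" "\<And>n. K \<subseteq> I n" "\<And>n. I (Suc n) \<subset> I n"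
    by simp_all
  note K' = ideal_membership[OF Ki]
  have anti: "I n \<subseteq> I m" if "m \<le> n" for m n
    using that by (induction n rule: dec_induct) (use I(4) in auto)
  have I': "a \<in> carrier R" if "a \<in> I n" for a n using ideal_membership(1)[OF I(1)] that by blast
  from I(4)[of 0] obtain a0 where "a0 \<in> I 0" "a0 \<notin> I 1" by auto
  then have a0: "a0 \<in> carrier R - K" using I(3)[of 1] I' by blast
  \<comment> \<open>Annihilators of elements of \<open>R/K\<close>. A maximal one among those of
    nonzero elements is prime; saturation of \<open>K\<close> puts it below \<open>P2\<close>, so by
    assumption it equals \<open>P2\<close>.\<close>
  define ann where "ann = (\<lambda>a. {r \<in> carrier R. r \<otimes> a \<in> K})"
  have ann_ideal: "ideal (ann a) R" if "a \<in> carrier R" for a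
  proof (rule ideal_intro)
    show "ann a \<subseteq> carrier R" by (auto simp: ann_def)
    show "\<zero> \<in> ann a" using that K'(2) by (simp add: ann_def)
    show "r \<oplus> s \<in> ann a" if "r \<in> ann a" "s \<in> ann a" for r s
      using that \<open>a \<in> carrier R\<close> K'(3) by (simp add: ann_def l_distr)
    show "r \<otimes> s \<in> ann a" if "r \<in> carrier R" "s \<in> ann a" for r s
      using that \<open>a \<in> carrier R\<close> K'(5) by (simp add: ann_def m_assoc)
  qed
  have "ann ` (carrier R - K) \<noteq> {}" using a0 by blast
  moreover have "ideal L R" if "L \<in> ann ` (carrier R - K)" for L using that ann_ideal by blast
  ultimately have "\<exists>M\<in>ann ` (carrier R - K). \<forall>L\<in>ann ` (carrier R - K). M \<subseteq> L \<longrightarrow> L = M"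
    by (rule maximal_ideal_in_family)
  then obtain M where M: "M \<in> ann ` (carrier R - K)"
    and Mmax: "\<forall>L\<in>ann ` (carrier R - K). M \<subseteq> L \<longrightarrow> L = M"
    by (rule bexE)
  from M obtain a where a: "a \<in> carrier R" "a \<notin> K" and Ma: "M = ann a" by blast
  have "primeideal (ann a) R"
  proof (rule primeidealI[OF ann_ideal[OF a(1)] cring_axioms])
    show "carrier R \<noteq> ann a"
    proof
      assume "carrier R = ann a"
      then have "\<one> \<in> ann a" using one_closed by blast
      then show False using a by (simp add: ann_def)
    qed
    fix r s assume r: "r \<in> carrier R" and s: "s \<in> carrier R" and rs: "r \<otimes> s \<in> ann a"
    show "r \<in> ann a \<or> s \<in> ann a"
    proof (rule disjCI)
      assume "s \<notin> ann a"
      then have "s \<otimes> a \<in> carrier R - K" using s a by (simp add: ann_def)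
      moreover have "ann a \<subseteq> ann (s \<otimes> a)"
      proof
        fix t assume t: "t \<in> ann a"
        have "t \<otimes> (s \<otimes> a) = s \<otimes> (t \<otimes> a)" using t s a by (simp add: ann_def m_lcomm)
        then show "t \<in> ann (s \<otimes> a)" using t s K'(5) by (simp add: ann_def)
      qed
      ultimately have "ann (s \<otimes> a) = ann a" using Mmax Ma by blast
      moreover have "r \<in> ann (s \<otimes> a)" using r s rs a by (simp add: ann_def m_assoc)
      ultimately show "r \<in> ann a" by simp
    qed
  qed
  moreover have "ann a \<subseteq> P2" using Ks a by (auto simp: ann_def saturated_def)
  moreover have "J \<subseteq> ann a"
    using JK K' a by (auto simp: ann_def m_comm[of _ a])
  ultimately have annP: "ann a = P2" by (rule only)
  \<comment> \<open>Modulo \<open>K\<close> the element \<open>a\<close> is annihilated by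
    \<open>P2\<close>, so at \<open>P2\<close> the quotient \<open>L/K\<close> is one-dimensional
    over the residue field. A saturated ideal above \<open>K\<close> therefore meets
    \<open>L\<close> in \<open>K\<close> or in \<open>L\<close>.\<close>
  define L where "L = sat_adj P2 K a"
  have L: "ideal L R" "saturated P2 L" "K \<subseteq> L" "a \<in> L"
    unfolding L_def using sat_adj_ideal sat_adj_saturated sat_adj_superset sat_adj_self P2 Ki a by auto
  then have LF: "L \<notin> \<F>" using Kmax a by blast
  \<comment> \<open>The ideals decrease, so membership of \<open>a\<close> is eventually constant.
    From index \<open>k\<close> on, all \<open>I n\<close> have the same intersection with
    \<open>L\<close>.\<close>
  obtain k where k: "(\<forall>n\<ge>k. a \<in> I n) \<or> (\<forall>n\<ge>k. a \<notin> I n)"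
    using anti by (cases "\<forall>n. a \<in> I n") blast+
  have IL: "b \<in> I m" if mk: "k \<le> m" "k \<le> n" and b: "b \<in> I n" "b \<in> L" for m n b
  proof (cases "b \<in> K")
    case True
    then show ?thesis using I(3) by blast
  next
    case False
    from b(2) obtain u r where u: "u \<in> carrier R - P2" "u \<in> carrier R" and r: "r \<in> carrier R"
      and bc: "b \<in> carrier R" and ur: "u \<otimes> b \<ominus> r \<otimes> a \<in> K" unfolding L_def by (rule sat_adjE)
    have "r \<notin> P2"
    proof
      assume "r \<in> P2"
      then have ra: "r \<otimes> a \<in> K" using annP by (auto simp: ann_def)
      have "u \<otimes> b = (u \<otimes> b \<ominus> r \<otimes> a) \<oplus> r \<otimes> a" using u r a bc by algebra
      also have "\<dots> \<in> K" by (intro K'(3) ur ra)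
      finally show False using False saturatedD[OF Ks _ bc u(1)] by blast
    qed
    note In = ideal_membership[OF I(1)[of n]] and Im = ideal_membership[OF I(1)[of m]]
    have "r \<otimes> a = u \<otimes> b \<ominus> (u \<otimes> b \<ominus> r \<otimes> a)" using u r a bc by algebra
    also have "\<dots> \<in> I n" by (intro In(4,5) u b subsetD[OF I(3)] ur)
    finally have "a \<in> I n" using saturatedD[OF I(2) _ a(1)] r \<open>r \<notin> P2\<close> by blast
    then have am: "a \<in> I m" using k mk by blast
    have "u \<otimes> b = (u \<otimes> b \<ominus> r \<otimes> a) \<oplus> r \<otimes> a" using u r a bc by algebra
    also have "\<dots> \<in> I m" by (intro Im(3,5) am r subsetD[OF I(3)] ur)
    finally show ?thesis using saturatedD[OF I(2) _ bc u(1)] by blast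
  qed
  \<comment> \<open>\<open>sup n\<close> is the saturation of \<open>I n + L\<close>. Since
    \<open>L\<close> is strictly larger than \<open>K\<close>, these ideals cannot keep decreasing
    strictly beyond index \<open>k\<close>.\<close>
  define sup where "sup = (\<lambda>n. {b \<in> carrier R. \<exists>u \<in> carrier R - P2. \<exists>c \<in> L. u \<otimes> b \<ominus> c \<in> I n})"
  note L' = ideal_membership[OF L(1)]
  have sup_ideal: "ideal (sup n) R" for n
  proof (rule ideal_intro)
    note In = ideal_membership[OF I(1)[of n]]
    show "sup n \<subseteq> carrier R" by (auto simp: sup_def)
    have "\<one> \<otimes> \<zero> \<ominus> \<zero> = \<zero>" by algebra
    then have "\<one> \<otimes> \<zero> \<ominus> \<zero> \<in> I n" using In(2) by (simp only:)
    then show "\<zero> \<in> sup n" using L'(2) P2'(2) unfolding sup_def by blast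
  next
    fix b b' assume "b \<in> sup n" "b' \<in> sup n"
    then obtain u c u' c' where *: "u \<in> carrier R - P2" "u' \<in> carrier R - P2" and cc: "c \<in> L" "c' \<in> L"
      and m: "u \<otimes> b \<ominus> c \<in> I n" "u' \<otimes> b' \<ominus> c' \<in> I n" and b: "b \<in> carrier R" "b' \<in> carrier R"
      unfolding sup_def by blast
    note In = ideal_membership[OF I(1)[of n]]
    have car: "u \<in> carrier R" "u' \<in> carrier R" "c \<in> carrier R" "c' \<in> carrier R"
      using * L'(1)[OF cc(1)] L'(1)[OF cc(2)] by auto
    have "(u \<otimes> u') \<otimes> (b \<oplus> b') \<ominus> (u' \<otimes> c \<oplus> u \<otimes> c') = u' \<otimes> (u \<otimes> b \<ominus> c) \<oplus> u \<otimes> (u' \<otimes> b' \<ominus> c')"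
      using car b by algebra
    also have "\<dots> \<in> I n" by (intro In(3,5) car m)
    finally have *: "(u \<otimes> u') \<otimes> (b \<oplus> b') \<ominus> (u' \<otimes> c \<oplus> u \<otimes> c') \<in> I n" 
      "u \<otimes> u' \<in> carrier R - P2" using P2'(3)[OF *] by auto
    have "u' \<otimes> c \<oplus> u \<otimes> c' \<in> L" by (intro L'(3,5) car cc)
    with * b show "b \<oplus> b' \<in> sup n" unfolding sup_def by blast
  next
    fix r b assume r: "r \<in> carrier R" and "b \<in> sup n"
    then obtain u c where *: "u \<in> carrier R - P2" and cc: "c \<in> L" 
      and m: "u \<otimes> b \<ominus> c \<in> I n" and b: "b \<in> carrier R" 
      unfolding sup_def by blast
    note In = ideal_membership[OF I(1)[of n]]
    have car: "u \<in> carrier R" "c \<in> carrier R" using * L'(1)[OF cc(1)] by auto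
    have "u \<otimes> (r \<otimes> b) \<ominus> (r \<otimes> c) = r \<otimes> (u \<otimes> b \<ominus> c)"
      using car b r by algebra
    also have "\<dots> \<in> I n" by (intro In(3,5) r m)
    finally have **: "u \<otimes> (r \<otimes> b) \<ominus> (r \<otimes> c) \<in> I n" .
    have "r \<otimes> c \<in> L" by (intro L'(3,5) r cc)
    with * ** b r show "r \<otimes> b \<in> sup n" unfolding sup_def by blast
  qed
  have sup_sat: "saturated P2 (sup n)" for n
    unfolding saturated_def
  proof (intro ballI impI)
    fix b v assume b: "b \<in> carrier R" and v: "v \<in> carrier R - P2" and "v \<otimes> b \<in> sup n"
    then obtain u c where u: "u \<in> carrier R - P2" and cc: "c \<in> L" 
      and m: "u \<otimes> (v \<otimes> b) \<ominus> c \<in> I n" 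
      unfolding sup_def by blast
    then have "(u \<otimes> v) \<otimes> b \<ominus> c \<in> I n" using b v by (simp add: m_assoc)
    then show "b \<in> sup n" using cc b P2'(3)[OF u v] unfolding sup_def by blast
  qed
  have I_sup: "I n \<subseteq> sup n" for n
  proof
    fix b assume b: "b \<in> I n"
    then have bc: "b \<in> carrier R" by (rule I')
    have "\<one> \<otimes> b \<ominus> \<zero> = b" using bc by algebra
    then have "\<one> \<otimes> b \<ominus> \<zero> \<in> I n" using b by (simp only:)
    then show "b \<in> sup n" using L'(2) P2'(2) bc unfolding sup_def by blast
  qed
  have L_sup: "L \<subseteq> sup n" for n
  proof
    fix b assume b: "b \<in> L"
    then have bc: "b \<in> carrier R" by (rule L'(1))
    have "\<one> \<otimes> b \<ominus> b = \<zero>" using bc by algebra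
    then have "\<one> \<otimes> b \<ominus> b \<in> I n" using ideal_membership(2)[OF I(1)] by (simp only:)
    then show "b \<in> sup n" using b P2'(2) bc unfolding sup_def by blast
  qed
  have sup_dec: "sup (Suc n) \<subseteq> sup n" for n
    using anti[of n "Suc n"] unfolding sup_def by (simp add: subset_iff) blast
  have "\<exists>n. sup (Suc (n + k)) = sup (n + k)"
  proof (rule ccontr)
    assume "\<nexists>n. sup (Suc (n + k)) = sup (n + k)"
    then have "sup (Suc n + k) \<subset> sup (n + k)" for n using sup_dec[of "n + k"] by auto
    then have "L \<in> \<F>" using L(1-3) JK sup_ideal sup_sat L_sup unfolding \<F>_def
      by (intro CollectI conjI exI[of _ "\<lambda>n. sup (n + k)"]) auto
    then show False using LF by blast
  qed
  then obtain n where n: "k \<le> n" "sup (Suc n) = sup n" by (metis le_add2)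
  \<comment> \<open>Modular law: the nested ideals \<open>I (Suc n)\<close> and \<open>I n\<close>
    have the same intersection with \<open>L\<close> and the same saturated sum with
    \<open>L\<close>, hence coincide.\<close>
  have "I n \<subseteq> I (Suc n)"
  proof
    fix b assume b: "b \<in> I n"
    then have "b \<in> sup (Suc n)" using I_sup n by blast
    then obtain u c where u: "u \<in> carrier R - P2" and cc: "c \<in> L" 
      and m: "u \<otimes> b \<ominus> c \<in> I (Suc n)" and bc: "b \<in> carrier R"
      unfolding sup_def by blast
    have car: "u \<in> carrier R" "c \<in> carrier R" using u L'(1)[OF cc] by auto
    have "c = u \<otimes> b \<ominus> (u \<otimes> b \<ominus> c)" using car bc by algebra
    also have "\<dots> \<in> I n"
      by (intro ideal_membership(4,5)[OF I(1)] car b subsetD[OF anti[of n "Suc n"]] m) simp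
    finally have "c \<in> I (Suc n)" using IL[OF _ n(1) _ cc, of "Suc n"] n(1) by simp
    have "u \<otimes> b = (u \<otimes> b \<ominus> c) \<oplus> c" using car bc by algebra
    also have "\<dots> \<in> I (Suc n)" by (intro ideal_membership(3)[OF I(1)] m \<open>c \<in> I (Suc n)\<close>)
    finally show "b \<in> I (Suc n)" by (rule saturatedD[OF I(2) _ bc u])
  qed
  with I(4)[of n] show False by blast
qed

text \<open>Krull's principal ideal theorem. With \<open>y \<in> P1 - P0\<close>, the contractions of the powers of \<open>(y)\<close>
  from the localization of \<open>R/P0\<close> at \<open>P1\<close> stabilize modulo \<open>x\<close>, hence stabilize by Nakayama's lemma;
  but then \<open>y\<close> would be a unit at \<open>P1\<close>.\<close>

lemma prime_insertion:
  assumes P: "primeideal P0 R" "primeideal P1 R" "primeideal P2 R" "P0 \<subset> P1" "P1 \<subset> P2"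
    and x: "x \<in> P2"
  obtains P where "primeideal P R" "P0 \<subset> P" "P \<subset> P2" "x \<in> P"
proof (rule ccontr)
  assume "\<not> thesis"
  with that have none: "\<And>Q. primeideal Q R \<Longrightarrow> P0 \<subset> Q \<Longrightarrow> x \<in> Q \<Longrightarrow> Q \<subseteq> P2 \<Longrightarrow> Q = P2"
    by blast
  note P0' = primeideal_props[OF P(1)] and P1' = primeideal_props[OF P(2)]
    and P2' = primeideal_props[OF P(3)]
  note P0i = ideal_membership[OF P0'(1)] and P1i = ideal_membership[OF P1'(1)]
    and P2i = ideal_membership[OF P2'(1)]
  have xP1: "x \<notin> P1" using none[OF P(2,4)] P(5) by blast
  then have xP0: "x \<notin> P0" using P(4) by blast
  have xc: "x \<in> carrier R" by (rule P2i(1)[OF x])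
  from P(4) obtain y where y: "y \<in> P1" "y \<notin> P0" by blast
  have yc: "y \<in> carrier R" by (rule P1i(1)[OF y(1)])
  have ypow: "y [^] n \<in> carrier R - P0" for n :: nat
    using y(2) yc P0'(2,3) by (induction n) auto
  define K where "K = (\<lambda>n::nat. sat_adj P1 P0 (y [^] n))"
  have Ki: "ideal (K n) R" and Ks: "saturated P1 (K n)" and KP0: "P0 \<subseteq> K n" and Ky: "y [^] n \<in> K n" for n
    unfolding K_def using sat_adj_ideal sat_adj_saturated sat_adj_superset sat_adj_self P(2) P0'(1) yc by auto
  have Kc: "b \<in> carrier R" if "b \<in> K n" for b n using ideal_membership(1)[OF Ki that] .
  have Kdec: "K (Suc n) \<subseteq> K n" for n
  proof -
    have "y [^] Suc n \<in> K n" using ideal_membership(5)[OF Ki yc Ky[of n]] yc by (simp add: m_comm)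
    then show ?thesis using sat_adj_least[OF Ki Ks KP0] by (simp add: K_def)
  qed
  define I where "I = (\<lambda>n. sat_adj P2 (K n) x)"
  have Ii: "ideal (I n) R" and Is: "saturated P2 (I n)" and IK: "K n \<subseteq> I n" and Ix: "x \<in> I n" for n
    unfolding I_def using sat_adj_ideal sat_adj_saturated sat_adj_superset sat_adj_self P(3) Ki xc by auto
  \<comment> \<open>The saturation of \<open>P0 + (x)\<close> at \<open>P2\<close>. A prime above
    \<open>J\<close> contains \<open>x\<close> and so differs from \<open>P0\<close>; by
    \<open>none\<close>, \<open>P2\<close> is the only such prime inside \<open>P2\<close>, as
    \<open>descending_chain_stationary\<close> demands.\<close>
  define J where "J = sat_adj P2 P0 x"
  have J: "ideal J R" "saturated P2 J" "P0 \<subseteq> J" "x \<in> J"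
    unfolding J_def using sat_adj_ideal sat_adj_saturated sat_adj_superset sat_adj_self P(3) P0' xc by auto
  have JI: "J \<subseteq> I n" for n
    unfolding J_def using sat_adj_least[OF Ii Is _ Ix] KP0 IK by blast
  have Idec: "I (Suc n) \<subseteq> I n" for n
    using sat_adj_least[OF Ii Is _ Ix, of "K (Suc n)" n] Kdec IK unfolding I_def by blast
  have "\<exists>n. I (Suc n) = I n"
  proof (rule descending_chain_stationary[where J = J and I = I, OF P(3) _ J(1,2) Ii Is JI Idec])
    fix Q assume "primeideal Q R" "Q \<subseteq> P2" "J \<subseteq> Q"
    then show "Q = P2" using none J(3,4) xP0 by blast
  qed
  then obtain n where n: "I (Suc n) = I n" ..
  have "\<exists>u \<in> carrier R - P2. u \<otimes> y [^] n \<in> K (Suc n)"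
  proof (rule nakayama_local[OF P(3) x Ki Ki _ Ky])
    fix b assume b: "b \<in> K n"
    then have "b \<in> I (Suc n)" using n IK by blast
    then obtain u r where u: "u \<in> carrier R - P2" "u \<in> carrier R" and r: "r \<in> carrier R"
      and bc: "b \<in> carrier R" and ur: "u \<otimes> b \<ominus> r \<otimes> x \<in> K (Suc n)" unfolding I_def by (rule sat_adjE)
    note Kn = ideal_membership[OF Ki[of n]]
    \<comment> \<open>The ideal \<open>K n\<close> is saturated at \<open>P1\<close> and
      \<open>x\<close> is outside \<open>P1\<close>, so \<open>x\<close> can be cancelled. This puts
      the coefficient \<open>r\<close> into \<open>K n\<close>, which is what Nakayama's lemma
      requires.\<close>
    have "x \<otimes> r = u \<otimes> b \<ominus> (u \<otimes> b \<ominus> r \<otimes> x)" using u r bc xc by algebra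
    also have "\<dots> \<in> K n" by (intro Kn(4,5) u b subsetD[OF Kdec[of n]] ur)
    finally have "r \<in> K n" using saturatedD[OF Ks _ r] xc xP1 by blast
    moreover have "u \<otimes> b \<ominus> x \<otimes> r \<in> K (Suc n)" using ur xc r by (simp add: m_comm)
    ultimately show "\<exists>u\<in>carrier R - P2. \<exists>r\<in>K n. u \<otimes> b \<ominus> x \<otimes> r \<in> K (Suc n)" using u by blast
  qed
  then obtain u where u: "u \<in> carrier R - P2" "u \<otimes> y [^] n \<in> K (Suc n)" by blast
  have "y [^] n \<in> K (Suc n)"
    using saturatedD[OF Ks u(2)] u(1) P(5) yc by blast
  then obtain t r where t: "t \<in> carrier R - P1" "t \<in> carrier R" and r: "r \<in> carrier R"
    and m: "t \<otimes> y [^] n \<ominus> r \<otimes> y [^] Suc n \<in> P0" unfolding K_def by (rule sat_adjE)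
  have m': "y [^] n \<otimes> (t \<ominus> r \<otimes> y) \<in> P0"
  proof -
    have "y [^] n \<otimes> (t \<ominus> r \<otimes> y) = t \<otimes> y [^] n \<ominus> r \<otimes> (y [^] n \<otimes> y)"
      using t(2) r yc nat_pow_closed[OF yc, of n] by algebra
    then show ?thesis using m by simp
  qed
  have tc: "t \<ominus> r \<otimes> y \<in> carrier R" using t r yc by simp
  \<comment> \<open>The power of \<open>y\<close> lies outside the prime \<open>P0\<close> and
    cancels. Then \<open>t\<close> is a multiple of \<open>y\<close> modulo \<open>P0\<close>, hence
    in \<open>P1\<close>, against its choice.\<close>
  have "t \<ominus> r \<otimes> y \<in> P0"
  proof (rule ccontr)
    assume "t \<ominus> r \<otimes> y \<notin> P0"
    then show False using P0'(3)[OF ypow[of n]] tc m' by blast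
  qed
  then have m1: "t \<ominus> r \<otimes> y \<in> P1" using P(4) by blast
  have "t = (t \<ominus> r \<otimes> y) \<oplus> r \<otimes> y" using t r yc by algebra
  also have "\<dots> \<in> P1" by (intro P1i(3,5) m1 r y)
  finally show False using t by blast
qed

definition prime_chain :: "nat \<Rightarrow> (nat \<Rightarrow> 'a set) \<Rightarrow> bool"
  where "prime_chain n c \<longleftrightarrow> (\<forall>i\<le>n. primeideal (c i) R) \<and> (\<forall>i<n. c i \<subset> c (Suc i))"

text \<open>Descending induction on \<open>k\<close>: once \<open>x\<close> lies in the member of
  index \<open>k + 1\<close>, \<open>prime_insertion\<close> replaces the member of index
  \<open>k\<close> by a prime containing \<open>x\<close>. The bottom has no prime beneath it to
  insert above, whence \<open>1 \<le> k\<close>.\<close>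

lemma prime_chain_shift_element:
  assumes c: "prime_chain n c" and x: "x \<in> c n" and k: "1 \<le> k" "k \<le> n"
  shows "\<exists>c'. prime_chain n c' \<and> c' 0 = c 0 \<and> c' n = c n \<and> x \<in> c' k"
  using k(2,1)
proof (induction k rule: inc_induct)
  case base
  then show ?case using c x by blast
next
  case (step k)
  then obtain d where d: "prime_chain n d" "d 0 = c 0" "d n = c n" "x \<in> d (Suc k)" by auto
  from step obtain j where j: "k = Suc j" by (cases k) auto
  have "primeideal (d j) R" "primeideal (d k) R" "primeideal (d (Suc k)) R" "d j \<subset> d k" "d k \<subset> d (Suc k)"
    using d(1) step(2) j unfolding prime_chain_def by auto
  from prime_insertion[OF this d(4)] obtain P
    where P: "primeideal P R" "d j \<subset> P" "P \<subset> d (Suc k)" "x \<in> P" .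
  have "prime_chain n (d(k := P))"
    using d(1) P j unfolding prime_chain_def by (auto simp: less_Suc_eq)
  moreover have "(d(k := P)) 0 = c 0" "(d(k := P)) n = c n" "x \<in> (d(k := P)) k"
    using d P j step(2) by simp_all
  ultimately show ?case by blast
qed

text \<open>Krull's height theorem: absorb one generator after the other into the second
  member of the chain.\<close>

lemma prime_chain_length_le_card:
  assumes "finite G" "G \<subseteq> carrier R" "prime_chain n c" "G \<subseteq> c n" "c n \<subseteq> Idl (c 0 \<union> G)"
  shows "n \<le> card G"
  using assms
proof (induction G arbitrary: n c rule: finite_induct)
  case empty
  have "primeideal (c 0) R" using empty.prems(2) by (auto simp: prime_chain_def)
  then have c0: "ideal (c 0) R" by (rule primeideal_props)
  have sub: "c n \<subseteq> c 0" using empty.prems(4) genideal_minimal[OF c0, of "c 0"] by auto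
  show ?case
  proof (cases n)
    case (Suc k)
    have "c 0 \<subset> c (Suc i)" if "i \<le> k" for i
      using that
    proof (induction i)
      case 0
      then show ?case using empty.prems(2) Suc by (simp add: prime_chain_def)
    next
      case (Suc i)
      then have "c (Suc i) \<subset> c (Suc (Suc i))"
        using empty.prems(2) \<open>n = Suc k\<close> by (simp add: prime_chain_def)
      with Suc show ?case by auto
    qed
    then have "c 0 \<subset> c n" using Suc by blast
    then show ?thesis using sub by blast
  qed simp
next
  case (insert x G)
  show ?case
  proof (cases n)
    case (Suc k)
    from prime_chain_shift_element[OF insert.prems(2), of x 1] obtain d
      where d: "prime_chain n d" "d 0 = c 0" "d n = c n" "x \<in> d 1"
      using insert.prems(3) Suc by auto
    have pr: "primeideal (d i) R" if "i \<le> n" for i using d(1) that by (simp add: prime_chain_def)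
    have dc: "d i \<subseteq> carrier R" if "i \<le> n" for i
      using ideal_membership(1)[OF primeideal_props(1)[OF pr[OF that]]] by blast
    \<comment> \<open>In the chain from \<open>d 1\<close> upwards \<open>x\<close> already belongs
      to the bottom prime, so the length and the number of generators both drop by one.\<close>
    have "k \<le> card G"
    proof (rule insert.IH[of k "\<lambda>i. d (Suc i)"])
      show "prime_chain k (\<lambda>i. d (Suc i))" using d(1) Suc by (auto simp: prime_chain_def)
      have "d 0 \<subseteq> d 1" using d(1) Suc by (auto simp: prime_chain_def)
      then have "c 0 \<union> insert x G \<subseteq> d 1 \<union> G" using d by auto
      moreover have *: "d 1 \<union> G \<subseteq> carrier R" using dc[of 1] insert.prems(1) Suc by auto
      ultimately have "c 0 \<union> insert x G \<subseteq> Idl (d 1 \<union> G)" using genideal_self by blast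
      then have "Idl (c 0 \<union> insert x G) \<subseteq> Idl (d 1 \<union> G)"
        by (rule genideal_minimal[OF genideal_ideal[OF *]])
      then show "d (Suc k) \<subseteq> Idl (d (Suc 0) \<union> G)" using insert.prems(4) d Suc by auto
    qed (use insert.prems d Suc in auto)
    then show ?thesis using Suc insert.hyps by simp
  qed simp
qed

end

section \<open>Regular local rings\<close>

context noetherian_cring
begin

lemma proper_ideal_in_maximal:
  assumes "ideal I R" "\<one> \<notin> I"
  obtains m where "maximalideal m R" "I \<subseteq> m"
proof -
  define \<F> where "\<F> = {K. ideal K R \<and> \<one> \<notin> K \<and> I \<subseteq> K}"
  have "\<F> \<noteq> {}" using assms by (auto simp: \<F>_def)
  moreover have "ideal K R" if "K \<in> \<F>" for K using that by (simp add: \<F>_def)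
  ultimately have "\<exists>K\<in>\<F>. \<forall>L\<in>\<F>. K \<subseteq> L \<longrightarrow> L = K" by (rule maximal_ideal_in_family)
  then obtain m where m: "m \<in> \<F>" and max: "\<forall>L\<in>\<F>. m \<subseteq> L \<longrightarrow> L = m"
    by (rule bexE)
  have "maximalideal m R"
  proof (rule maximalidealI)
    show "ideal m R" "carrier R \<noteq> m" using m by (auto simp: \<F>_def)
    fix J assume J: "ideal J R" "m \<subseteq> J" "J \<subseteq> carrier R"
    show "J = m \<or> J = carrier R"
    proof (cases "\<one> \<in> J")
      case True
      then show ?thesis using ideal.one_imp_carrier[OF J(1)] by simp
    next
      case False
      then have "J \<in> \<F>" using J m by (auto simp: \<F>_def)
      then show ?thesis using max J(2) by blast
    qed
  qed
  then show thesis using that m by (simp add: \<F>_def)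
qed

lemma unit_outside_unique_maximal:
  assumes uniq: "\<And>n. maximalideal n R \<Longrightarrow> n = m" and a: "a \<in> carrier R" "a \<notin> m"
  obtains b where "b \<in> carrier R" "b \<otimes> a = \<one>"
proof -
  have "\<one> \<in> PIdl a"
  proof (rule ccontr)
    assume "\<one> \<notin> PIdl a"
    then obtain n where "maximalideal n R" "PIdl a \<subseteq> n"
      using proper_ideal_in_maximal[OF cgenideal_ideal[OF a(1)]] by blast
    then show False using uniq cgenideal_self[OF a(1)] a(2) by blast
  qed
  then show thesis using that unfolding cgenideal_def by auto
qed

text \<open>Steinitz exchange over a local ring. If all coefficients of \<open>w\<close> were in
  \<open>m\<close>, then \<open>w\<close> would be a sum of products of two elements of
  \<open>m\<close> and lie in \<open>N\<close>; so some coefficient is a unit and its generator can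
  be solved for.\<close>

lemma exchange_generator:
  assumes "finite G" "G \<subseteq> carrier R" and m: "ideal m R" "G \<subseteq> m"
    and unit: "\<And>a. a \<in> carrier R \<Longrightarrow> a \<notin> m \<Longrightarrow> \<exists>b \<in> carrier R. b \<otimes> a = \<one>"
    and N: "ideal N R" "\<And>a b. a \<in> m \<Longrightarrow> b \<in> m \<Longrightarrow> a \<otimes> b \<in> N"
    and w: "w \<in> Idl G" "w \<notin> N"
  shows "\<exists>g\<in>G. g \<in> Idl (insert w (G - {g}))"
  using assms(1,2,4) w
proof (induction G arbitrary: w rule: finite_induct)
  case empty
  have "{} \<subseteq> {\<zero>}" by simp
  then have "Idl {} \<subseteq> {\<zero>}" by (intro genideal_minimal zeroideal)
  then show ?case using empty ideal_membership(2)[OF N(1)] by auto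
next
  case (insert g H)
  have g: "g \<in> carrier R" "g \<in> m" and H: "H \<subseteq> carrier R" "H \<subseteq> m" using insert.prems by auto
  have wc: "w \<in> carrier R"
    using ideal_membership(1)[OF genideal_ideal[OF insert.prems(1)] insert.prems(3)] .
  from Idl_insert[OF g(1) H(1) insert.prems(3)] obtain a h
    where a: "a \<in> carrier R" and h: "h \<in> Idl H" and wah: "w = a \<otimes> g \<oplus> h" .
  have hc: "h \<in> carrier R" by (rule ideal_membership(1)[OF genideal_ideal[OF H(1)] h])
  show ?case
  proof (cases "a \<in> m")
    case False
    with unit a obtain b where b: "b \<in> carrier R" "b \<otimes> a = \<one>" by blast
    have wH: "insert w H \<subseteq> carrier R" using wc H by simp
    note M = ideal_membership[OF genideal_ideal[OF wH]]
    have "w \<in> Idl (insert w H)" "H \<subseteq> Idl (insert w H)" using genideal_self[OF wH] by auto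
    moreover have "Idl H \<subseteq> Idl (insert w H)"
      by (rule genideal_minimal[OF genideal_ideal[OF wH] calculation(2)])
    ultimately have wh: "w \<in> Idl (insert w H)" "h \<in> Idl (insert w H)" using h by auto
    have "g = (b \<otimes> a) \<otimes> g" using b(2) g by simp
    also have "\<dots> = b \<otimes> (w \<ominus> h)" unfolding wah using a b(1) g hc by algebra
    also have "\<dots> \<in> Idl (insert w H)" by (intro M(4,5) b wh)
    finally show ?thesis using insert.hyps by (intro bexI[of _ g]) auto
  next
    case True
    \<comment> \<open>Here \<open>a \<otimes> g\<close> is in \<open>N\<close>, so \<open>w\<close>
      and \<open>h\<close> agree modulo \<open>N\<close>. The exchange is made inside
      \<open>H\<close> with \<open>h\<close>, and afterwards \<open>h\<close> is rewritten through
      \<open>w\<close> and \<open>g\<close>, which stays a generator.\<close>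
    have "h \<notin> N"
    proof
      assume "h \<in> N"
      then have "w \<in> N" unfolding wah by (intro ideal_membership(3)[OF N(1)] N(2) True g)
      then show False using insert.prems by simp
    qed
    from insert.IH[OF H h this] obtain k where k: "k \<in> H" "k \<in> Idl (insert h (H - {k}))" by blast
    let ?S = "insert w (insert g H - {k})"
    have S: "?S \<subseteq> carrier R" using wc g H by auto
    note M = ideal_membership[OF genideal_ideal[OF S]]
    have "g \<noteq> k" using k insert.hyps by blast
    then have S': "w \<in> Idl ?S" "g \<in> Idl ?S" "H - {k} \<subseteq> Idl ?S" using genideal_self[OF S] by auto
    have "h = w \<ominus> a \<otimes> g" unfolding wah using a g hc by algebra
    also have "\<dots> \<in> Idl ?S" by (intro M(4,5) S' a)
    finally have "insert h (H - {k}) \<subseteq> Idl ?S" using S' by blast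
    then have "Idl (insert h (H - {k})) \<subseteq> Idl ?S" by (rule genideal_minimal[OF genideal_ideal[OF S]])
    then show ?thesis using k by (intro bexI[of _ k]) auto
  qed
qed

end

text \<open>A finite supremum bounds the set, which is then finite and has a maximum. Applied to
  lengths of chains of primes, this yields a chain as long as the Krull dimension.\<close>

lemma enat_SUP_attained:
  assumes "(SUP n\<in>A. enat n) = enat d" "A \<noteq> {}"
  shows "d \<in> A"
proof -
  have fin: "finite A"
  proof (rule finite_subset)
    show "A \<subseteq> {..d}"
    proof
      fix n assume "n \<in> A"
      then have "enat n \<le> (SUP n\<in>A. enat n)" by (rule SUP_upper)
      then show "n \<in> {..d}" using assms(1) by simp
    qed
  qed simp
  then have "(SUP n\<in>A. enat n) = Max (enat ` A)" using assms(2) by (simp add: Max_Sup)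
  also have "\<dots> \<in> enat ` A" using fin assms(2) by (intro Max_in) auto
  finally show ?thesis using assms(1) by auto
qed

text \<open>A prime at the bottom of a chain of maximal length misses every element of \<open>m - m\<^sup>2\<close>,
  for otherwise such an element could replace one of the \<open>dim A\<close> generators of \<open>m\<close>, contrary to
  the height theorem. Here \<open>N\<close> stands for any ideal containing \<open>m\<^sup>2\<close>.\<close>

lemma regular_local_ring_small_prime:
  assumes "regular_local_ring A"
  obtains m q where "maximalideal m A" "primeideal q A" "q \<subseteq> m"
    "\<And>w N. w \<in> q \<Longrightarrow> ideal N A \<Longrightarrow> (\<And>a b. a \<in> m \<Longrightarrow> b \<in> m \<Longrightarrow> a \<otimes>\<^bsub>A\<^esub> b \<in> N) \<Longrightarrow> w \<in> N"
proof -
  interpret A: noetherian_cring A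
    using assms by (auto simp: regular_local_ring_def noetherian_cring_def)
  obtain m G where m: "maximalideal m A" and G: "G \<subseteq> carrier A" "finite G" "m = Idl\<^bsub>A\<^esub> G"
    and dim: "krull_dim A = enat (card G)" and uniq: "\<And>n. maximalideal n A \<Longrightarrow> n = m"
    using assms unfolding regular_local_ring_def by metis
  have mprime: "primeideal m A" by (rule A.maximalideal_prime[OF m])
  note m' = A.primeideal_props[OF mprime]
  have Gm: "G \<subseteq> m" using A.genideal_self[OF G(1)] G(3) by simp
  have unit: "\<exists>b\<in>carrier A. b \<otimes>\<^bsub>A\<^esub> a = \<one>\<^bsub>A\<^esub>" if "a \<in> carrier A" "a \<notin> m" for a
    using A.unit_outside_unique_maximal[OF uniq that] by blast
  let ?D = "{n. \<exists>c. (\<forall>i\<le>n. c i \<in> Spec A) \<and> (\<forall>i<n. c i \<subset> c (Suc i))}"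
  have "0 \<in> ?D" using mprime by (auto simp: Spec_def intro!: exI[of _ "\<lambda>_. m"])
  then have "card G \<in> ?D" using enat_SUP_attained[of ?D "card G"] dim by (auto simp: krull_dim_def)
  then obtain c where "A.prime_chain (card G) c"
    by (auto simp: A.prime_chain_def Spec_def)
  moreover define n where "n = card G"
  ultimately have c: "A.prime_chain n c" by simp
  have cm: "c n \<subseteq> m"
  proof -
    have "primeideal (c n) A" using c by (simp add: A.prime_chain_def)
    note cn = A.primeideal_props[OF this]
    obtain m' where "maximalideal m' A" "c n \<subseteq> m'" by (rule A.proper_ideal_in_maximal[OF cn(1,2)])
    then show ?thesis using uniq by blast
  qed
  \<comment> \<open>The top prime is enlarged to \<open>m\<close>, so that the height theorem can be
    applied to generators of \<open>m\<close>.\<close>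
  define d where "d = c(n := m)"
  have d: "A.prime_chain n d"
    using c cm mprime unfolding A.prime_chain_def d_def by (auto simp: psubset_subset_trans)
  have dn: "d n = m" by (simp add: d_def)
  have d0: "d 0 \<subseteq> m"
  proof -
    have "d i \<subseteq> m" if "i \<le> n" for i
      using that
    proof (induction i rule: inc_induct)
      case base
      then show ?case by (simp add: dn)
    next
      case (step i)
      then show ?case using d by (auto simp: A.prime_chain_def)
    qed
    then show ?thesis by simp
  qed
  have small: "w \<in> N" if w: "w \<in> d 0" and N: "ideal N A" "\<And>a b. a \<in> m \<Longrightarrow> b \<in> m \<Longrightarrow> a \<otimes>\<^bsub>A\<^esub> b \<in> N" for w N
  proof (rule ccontr)
    assume "w \<notin> N"
    have "w \<in> Idl\<^bsub>A\<^esub> G" using w d0 G(3) by blast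
    from A.exchange_generator[OF G(2,1) m'(1) Gm unit N this \<open>w \<notin> N\<close>]
    obtain g where g: "g \<in> G" "g \<in> Idl\<^bsub>A\<^esub> (insert w (G - {g}))" by blast
    \<comment> \<open>Since \<open>w\<close> lies in the bottom prime \<open>d 0\<close>, the
      generator \<open>g\<close> is redundant modulo \<open>d 0\<close>. So
      \<open>card G - 1\<close> elements generate \<open>m\<close> over \<open>d 0\<close>, too few
      for a chain of length \<open>card G\<close>.\<close>
    let ?S = "d 0 \<union> (G - {g})"
    have "d 0 \<subseteq> carrier A"
      using d0 A.ideal_membership(1)[OF m'(1)] by blast
    then have S: "?S \<subseteq> carrier A" using G(1) by blast
    have "insert w (G - {g}) \<subseteq> Idl\<^bsub>A\<^esub> ?S" using A.genideal_self[OF S] w by blast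
    then have "g \<in> Idl\<^bsub>A\<^esub> ?S" using g A.genideal_minimal[OF A.genideal_ideal[OF S]] by blast
    then have "G \<subseteq> Idl\<^bsub>A\<^esub> ?S" using A.genideal_self[OF S] by blast
    then have "m \<subseteq> Idl\<^bsub>A\<^esub> ?S" unfolding G(3) by (rule A.genideal_minimal[OF A.genideal_ideal[OF S]])
    then have "n \<le> card (G - {g})"
      using A.prime_chain_length_le_card[OF _ _ d, of "G - {g}"] G Gm dn by auto
    moreover have "0 < card G" using g(1) G(2) card_gt_0_iff by blast
    ultimately show False using g(1) G(2) by (simp add: n_def)
  qed
  have "primeideal (d 0) A" using d by (simp add: A.prime_chain_def)
  from that[OF m this d0 small] show thesis by blast
qed

section \<open>Localization at a prime\<close>

locale prime_localization = cring R + primeideal P R for R (structure) and P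
begin

abbreviation "M \<equiv> carrier R - P"
abbreviation "fract \<equiv> frac_class R P"
abbreviation "A \<equiv> localization R P"

lemma frac_rel_equiv: "equiv (carrier R \<times> M) (frac_rel R P)"
proof (rule equivI)
  note mult = primeideal_props(3)[OF primeideal_axioms] and one = primeideal_props(2)[OF primeideal_axioms]
  show "frac_rel R P \<subseteq> (carrier R \<times> M) \<times> (carrier R \<times> M)" by (auto simp: frac_rel_def)
  show "refl_on (carrier R \<times> M) (frac_rel R P)"
  proof (rule refl_onI)
    fix x assume "x \<in> carrier R \<times> M"
    then obtain a s where x: "x = (a, s)" "a \<in> carrier R" "s \<in> M" by auto
    have "\<one> \<otimes> (a \<otimes> s \<ominus> a \<otimes> s) = \<zero>" using x by (simp add: r_neg a_minus_def)
    then show "(x, x) \<in> frac_rel R P" using x one unfolding frac_rel_def by blast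
  qed
  show "sym (frac_rel R P)"
  proof (rule symI)
    fix x y assume "(x, y) \<in> frac_rel R P"
    then obtain a s b t u where *: "x = (a, s)" "y = (b, t)" "a \<in> carrier R" "b \<in> carrier R" "s \<in> M" "t \<in> M"
      "u \<in> M" "u \<otimes> (a \<otimes> t \<ominus> b \<otimes> s) = \<zero>" unfolding frac_rel_def by blast
    have c: "s \<in> carrier R" "t \<in> carrier R" "u \<in> carrier R" using * by auto
    have "u \<otimes> (b \<otimes> s \<ominus> a \<otimes> t) = \<ominus> (u \<otimes> (a \<otimes> t \<ominus> b \<otimes> s))" using *(3,4) c by algebra
    then have "u \<otimes> (b \<otimes> s \<ominus> a \<otimes> t) = \<zero>" using *(8) by simp
    then show "(y, x) \<in> frac_rel R P" using * unfolding frac_rel_def by blast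
  qed
  show "trans (frac_rel R P)"
  proof (rule transI)
    fix x y z assume "(x, y) \<in> frac_rel R P" "(y, z) \<in> frac_rel R P"
    then obtain a s b t c w u v where x: "x = (a, s)" "y = (b, t)" "z = (c, w)" and
      r: "a \<in> carrier R" "b \<in> carrier R" "c \<in> carrier R" and
      m: "s \<in> M" "t \<in> M" "w \<in> M" "u \<in> M" "v \<in> M" and
      e: "u \<otimes> (a \<otimes> t \<ominus> b \<otimes> s) = \<zero>" "v \<otimes> (b \<otimes> w \<ominus> c \<otimes> t) = \<zero>"
      unfolding frac_rel_def by blast
    have mc: "s \<in> carrier R" "t \<in> carrier R" "w \<in> carrier R" "u \<in> carrier R" "v \<in> carrier R"
      using m by auto
    \<comment> \<open>The two relations are combined so that the terms in \<open>b\<close> cancel;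
      the middle denominator \<open>t\<close> survives as an additional factor of the
      multiplier.\<close>
    have "(u \<otimes> v \<otimes> t) \<otimes> (a \<otimes> w \<ominus> c \<otimes> s) =
        (v \<otimes> w) \<otimes> (u \<otimes> (a \<otimes> t \<ominus> b \<otimes> s)) \<oplus> (u \<otimes> s) \<otimes> (v \<otimes> (b \<otimes> w \<ominus> c \<otimes> t))"
      using r mc by algebra
    then have "(u \<otimes> v \<otimes> t) \<otimes> (a \<otimes> w \<ominus> c \<otimes> s) = \<zero>" using e mc by simp
    moreover have "u \<otimes> v \<otimes> t \<in> M" by (intro mult m)
    ultimately show "(x, z) \<in> frac_rel R P" using x r m unfolding frac_rel_def by blast
  qed
qed

lemma M_mult: "a \<in> M \<Longrightarrow> b \<in> M \<Longrightarrow> a \<otimes> b \<in> M"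
  and M_one: "\<one> \<in> M"
  using primeideal_props(2,3)[OF primeideal_axioms] by auto

lemma frac_eq_iff:
  assumes "a \<in> carrier R" "s \<in> M" "b \<in> carrier R" "t \<in> M"
  shows "fract a s = fract b t \<longleftrightarrow> (\<exists>u\<in>M. u \<otimes> (a \<otimes> t \<ominus> b \<otimes> s) = \<zero>)"
proof -
  have "fract a s = fract b t \<longleftrightarrow> ((a, s), (b, t)) \<in> frac_rel R P"
    unfolding frac_class_def using eq_equiv_class_iff[OF frac_rel_equiv] assms by simp
  then show ?thesis using assms by (simp add: frac_rel_def)
qed

lemma frac_eqI:
  assumes "a \<in> carrier R" "s \<in> M" "b \<in> carrier R" "t \<in> M" "a \<otimes> t = b \<otimes> s"
  shows "fract a s = fract b t"
  unfolding frac_eq_iff[OF assms(1-4)] using assms M_one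
  by (intro bexI[of _ \<one>]) (auto simp: a_minus_def r_neg)

text \<open>Collapses the unions over representatives in \<open>localization\<close> to one value
  once independence of the representative is known. The class contains \<open>(a, s)\<close>, so the
  union is not empty.\<close>

lemma frac_const_UN:
  assumes "a \<in> carrier R" "s \<in> M"
    and "\<And>a' s'. a' \<in> carrier R \<Longrightarrow> s' \<in> M \<Longrightarrow> fract a' s' = fract a s \<Longrightarrow> F a' s' = X"
  shows "(\<Union>(a', s')\<in>fract a s. F a' s') = X"
proof -
  have self: "(a, s) \<in> fract a s" unfolding frac_class_def
    using equiv_class_self[OF frac_rel_equiv] assms by simp
  have "F a' s' = X" if "(a', s') \<in> fract a s" for a' s'
  proof (rule assms(3))
    have rel: "((a, s), (a', s')) \<in> frac_rel R P" using that by (simp add: frac_class_def)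
    then show "a' \<in> carrier R" "s' \<in> M" by (auto simp: frac_rel_def)
    show "fract a' s' = fract a s" unfolding frac_class_def
      using equiv_class_eq[OF frac_rel_equiv rel] by simp
  qed
  then show ?thesis using self by blast
qed

lemma carrier_localization: "carrier A = {fract a s | a s. a \<in> carrier R \<and> s \<in> M}"
  by (auto simp: localization_def quotient_def frac_class_def)

lemma frac_in_carrier [simp]: "a \<in> carrier R \<Longrightarrow> s \<in> M \<Longrightarrow> fract a s \<in> carrier A"
  by (auto simp: carrier_localization)

lemma frac_mult:
  assumes "a \<in> carrier R" "s \<in> M" "b \<in> carrier R" "t \<in> M"
  shows "fract a s \<otimes>\<^bsub>A\<^esub> fract b t = fract (a \<otimes> b) (s \<otimes> t)"
proof -
  have "fract (a' \<otimes> b') (s' \<otimes> t') = fract (a \<otimes> b) (s \<otimes> t)"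
    if a: "a' \<in> carrier R" "s' \<in> M" "fract a' s' = fract a s"
      and b: "b' \<in> carrier R" "t' \<in> M" "fract b' t' = fract b t" for a' s' b' t'
  proof -
    from a assms obtain u where u: "u \<in> M" "u \<otimes> (a' \<otimes> s \<ominus> a \<otimes> s') = \<zero>" by (auto simp: frac_eq_iff)
    from b assms obtain v where v: "v \<in> M" "v \<otimes> (b' \<otimes> t \<ominus> b \<otimes> t') = \<zero>" by (auto simp: frac_eq_iff)
    have c: "s \<in> carrier R" "s' \<in> carrier R" "t \<in> carrier R" "t' \<in> carrier R" "u \<in> carrier R" "v \<in> carrier R"
      using a b u v assms by auto
    have "(u \<otimes> v) \<otimes> ((a' \<otimes> b') \<otimes> (s \<otimes> t) \<ominus> (a \<otimes> b) \<otimes> (s' \<otimes> t')) =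
        (v \<otimes> b' \<otimes> t) \<otimes> (u \<otimes> (a' \<otimes> s \<ominus> a \<otimes> s')) \<oplus> (u \<otimes> a \<otimes> s') \<otimes> (v \<otimes> (b' \<otimes> t \<ominus> b \<otimes> t'))"
      using c a(1) b(1) assms(1,3) by algebra
    also have "\<dots> = \<zero>" unfolding u v using c a(1) b(1) assms(1,3) by simp
    finally show ?thesis
      using M_mult[OF u(1) v(1)] a b assms M_mult by (subst frac_eq_iff) auto
  qed
  then have inner: "(\<Union>(b', t')\<in>fract b t. fract (a' \<otimes> b') (s' \<otimes> t')) = fract (a \<otimes> b) (s \<otimes> t)"
    if "a' \<in> carrier R" "s' \<in> M" "fract a' s' = fract a s" for a' s'
    using that by (intro frac_const_UN[OF assms(3,4)])
  have "(\<Union>(a', s')\<in>fract a s. \<Union>(b', t')\<in>fract b t. fract (a' \<otimes> b') (s' \<otimes> t')) = fract (a \<otimes> b) (s \<otimes> t)"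
    by (rule frac_const_UN[OF assms(1,2) inner])
  then show ?thesis by (simp add: localization_def)
qed

lemma frac_add:
  assumes "a \<in> carrier R" "s \<in> M" "b \<in> carrier R" "t \<in> M"
  shows "fract a s \<oplus>\<^bsub>A\<^esub> fract b t = fract (a \<otimes> t \<oplus> b \<otimes> s) (s \<otimes> t)"
proof -
  have "fract (a' \<otimes> t' \<oplus> b' \<otimes> s') (s' \<otimes> t') = fract (a \<otimes> t \<oplus> b \<otimes> s) (s \<otimes> t)"
    if a: "a' \<in> carrier R" "s' \<in> M" "fract a' s' = fract a s"
      and b: "b' \<in> carrier R" "t' \<in> M" "fract b' t' = fract b t" for a' s' b' t'
  proof -
    from a assms obtain u where u: "u \<in> M" "u \<otimes> (a' \<otimes> s \<ominus> a \<otimes> s') = \<zero>" by (auto simp: frac_eq_iff)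
    from b assms obtain v where v: "v \<in> M" "v \<otimes> (b' \<otimes> t \<ominus> b \<otimes> t') = \<zero>" by (auto simp: frac_eq_iff)
    have c: "s \<in> carrier R" "s' \<in> carrier R" "t \<in> carrier R" "t' \<in> carrier R" "u \<in> carrier R" "v \<in> carrier R"
      using a b u v assms by auto
    have "(u \<otimes> v) \<otimes> ((a' \<otimes> t' \<oplus> b' \<otimes> s') \<otimes> (s \<otimes> t) \<ominus> (a \<otimes> t \<oplus> b \<otimes> s) \<otimes> (s' \<otimes> t')) =
        (v \<otimes> t \<otimes> t') \<otimes> (u \<otimes> (a' \<otimes> s \<ominus> a \<otimes> s')) \<oplus> (u \<otimes> s \<otimes> s') \<otimes> (v \<otimes> (b' \<otimes> t \<ominus> b \<otimes> t'))"
      using c a(1) b(1) assms(1,3) by algebra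
    also have "\<dots> = \<zero>" unfolding u v using c a(1) b(1) assms(1,3) by simp
    finally show ?thesis
      using M_mult[OF u(1) v(1)] a b assms M_mult c by (subst frac_eq_iff) auto
  qed
  then have inner: "(\<Union>(b', t')\<in>fract b t. fract (a' \<otimes> t' \<oplus> b' \<otimes> s') (s' \<otimes> t')) = fract (a \<otimes> t \<oplus> b \<otimes> s) (s \<otimes> t)"
    if "a' \<in> carrier R" "s' \<in> M" "fract a' s' = fract a s" for a' s'
    using that by (intro frac_const_UN[OF assms(3,4)])
  have "(\<Union>(a', s')\<in>fract a s. \<Union>(b', t')\<in>fract b t. fract (a' \<otimes> t' \<oplus> b' \<otimes> s') (s' \<otimes> t')) = fract (a \<otimes> t \<oplus> b \<otimes> s) (s \<otimes> t)"
    by (rule frac_const_UN[OF assms(1,2) inner])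
  then show ?thesis by (simp add: localization_def)
qed

lemma localization_one: "\<one>\<^bsub>A\<^esub> = fract \<one> \<one>" and localization_zero: "\<zero>\<^bsub>A\<^esub> = fract \<zero> \<one>"
  by (simp_all add: localization_def)

lemma localizationE:
  assumes "x \<in> carrier A"
  obtains a s where "x = fract a s" "a \<in> carrier R" "s \<in> M" "s \<in> carrier R"
  using assms by (auto simp: carrier_localization)

lemma cring_localization: "cring A"
proof (rule cringI)
  show "abelian_group A"
  proof (rule abelian_groupI)
    fix x y assume "x \<in> carrier A" "y \<in> carrier A"
    then obtain a s b t where x: "x = fract a s" "a \<in> carrier R" "s \<in> M" "s \<in> carrier R"
      and y: "y = fract b t" "b \<in> carrier R" "t \<in> M" "t \<in> carrier R" by (elim localizationE)
    show "x \<oplus>\<^bsub>A\<^esub> y \<in> carrier A" using x y M_mult by (simp add: frac_add)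
    have "a \<otimes> t \<oplus> b \<otimes> s = b \<otimes> s \<oplus> a \<otimes> t" "s \<otimes> t = t \<otimes> s" using x y by algebra+
    then show "x \<oplus>\<^bsub>A\<^esub> y = y \<oplus>\<^bsub>A\<^esub> x" using x y by (simp add: frac_add)
  next
    fix x y z assume "x \<in> carrier A" "y \<in> carrier A" "z \<in> carrier A"
    then obtain a s b t c u where x: "x = fract a s" "a \<in> carrier R" "s \<in> M" "s \<in> carrier R"
      and y: "y = fract b t" "b \<in> carrier R" "t \<in> M" "t \<in> carrier R"
      and z: "z = fract c u" "c \<in> carrier R" "u \<in> M" "u \<in> carrier R" by (elim localizationE)
    have e: "(a \<otimes> t \<oplus> b \<otimes> s) \<otimes> u \<oplus> c \<otimes> (s \<otimes> t) = a \<otimes> (t \<otimes> u) \<oplus> (b \<otimes> u \<oplus> c \<otimes> t) \<otimes> s"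
      "s \<otimes> t \<otimes> u = s \<otimes> (t \<otimes> u)" using x y z by algebra+
    have M: "s \<otimes> t \<in> M" "t \<otimes> u \<in> M" using x y z M_mult by auto
    show "x \<oplus>\<^bsub>A\<^esub> y \<oplus>\<^bsub>A\<^esub> z = x \<oplus>\<^bsub>A\<^esub> (y \<oplus>\<^bsub>A\<^esub> z)"
      unfolding x(1) y(1) z(1)
      by (subst frac_add, (use x y z M in simp_all)[4])+ (simp only: e)
  next
    fix x assume "x \<in> carrier A"
    then obtain a s where x: "x = fract a s" "a \<in> carrier R" "s \<in> M" "s \<in> carrier R" by (elim localizationE)
    show "\<zero>\<^bsub>A\<^esub> \<oplus>\<^bsub>A\<^esub> x = x" using x M_one by (simp add: localization_zero frac_add)
    have "fract (\<ominus> a) s \<oplus>\<^bsub>A\<^esub> x = fract ((\<ominus> a) \<otimes> s \<oplus> a \<otimes> s) (s \<otimes> s)" using x by (simp add: frac_add)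
    also have "(\<ominus> a) \<otimes> s \<oplus> a \<otimes> s = \<zero>" using x(2,4) by algebra
    also have "fract \<zero> (s \<otimes> s) = fract \<zero> \<one>" using x M_mult M_one by (intro frac_eqI) auto
    finally show "\<exists>y\<in>carrier A. y \<oplus>\<^bsub>A\<^esub> x = \<zero>\<^bsub>A\<^esub>" 
      using x by (intro bexI[of _ "fract (\<ominus> a) s"]) (simp_all add: localization_zero)
  qed (use M_one in \<open>simp add: localization_zero\<close>)
  show "comm_monoid A"
  proof (rule comm_monoidI)
    fix x y assume "x \<in> carrier A" "y \<in> carrier A"
    then obtain a s b t where x: "x = fract a s" "a \<in> carrier R" "s \<in> M" "s \<in> carrier R"
      and y: "y = fract b t" "b \<in> carrier R" "t \<in> M" "t \<in> carrier R" by (elim localizationE)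
    show "x \<otimes>\<^bsub>A\<^esub> y \<in> carrier A" using x y M_mult by (simp add: frac_mult)
    show "x \<otimes>\<^bsub>A\<^esub> y = y \<otimes>\<^bsub>A\<^esub> x" using x y by (simp add: frac_mult m_comm)
  next
    fix x y z assume "x \<in> carrier A" "y \<in> carrier A" "z \<in> carrier A"
    then obtain a s b t c u where x: "x = fract a s" "a \<in> carrier R" "s \<in> M" "s \<in> carrier R"
      and y: "y = fract b t" "b \<in> carrier R" "t \<in> M" "t \<in> carrier R"
      and z: "z = fract c u" "c \<in> carrier R" "u \<in> M" "u \<in> carrier R" by (elim localizationE)
    have M: "s \<otimes> t \<in> M" "t \<otimes> u \<in> M" using x y z M_mult by auto
    show "x \<otimes>\<^bsub>A\<^esub> y \<otimes>\<^bsub>A\<^esub> z = x \<otimes>\<^bsub>A\<^esub> (y \<otimes>\<^bsub>A\<^esub> z)"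
      using x y z M by (simp add: frac_mult m_assoc)
  next
    fix x assume "x \<in> carrier A"
    then obtain a s where x: "x = fract a s" "a \<in> carrier R" "s \<in> M" "s \<in> carrier R" by (elim localizationE)
    show "\<one>\<^bsub>A\<^esub> \<otimes>\<^bsub>A\<^esub> x = x" using x M_one by (simp add: localization_one frac_mult)
  qed (use M_one in \<open>simp add: localization_one\<close>)
  fix x y z assume "x \<in> carrier A" "y \<in> carrier A" "z \<in> carrier A"
  then obtain a s b t c u where x: "x = fract a s" "a \<in> carrier R" "s \<in> M" "s \<in> carrier R"
    and y: "y = fract b t" "b \<in> carrier R" "t \<in> M" "t \<in> carrier R"
    and z: "z = fract c u" "c \<in> carrier R" "u \<in> M" "u \<in> carrier R" by (elim localizationE)
  have M: "s \<otimes> t \<in> M" "t \<otimes> u \<in> M" "s \<otimes> u \<in> M" "s \<otimes> t \<otimes> u \<in> M" "s \<otimes> u \<otimes> (t \<otimes> u) \<in> M"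
    using x y z M_mult by auto
  have "(a \<otimes> t \<oplus> b \<otimes> s) \<otimes> c \<otimes> (s \<otimes> u \<otimes> (t \<otimes> u)) =
      (a \<otimes> c \<otimes> (t \<otimes> u) \<oplus> b \<otimes> c \<otimes> (s \<otimes> u)) \<otimes> (s \<otimes> t \<otimes> u)"
    using x(2,4) y(2,4) z(2,4) by algebra
  then have "fract ((a \<otimes> t \<oplus> b \<otimes> s) \<otimes> c) (s \<otimes> t \<otimes> u) = fract (a \<otimes> c \<otimes> (t \<otimes> u) \<oplus> b \<otimes> c \<otimes> (s \<otimes> u)) (s \<otimes> u \<otimes> (t \<otimes> u))"
    using x y z M by (intro frac_eqI) auto
  then show "(x \<oplus>\<^bsub>A\<^esub> y) \<otimes>\<^bsub>A\<^esub> z = x \<otimes>\<^bsub>A\<^esub> z \<oplus>\<^bsub>A\<^esub> y \<otimes>\<^bsub>A\<^esub> z"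
    using x y z M by (simp add: frac_mult frac_add)
qed

lemma frac_zero_iff:
  assumes "a \<in> carrier R" "s \<in> M"
  shows "fract a s = \<zero>\<^bsub>A\<^esub> \<longleftrightarrow> (\<exists>u\<in>M. u \<otimes> a = \<zero>)"
proof -
  have "a \<otimes> \<one> \<ominus> \<zero> \<otimes> s = a" using assms by (simp add: a_minus_def)
  then show ?thesis
    using frac_eq_iff[OF assms, of \<zero> \<one>] M_one by (simp add: localization_zero)
qed

lemma frac_inverse:
  assumes "s \<in> M" "t \<in> M"
  shows "fract t s \<otimes>\<^bsub>A\<^esub> fract s t = \<one>\<^bsub>A\<^esub>"
proof -
  have "fract (t \<otimes> s) (s \<otimes> t) = fract \<one> \<one>"
    using assms M_mult M_one by (intro frac_eqI) (auto simp: m_comm)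
  then show ?thesis using assms by (simp add: frac_mult localization_one)
qed

text \<open>A fraction with numerator outside \<open>P\<close> is a unit. Applied to a maximal
  ideal, this gives all that is needed about it without computing it.\<close>

lemma proper_ideal_localization:
  assumes I: "ideal I A" "\<one>\<^bsub>A\<^esub> \<notin> I" and x: "x \<in> I"
  obtains a s where "x = fract a s" "a \<in> P" "s \<in> M"
proof -
  interpret A: cring A by (rule cring_localization)
  note I' = A.ideal_membership[OF I(1)]
  from I'(1)[OF x] obtain a s where a: "x = fract a s" "a \<in> carrier R" "s \<in> M" by (rule localizationE)
  have "a \<in> P"
  proof (rule ccontr)
    assume "a \<notin> P"
    then have "fract s a \<otimes>\<^bsub>A\<^esub> x = \<one>\<^bsub>A\<^esub>" using a frac_inverse[of a s] by simp
    moreover have "fract s a \<otimes>\<^bsub>A\<^esub> x \<in> I" using a \<open>a \<notin> P\<close> by (intro I'(5) x frac_in_carrier) auto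
    ultimately show False using I(2) by simp
  qed
  with a that show thesis by blast
qed

text \<open>The assumption says that \<open>P\<close> becomes zero in the localization, while
  fractions with numerator outside \<open>P\<close> are units.\<close>

lemma field_localization:
  assumes "\<And>a. a \<in> P \<Longrightarrow> \<exists>u\<in>M. u \<otimes> a = \<zero>"
  shows "field A"
proof -
  interpret A: cring A by (rule cring_localization)
  have "\<one>\<^bsub>A\<^esub> \<noteq> \<zero>\<^bsub>A\<^esub>"
  proof
    assume "\<one>\<^bsub>A\<^esub> = \<zero>\<^bsub>A\<^esub>"
    then obtain u where "u \<in> M" "u \<otimes> \<one> = \<zero>"
      using frac_zero_iff[of \<one> \<one>] M_one by (auto simp: localization_one)
    then show False using additive_subgroup.zero_closed[OF additive_subgroup_axioms] by auto
  qed
  moreover have "x \<in> Units A" if x: "x \<in> carrier A" "x \<noteq> \<zero>\<^bsub>A\<^esub>" for x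
  proof -
    from x(1) obtain a s where a: "x = fract a s" "a \<in> carrier R" "s \<in> M" by (rule localizationE)
    then have "a \<notin> P" using x(2) assms frac_zero_iff by blast
    then have "a \<in> M" using a by blast
    then show ?thesis using a frac_inverse[of a s] frac_inverse[of s a] x(1)
      unfolding Units_def by (intro CollectI conjI bexI[of _ "fract s a"]) auto
  qed
  moreover have "\<zero>\<^bsub>A\<^esub> \<notin> Units A" if "\<one>\<^bsub>A\<^esub> \<noteq> \<zero>\<^bsub>A\<^esub>"
    using that by (auto simp: Units_def)
  ultimately have "Units A = carrier A - {\<zero>\<^bsub>A\<^esub>}" by blast
  then show ?thesis by (rule A.cring_fieldI)
qed

end

text \<open>The zero ideal is the only prime, so the dimension is 0, and the maximal ideal is
  generated by the empty set.\<close>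

lemma regular_local_ring_field:
  assumes "field K"
  shows "regular_local_ring K"
proof -
  interpret field K by fact
  have Idl0: "Idl\<^bsub>K\<^esub> {} = {\<zero>\<^bsub>K\<^esub>}"
    using genideal_minimal[OF zeroideal, of "{}"] ideal_membership(2)[OF genideal_ideal[of "{}"]] by auto
  have ideals: "I = {\<zero>\<^bsub>K\<^esub>} \<or> I = carrier K" if "ideal I K" for I
    using all_ideals that by blast
  have max: "n = {\<zero>\<^bsub>K\<^esub>}" if "maximalideal n K" for n
  proof -
    interpret maximalideal n K by fact
    show ?thesis using ideals[OF is_ideal] I_notcarr by blast
  qed
  have spec: "Spec K = {{\<zero>\<^bsub>K\<^esub>}}"
  proof -
    have "p = {\<zero>\<^bsub>K\<^esub>}" if "primeideal p K" for p
    proof -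
      interpret primeideal p K by fact
      show ?thesis using ideals[OF is_ideal] I_notcarr by blast
    qed
    then have "primeideal p K \<longleftrightarrow> p = {\<zero>\<^bsub>K\<^esub>}" for p using zeroprimeideal by metis
    then show ?thesis by (simp add: Spec_def)
  qed
  let ?D = "{n. \<exists>c. (\<forall>i\<le>n. c i \<in> Spec K) \<and> (\<forall>i<n. c i \<subset> c (Suc i))}"
  have "n = 0" if "\<forall>i\<le>n. c i \<in> Spec K" "\<forall>i<n. c i \<subset> c (Suc i)" for c and n :: nat
  proof (rule ccontr)
    assume "n \<noteq> 0"
    then have "c 0 \<subset> c 1" "c 0 \<in> Spec K" "c 1 \<in> Spec K" using that by auto
    then show False by (simp add: spec)
  qed
  then have "?D \<subseteq> {0}" by blast
  moreover have "0 \<in> ?D" by (auto simp: spec intro!: exI[of _ "\<lambda>_. {\<zero>\<^bsub>K\<^esub>}"])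
  ultimately have "?D = {0}" by (intro equalityI) simp_all
  then have dim: "krull_dim K = enat 0" by (simp add: krull_dim_def)
  have "noetherian_ring K"
  proof (rule noetherian_ringI)
    fix I assume "ideal I K"
    then consider "I = Idl\<^bsub>K\<^esub> {}" | "I = Idl\<^bsub>K\<^esub> {\<one>\<^bsub>K\<^esub>}" using ideals Idl0 genideal_one by auto
    then show "\<exists>A\<subseteq>carrier K. finite A \<and> I = Idl\<^bsub>K\<^esub> A"
    proof cases
      case 1
      then show ?thesis by (intro exI[of _ "{}"]) simp
    next
      case 2
      then show ?thesis by (intro exI[of _ "{\<one>\<^bsub>K\<^esub>}"]) simp
    qed
  qed
  moreover have "\<exists>!m. maximalideal m K" using zeromaximalideal max by blast
  ultimately show ?thesis
    unfolding regular_local_ring_def using is_cring zeromaximalideal dim Idl0[symmetric]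
    by (intro conjI exI[of _ "{\<zero>\<^bsub>K\<^esub>}"] exI[of _ "{}"]) auto
qed

section \<open>Derivations and the local ring of a quotient at a prime\<close>

definition (in cring) derivation :: "('a \<Rightarrow> 'a) \<Rightarrow> bool"
  where "derivation D \<longleftrightarrow> (\<forall>a\<in>carrier R. D a \<in> carrier R) \<and>
    (\<forall>a\<in>carrier R. \<forall>b\<in>carrier R. D (a \<oplus> b) = D a \<oplus> D b \<and> D (a \<otimes> b) = a \<otimes> D b \<oplus> b \<otimes> D a)"

locale quotient_at_prime = cring R for R (structure) +
  fixes I p
  assumes I: "ideal I R" and p: "primeideal p R" and Ip: "I \<subseteq> p"
begin

text \<open>Written exactly as the image of \<open>p\<close> in \<open>sing_locus\<close>, so that
  the localization of \<open>B\<close> at \<open>pbar\<close> is the ring whose regularity is tested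
  there.\<close>

definition "pbar = (\<lambda>a. I +> a) ` p"

abbreviation "B \<equiv> R Quot I"

lemmas p_props = primeideal_props[OF p]
lemmas p_mem = ideal_membership[OF p_props(1)]
lemmas I_mem = ideal_membership[OF I]

lemma cring_B: "cring B"
  by (rule ideal.quotient_is_cring[OF I is_cring])

lemma coset_hom: "ring_hom_cring R B ((+>) I)"
  using ideal.rcos_ring_hom_cring[OF I is_cring] .

lemma carrier_B: "carrier B = (\<lambda>a. I +> a) ` carrier R"
  by (auto simp: FactRing_def A_RCOSETS_def')

lemma coset_closed [simp]: "a \<in> carrier R \<Longrightarrow> I +> a \<in> carrier B"
  by (simp add: carrier_B)

lemma coset_ops:
  assumes "a \<in> carrier R" "b \<in> carrier R"
  shows "(I +> a) \<otimes>\<^bsub>B\<^esub> (I +> b) = I +> (a \<otimes> b)" "(I +> a) \<oplus>\<^bsub>B\<^esub> (I +> b) = I +> (a \<oplus> b)"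
    "(I +> a) \<ominus>\<^bsub>B\<^esub> (I +> b) = I +> (a \<ominus> b)" "\<one>\<^bsub>B\<^esub> = I +> \<one>"
proof -
  interpret h: ring_hom_cring R B "(+>) I" by (rule coset_hom)
  show "(I +> a) \<otimes>\<^bsub>B\<^esub> (I +> b) = I +> (a \<otimes> b)" "(I +> a) \<oplus>\<^bsub>B\<^esub> (I +> b) = I +> (a \<oplus> b)"
    "\<one>\<^bsub>B\<^esub> = I +> \<one>" using assms by simp_all
  show "(I +> a) \<ominus>\<^bsub>B\<^esub> (I +> b) = I +> (a \<ominus> b)" using assms by (simp add: a_minus_def)
qed

lemma coset_zero_iff: "a \<in> carrier R \<Longrightarrow> I +> a = \<zero>\<^bsub>B\<^esub> \<longleftrightarrow> a \<in> I"
  using ideal.rcos_const_imp_mem[OF I] a_rcos_zero[OF I] by (auto simp: FactRing_def)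

lemma coset_in_pbar_iff:
  assumes "a \<in> carrier R"
  shows "I +> a \<in> pbar \<longleftrightarrow> a \<in> p"
proof
  assume "I +> a \<in> pbar"
  then obtain b where b: "b \<in> p" "I +> a = I +> b" by (auto simp: pbar_def)
  have bc: "b \<in> carrier R" by (rule p_mem(1)[OF b(1)])
  have "a \<ominus> b \<in> I" using b(2) quotient_eq_iff_same_a_r_cos[OF I assms bc] by simp
  then have "a \<ominus> b \<in> p" using Ip by blast
  moreover have "a = (a \<ominus> b) \<oplus> b" using assms bc by algebra
  ultimately show "a \<in> p" using p_mem(3)[of "a \<ominus> b" b] b(1) by simp
qed (simp add: pbar_def)

lemma pbar_prime: "primeideal pbar B"
proof (rule primeidealI)
  interpret B: cring B by (rule cring_B)
  show "ideal pbar B"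
  proof (rule B.ideal_intro)
    show "pbar \<subseteq> carrier B" using p_mem(1) by (auto simp: pbar_def)
    show "\<zero>\<^bsub>B\<^esub> \<in> pbar" using coset_zero_iff[of \<zero>] I_mem(2) p_mem(2) unfolding pbar_def by (metis image_eqI zero_closed)
    show "x \<oplus>\<^bsub>B\<^esub> y \<in> pbar" if xy: "x \<in> pbar" "y \<in> pbar" for x y
    proof -
      from xy obtain a b where a: "a \<in> p" "x = I +> a" and b: "b \<in> p" "y = I +> b" by (auto simp: pbar_def)
      then show ?thesis using p_mem(1)[OF a(1)] p_mem(1)[OF b(1)] p_mem(3)[OF a(1) b(1)]
        by (simp add: coset_ops coset_in_pbar_iff)
    qed
    show "r \<otimes>\<^bsub>B\<^esub> x \<in> pbar" if rx: "r \<in> carrier B" "x \<in> pbar" for r x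
    proof -
      from rx obtain a b where a: "a \<in> carrier R" "r = I +> a" and b: "b \<in> p" "x = I +> b" 
        by (auto simp: pbar_def carrier_B)
      then show ?thesis using p_mem(1)[OF b(1)] p_mem(5)[OF a(1) b(1)]
        by (simp add: coset_ops coset_in_pbar_iff)
    qed
  qed
  show "cring B" by (rule cring_B)
  show "carrier B \<noteq> pbar"
  proof
    assume "carrier B = pbar"
    then have "I +> \<one> \<in> pbar" using coset_closed[of \<one>] by simp
    then show False using p_props(2) by (simp add: coset_in_pbar_iff)
  qed
  fix x y assume "x \<in> carrier B" "y \<in> carrier B" "x \<otimes>\<^bsub>B\<^esub> y \<in> pbar"
  then obtain a b where *: "a \<in> carrier R" "x = I +> a" "b \<in> carrier R" "y = I +> b" "a \<otimes> b \<in> p"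
    by (auto simp: carrier_B coset_ops coset_in_pbar_iff)
  then show "x \<in> pbar \<or> y \<in> pbar"
    using p_props(3)[of a b] by (auto simp: coset_in_pbar_iff)
qed

sublocale loc: prime_localization B pbar
  unfolding prime_localization_def using cring_B pbar_prime by simp

text \<open>Fractions of \<open>B\<close> through representatives in \<open>R\<close>: computations
  in the local ring become computations in \<open>R\<close> modulo \<open>I\<close>.\<close>

definition frc where "frc a s = loc.fract (I +> a) (I +> s)"

lemma coset_in_M: "s \<in> carrier R - p \<Longrightarrow> I +> s \<in> loc.M"
  by (simp add: coset_in_pbar_iff)

lemma loc_M: "loc.M = (\<lambda>a. I +> a) ` (carrier R - p)"
  by (auto simp: carrier_B coset_in_pbar_iff)

lemma frc_simps:
  assumes "a \<in> carrier R" "s \<in> carrier R - p" "b \<in> carrier R" "t \<in> carrier R - p"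
  shows "frc a s \<otimes>\<^bsub>loc.A\<^esub> frc b t = frc (a \<otimes> b) (s \<otimes> t)"
    "frc a s \<oplus>\<^bsub>loc.A\<^esub> frc b t = frc (a \<otimes> t \<oplus> b \<otimes> s) (s \<otimes> t)"
  unfolding frc_def using assms coset_in_M[OF assms(2)] coset_in_M[OF assms(4)]
  by (simp_all add: loc.frac_mult loc.frac_add coset_ops)

lemma frc_closed: "a \<in> carrier R \<Longrightarrow> s \<in> carrier R - p \<Longrightarrow> frc a s \<in> carrier loc.A"
  unfolding frc_def using coset_in_M by (intro loc.frac_in_carrier) auto

lemma frc_cases:
  assumes "x \<in> carrier loc.A"
  obtains a s where "a \<in> carrier R" "s \<in> carrier R - p" "x = frc a s"
proof -
  from assms obtain a' s' where x: "x = loc.fract a' s'" "a' \<in> carrier B" "s' \<in> loc.M"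
    by (rule loc.localizationE)
  from x(2) obtain a where a: "a \<in> carrier R" "a' = I +> a" unfolding carrier_B by blast
  from x(3) obtain s where s: "s \<in> carrier R - p" "s' = I +> s" unfolding loc_M by blast
  show thesis by (rule that[OF a(1) s(1)]) (simp add: x a s frc_def)
qed

lemma frc_eq_iff:
  assumes "a \<in> carrier R" "s \<in> carrier R - p" "b \<in> carrier R" "t \<in> carrier R - p"
  shows "frc a s = frc b t \<longleftrightarrow> (\<exists>u\<in>carrier R - p. u \<otimes> (a \<otimes> t \<ominus> b \<otimes> s) \<in> I)"
proof -
  have "frc a s = frc b t \<longleftrightarrow> (\<exists>u\<in>carrier R - p. (I +> u) \<otimes>\<^bsub>B\<^esub> ((I +> a) \<otimes>\<^bsub>B\<^esub> (I +> t) \<ominus>\<^bsub>B\<^esub> (I +> b) \<otimes>\<^bsub>B\<^esub> (I +> s)) = \<zero>\<^bsub>B\<^esub>)"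
    unfolding frc_def using assms coset_in_M[OF assms(2)] coset_in_M[OF assms(4)]
    by (subst loc.frac_eq_iff) (auto simp: loc_M)
  also have "\<dots> \<longleftrightarrow> (\<exists>u\<in>carrier R - p. u \<otimes> (a \<otimes> t \<ominus> b \<otimes> s) \<in> I)"
    using assms by (intro bex_cong refl) (simp add: coset_ops coset_zero_iff)
  finally show ?thesis .
qed

lemma frc_zero: "s \<in> carrier R - p \<Longrightarrow> a \<in> I \<Longrightarrow> frc a s = \<zero>\<^bsub>loc.A\<^esub>"
  using loc.frac_zero_iff[of "I +> a" "I +> s"] coset_in_M[of s] coset_zero_iff[of a] I_mem(1)[of a]
    loc.M_one loc.r_null[of "\<one>\<^bsub>B\<^esub>"] unfolding frc_def by auto

text \<open>The condition makes the image of \<open>p\<close> vanish in the local ring, which is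
  therefore a field. It is met by the primes of minimal vertex covers.\<close>

lemma regular_if_minimal:
  assumes "\<And>a. a \<in> p \<Longrightarrow> \<exists>u\<in>carrier R - p. u \<otimes> a \<in> I"
  shows "regular_local_ring loc.A"
proof (rule regular_local_ring_field, rule loc.field_localization)
  fix x assume "x \<in> pbar"
  then obtain a where a: "a \<in> p" "x = I +> a" by (auto simp: pbar_def)
  from assms[OF a(1)] obtain u where u: "u\<in>carrier R - p" "u \<otimes> a \<in> I" by blast
  have "(I +> u) \<otimes>\<^bsub>B\<^esub> x = \<zero>\<^bsub>B\<^esub>" using u a p_mem(1)[OF a(1)] by (simp add: coset_ops coset_zero_iff)
  then show "\<exists>u\<in>loc.M. u \<otimes>\<^bsub>B\<^esub> x = \<zero>\<^bsub>B\<^esub>" using u(1) loc_M by blast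
qed

text \<open>For a derivation \<open>D\<close> with \<open>D(I) \<subseteq> p\<close>, the fractions \<open>a/s\<close> with \<open>a \<in> p\<close> and \<open>D a \<in> p\<close> form
  an ideal that contains the square of the maximal ideal.\<close>

lemma regular_imp_prime_without_tangents:
  assumes "regular_local_ring loc.A"
  shows "\<exists>q. primeideal q R \<and> I \<subseteq> q \<and> q \<subseteq> p \<and>
    (\<forall>D x. derivation D \<longrightarrow> D ` I \<subseteq> p \<longrightarrow> x \<in> q \<longrightarrow> D x \<in> p)"
proof -
  interpret A: cring loc.A by (rule loc.cring_localization)
  from regular_local_ring_small_prime[OF assms] obtain m Q where
    m: "maximalideal m loc.A" and Q: "primeideal Q loc.A" "Q \<subseteq> m" and
    small: "\<And>w N. w \<in> Q \<Longrightarrow> ideal N loc.A \<Longrightarrow> (\<And>a b. a \<in> m \<Longrightarrow> b \<in> m \<Longrightarrow> a \<otimes>\<^bsub>loc.A\<^esub> b \<in> N) \<Longrightarrow> w \<in> N"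
    by blast
  have mi: "ideal m loc.A" "\<one>\<^bsub>loc.A\<^esub> \<notin> m"
    using A.primeideal_props[OF A.maximalideal_prime[OF m]] by auto
  note Q' = A.primeideal_props[OF Q(1)]
  note Qm = A.ideal_membership[OF Q'(1)]
  have one: "\<one> \<in> carrier R - p" using p_props(2) by simp
  have mult: "s \<otimes> t \<in> carrier R - p" if "s \<in> carrier R - p" "t \<in> carrier R - p" for s t
    using p_props(3) that .
  have m_frc: "\<exists>a s. a \<in> p \<and> s \<in> carrier R - p \<and> x = frc a s" if "x \<in> m" for x
  proof -
    from loc.proper_ideal_localization[OF mi that] obtain a' s' where
      x: "x = loc.fract a' s'" "a' \<in> pbar" "s' \<in> loc.M" .
    from x(2) obtain a where a: "a \<in> p" "a' = I +> a" unfolding pbar_def by blast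
    from x(3) obtain s where s: "s \<in> carrier R - p" "s' = I +> s" unfolding loc_M by blast
    have "x = frc a s" by (simp add: x a s frc_def)
    with a(1) s(1) show ?thesis by blast
  qed
  have frc_m: "x \<in> p" if x: "frc x \<one> \<in> m" "x \<in> carrier R" for x
  proof -
    from m_frc[OF x(1)] obtain a s where a: "a \<in> p" "s \<in> carrier R - p" "frc x \<one> = frc a s" by blast
    have ac: "a \<in> carrier R" by (rule p_mem(1)[OF a(1)])
    from a(3) obtain u where u: "u \<in> carrier R - p" "u \<otimes> (x \<otimes> s \<ominus> a \<otimes> \<one>) \<in> I"
      using frc_eq_iff[OF x(2) one ac a(2)] by blast
    have c: "u \<in> carrier R" "s \<in> carrier R" using u a by auto
    have "u \<otimes> s \<otimes> x = u \<otimes> (x \<otimes> s \<ominus> a \<otimes> \<one>) \<oplus> u \<otimes> a" using c ac x(2) by algebra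
    also have "\<dots> \<in> p" by (intro p_mem(3,5) subsetD[OF Ip] u c a)
    finally show "x \<in> p" using p_props(3)[OF mult[OF u(1) a(2)], of x] x(2) by blast
  qed
  \<comment> \<open>The contraction to \<open>R\<close> of the prime \<open>Q\<close> of the local
    ring; \<open>frc_m\<close> shows that it stays inside \<open>p\<close>.\<close>
  define q where "q = {a \<in> carrier R. frc a \<one> \<in> Q}"
  have qp: "q \<subseteq> p" using frc_m Q(2) by (auto simp: q_def)
  have Iq: "I \<subseteq> q" using frc_zero[OF one] Qm(2) I_mem(1) by (auto simp: q_def)
  have "primeideal q R"
  proof (rule primeidealI)
    show "ideal q R"
    proof (rule ideal_intro)
      show "\<zero> \<in> q" using Iq I_mem(2) by blast
      show "a \<oplus> b \<in> q" if "a \<in> q" "b \<in> q" for a b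
        using that Qm(3)[of "frc a \<one>" "frc b \<one>"] one by (simp add: q_def frc_simps)
      show "r \<otimes> a \<in> q" if "r \<in> carrier R" "a \<in> q" for a r
        using that Qm(5)[of "frc r \<one>" "frc a \<one>"] one by (simp add: q_def frc_simps frc_closed)
    qed (auto simp: q_def)
    show "carrier R \<noteq> q" using qp p_props(2) by auto
    fix a b assume "a \<in> carrier R" "b \<in> carrier R" "a \<otimes> b \<in> q"
    then show "a \<in> q \<or> b \<in> q"
      using Q'(3)[of "frc a \<one>" "frc b \<one>"] one by (auto simp: q_def frc_simps frc_closed)
  qed (rule is_cring)
  moreover have "D x \<in> p" if der: "derivation D" and DI: "D ` I \<subseteq> p" and x: "x \<in> q" for D x
  proof -
    have D: "\<And>a. a \<in> carrier R \<Longrightarrow> D a \<in> carrier R"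
      "\<And>a b. a \<in> carrier R \<Longrightarrow> b \<in> carrier R \<Longrightarrow> D (a \<oplus> b) = D a \<oplus> D b"
      "\<And>a b. a \<in> carrier R \<Longrightarrow> b \<in> carrier R \<Longrightarrow> D (a \<otimes> b) = a \<otimes> D b \<oplus> b \<otimes> D a"
      "\<And>a. a \<in> I \<Longrightarrow> D a \<in> p"
      using der DI by (auto simp: derivation_def)
    have xp: "x \<in> p" using x qp by blast
    have xc: "x \<in> carrier R" by (rule p_mem(1)[OF xp])
    \<comment> \<open>Requiring \<open>a \<in> p\<close> besides \<open>D a \<in> p\<close> makes
      \<open>K\<close> an ideal: \<open>D (r \<otimes> a)\<close> contains the term
      \<open>a \<otimes> D r\<close>.\<close>
    define K where "K = {a \<in> p. D a \<in> p}"
    have Kc: "a \<in> carrier R" if "a \<in> K" for a using that p_mem(1) by (auto simp: K_def)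
    have K_add: "a \<oplus> b \<in> K" if "a \<in> K" "b \<in> K" for a b
      using that Kc[OF that(1)] Kc[OF that(2)] p_mem(3) by (simp add: K_def D(2))
    have K_mult: "r \<otimes> a \<in> K" if "r \<in> carrier R" "a \<in> K" for a r
      using that Kc[OF that(2)] p_mem(5)[of r a] p_mem(3)[OF p_mem(5)[of r "D a"] p_mem(5)[of "D r" a]]
        D(1)[OF that(1)] by (simp add: K_def D(3) m_comm[of a])
    have pp: "a \<otimes> b \<in> K" if "a \<in> p" "b \<in> p" for a b
    proof -
      have c: "a \<in> carrier R" "b \<in> carrier R" using that p_mem(1) by auto
      have "a \<otimes> D b \<oplus> b \<otimes> D a = D b \<otimes> a \<oplus> D a \<otimes> b" using c D(1)[OF c(1)] D(1)[OF c(2)] by algebra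
      also have "\<dots> \<in> p" by (intro p_mem(3,5) D(1) c that)
      finally show ?thesis using p_mem(5)[OF c(1) that(2)] c by (simp add: K_def D(3))
    qed
    have I_K: "I \<subseteq> K" using Ip D(4) by (auto simp: K_def)
    define N where "N = {frc a s | a s. a \<in> K \<and> s \<in> carrier R - p}"
    have N: "ideal N loc.A"
    proof (rule A.ideal_intro)
      show "N \<subseteq> carrier loc.A" using Kc frc_closed by (auto simp: N_def)
      have "\<zero>\<^bsub>loc.A\<^esub> = frc \<zero> \<one>" using frc_zero[OF one I_mem(2)] by simp
      then show "\<zero>\<^bsub>loc.A\<^esub> \<in> N" using I_K I_mem(2) one unfolding N_def by blast
      show "v \<oplus>\<^bsub>loc.A\<^esub> w \<in> N" if "v \<in> N" "w \<in> N" for v w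
      proof -
        from that obtain a s b t where *: "v = frc a s" "w = frc b t" "a \<in> K" "b \<in> K"
          "s \<in> carrier R - p" "t \<in> carrier R - p" by (auto simp: N_def)
        have "v \<oplus>\<^bsub>loc.A\<^esub> w = frc (t \<otimes> a \<oplus> s \<otimes> b) (s \<otimes> t)"
          using * Kc by (simp add: frc_simps m_comm)
        moreover have "t \<otimes> a \<oplus> s \<otimes> b \<in> K" using * by (intro K_add K_mult) auto
        ultimately show ?thesis using mult[OF *(5,6)] unfolding N_def by blast
      qed
      show "v \<otimes>\<^bsub>loc.A\<^esub> w \<in> N" if "v \<in> carrier loc.A" "w \<in> N" for v w
      proof -
        from that(1) obtain a s where a: "a \<in> carrier R" "s \<in> carrier R - p" "v = frc a s" by (rule frc_cases)
        from that(2) obtain b t where b: "w = frc b t" "b \<in> K" "t \<in> carrier R - p" by (auto simp: N_def)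
        have "v \<otimes>\<^bsub>loc.A\<^esub> w = frc (a \<otimes> b) (s \<otimes> t)" using a b Kc by (simp add: frc_simps)
        moreover have "a \<otimes> b \<in> K" using a b by (intro K_mult)
        ultimately show ?thesis using mult[OF a(2) b(3)] unfolding N_def by blast
      qed
    qed
    have "frc x \<one> \<in> N"
    proof (rule small[OF _ N])
      show "frc x \<one> \<in> Q" using x by (simp add: q_def)
      fix v w assume "v \<in> m" "w \<in> m"
      then obtain a s b t where *: "v = frc a s" "w = frc b t" "a \<in> p" "b \<in> p"
        "s \<in> carrier R - p" "t \<in> carrier R - p" using m_frc by meson
      have "v \<otimes>\<^bsub>loc.A\<^esub> w = frc (a \<otimes> b) (s \<otimes> t)" using * p_mem(1) by (simp add: frc_simps)
      then show "v \<otimes>\<^bsub>loc.A\<^esub> w \<in> N" using pp[OF *(3,4)] mult[OF *(5,6)] unfolding N_def by blast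
    qed
    then obtain a s where a: "a \<in> K" "s \<in> carrier R - p" "frc x \<one> = frc a s" by (auto simp: N_def)
    have ac: "a \<in> carrier R" and sc: "s \<in> carrier R" using Kc a by auto
    from a(3) obtain u where u: "u \<in> carrier R - p" "u \<otimes> (x \<otimes> s \<ominus> a \<otimes> \<one>) \<in> I"
      using frc_eq_iff[OF xc one ac a(2)] by blast
    have uc: "u \<in> carrier R" using u by blast
    \<comment> \<open>Equality of fractions holds up to a factor \<open>u\<close> and modulo
      \<open>I\<close>, and \<open>K\<close> contains \<open>I\<close>, so
      \<open>u \<otimes> s \<otimes> x\<close> is in \<open>K\<close>. The Leibniz rule with
      \<open>x \<in> p\<close> then leaves \<open>D x\<close> times a factor outside
      \<open>p\<close>.\<close>
    have "(u \<otimes> s) \<otimes> x = u \<otimes> (x \<otimes> s \<ominus> a \<otimes> \<one>) \<oplus> u \<otimes> a" using uc sc xc ac by algebra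
    also have "\<dots> \<in> K" by (intro K_add K_mult subsetD[OF I_K] u uc a)
    finally have "D ((u \<otimes> s) \<otimes> x) \<in> p" by (simp add: K_def)
    then have Dp: "(u \<otimes> s) \<otimes> D x \<oplus> x \<otimes> D (u \<otimes> s) \<in> p" using uc sc xc by (simp add: D(3))
    have c: "u \<otimes> s \<in> carrier R" "D x \<in> carrier R" "D (u \<otimes> s) \<in> carrier R" using uc sc xc D(1) by auto
    have "(u \<otimes> s) \<otimes> D x = ((u \<otimes> s) \<otimes> D x \<oplus> x \<otimes> D (u \<otimes> s)) \<ominus> D (u \<otimes> s) \<otimes> x"
      using c(2,3) xc uc sc by algebra
    also have "\<dots> \<in> p" by (intro p_mem(4,5) Dp xp c)
    finally show "D x \<in> p" using p_props(3)[OF mult[OF u(1) a(2)], of "D x"] c(2) by blast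
  qed
  ultimately show ?thesis using Iq qp by (intro exI[of _ q]) simp
qed

end

section \<open>Polynomials and monomial ideals\<close>

lemma single_power: "Poly_Mapping.single (Poly_Mapping.single x 1) (1::'k::field) ^ n = Poly_Mapping.single (Poly_Mapping.single x (n::nat)) 1"
  by (induction n) (simp_all add: mult_single single_add[symmetric])

lemma prod_single: "(\<Prod>x\<in>A. Poly_Mapping.single (k x) (1::'k::field)) = Poly_Mapping.single (\<Sum>x\<in>A. k x :: 'x \<Rightarrow>\<^sub>0 nat) 1"
  by (induction A rule: infinite_finite_induct) (simp_all add: mult_single)

lemma monomial_expand: "(\<Sum>x\<in>Poly_Mapping.keys k. Poly_Mapping.single x (Poly_Mapping.lookup k x)) = (k :: 'x \<Rightarrow>\<^sub>0 nat)"
proof (rule poly_mapping_eqI)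
  fix y
  have "(\<Sum>x\<in>Poly_Mapping.keys k. Poly_Mapping.lookup k x when x = y) = Poly_Mapping.lookup k y"
    by (cases "y \<in> Poly_Mapping.keys k") (auto simp: when_def in_keys_iff)
  then show "Poly_Mapping.lookup (\<Sum>x\<in>Poly_Mapping.keys k. Poly_Mapping.single x (Poly_Mapping.lookup k x)) y = Poly_Mapping.lookup k y"
    by (simp add: lookup_sum lookup_single)
qed

lemma single_eq_prod_Var:
  "Poly_Mapping.single k (c::'k::field) = Const c * (\<Prod>x\<in>Poly_Mapping.keys k. Var x ^ Poly_Mapping.lookup k x)"
  by (simp add: Var_def Const_def single_power prod_single monomial_expand mult_single del: One_nat_def)

text \<open>Reduces identities between substitutions, and bounds on the variables of their values,
  to constants and variables.\<close>

lemma mpoly_induct [consumes 1, case_names Const Var add mult]: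
  fixes f :: "('x, 'k::field) mpoly"
  assumes "indets f \<subseteq> Y" and "\<And>c. Q (Const c)" and "\<And>y. y \<in> Y \<Longrightarrow> Q (Var y)"
    and "\<And>f g. Q f \<Longrightarrow> Q g \<Longrightarrow> Q (f + g)" and "\<And>f g. Q f \<Longrightarrow> Q g \<Longrightarrow> Q (f * g)"
  shows "Q f"
proof -
  have one: "Q 1" using assms(2)[of 1] by (simp add: Const_def)
  have zero: "Q 0" using assms(2)[of 0] by simp
  have pow: "Q (h ^ n)" if "Q h" for h and n :: nat
    by (induction n) (use that one assms(5) in auto)
  have prod: "Q (prod F A)" if "\<And>i. i \<in> A \<Longrightarrow> Q (F i)" for F :: "'x \<Rightarrow> ('x, 'k) mpoly" and A
    using that by (induction A rule: infinite_finite_induct) (use one assms(5) in auto)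
  have sum: "Q (sum F A)" if "\<And>i. i \<in> A \<Longrightarrow> Q (F i)" for F :: "('x \<Rightarrow>\<^sub>0 nat) \<Rightarrow> ('x, 'k) mpoly" and A
    using that by (induction A rule: infinite_finite_induct) (use zero assms(4) in auto)
  have "Q (\<Sum>m\<in>Poly_Mapping.keys f. Poly_Mapping.single m (Poly_Mapping.lookup f m))"
    unfolding single_eq_prod_Var using assms(1)
    by (intro sum assms(2,5) prod pow assms(3)) (auto simp: indets_def)
  then show ?thesis by (simp only: mpoly_expand[symmetric])
qed

lemma mpoly_eval_Const: "h 0 = 0 \<Longrightarrow> mpoly_eval h v (Const c) = h c"
  by (cases "c = 0") (simp_all add: mpoly_eval_def Const_def)

lemma mpoly_eval_Var: "mpoly_eval h v (Var x) = h 1 * v x"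
  by (simp add: mpoly_eval_def Var_def)

abbreviation subst_vars :: "('x \<Rightarrow> ('y, 'k::field) mpoly) \<Rightarrow> ('x, 'k) mpoly \<Rightarrow> ('y, 'k) mpoly"
  where "subst_vars \<equiv> mpoly_eval Const"

lemma Const_1 [simp]: "Const 1 = 1"
  by (simp add: Const_def)

lemma subst_vars_simps [simp]:
  fixes v :: "'x \<Rightarrow> ('y, 'k::field) mpoly"
  shows "subst_vars v (Const c) = Const c"
  "subst_vars v (Var x) = v x"
  "subst_vars v (f + g) = subst_vars v f + subst_vars v g"
  "subst_vars v (f * g) = subst_vars v f * subst_vars v g"
  "subst_vars v 0 = 0"
  "subst_vars v 1 = 1"
proof -
  show "subst_vars v (Const c) = Const c" for c :: 'k by (rule mpoly_eval_Const) simp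
  from this[of 0] this[of 1] show "subst_vars v 0 = 0" "subst_vars v 1 = 1" by simp_all
qed (simp_all add: mpoly_eval_Var mpoly_eval_add mpoly_eval_mult Const_add Const_mult)

lemma subst_vars_sum: "subst_vars v (sum F A) = (\<Sum>i\<in>A. subst_vars v (F i))"
  by (induction A rule: infinite_finite_induct) simp_all

lemma subst_vars_comp: "subst_vars w (subst_vars v f) = subst_vars (\<lambda>x. subst_vars w (v x)) f"
proof -
  have "indets f \<subseteq> UNIV" by simp
  then show ?thesis by (induction rule: mpoly_induct) simp_all
qed

lemma subst_vars_cong:
  assumes "indets f \<subseteq> Y" "\<And>y. y \<in> Y \<Longrightarrow> v y = w y"
  shows "subst_vars v f = subst_vars w f"
  using assms(1) by (induction rule: mpoly_induct) (simp_all add: assms(2))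

lemma indets_subst_vars:
  assumes "indets f \<subseteq> Y" "\<And>y. y \<in> Y \<Longrightarrow> indets (v y) \<subseteq> Z"
  shows "indets (subst_vars v f) \<subseteq> Z"
  using assms(1)
proof (induction rule: mpoly_induct)
  case (add f g)
  then show ?case using indets_add[of "subst_vars v f" "subst_vars v g"] by auto
next
  case (mult f g)
  then show ?case using indets_mult[of "subst_vars v f" "subst_vars v g"] by auto
qed (use assms(2) in auto)

abbreviation restrict_vars :: "'x set \<Rightarrow> ('x, 'k::field) mpoly \<Rightarrow> ('x, 'k) mpoly"
  where "restrict_vars W \<equiv> subst_vars (\<lambda>x. if x \<in> W then 0 else Var x)"

lemma restrict_vars_single:
  "restrict_vars W (Poly_Mapping.single k c) =
    (if Poly_Mapping.keys k \<inter> W = {} then Poly_Mapping.single k c else 0)"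
proof -
  have *: "restrict_vars W (Poly_Mapping.single k c) =
      Const c * (\<Prod>x\<in>Poly_Mapping.keys k. (if x \<in> W then 0 else Var x) ^ Poly_Mapping.lookup k x)"
    by (cases "c = 0") (simp_all add: mpoly_eval_def)
  show ?thesis
  proof (cases "Poly_Mapping.keys k \<inter> W = {}")
    case True
    then have "(\<Prod>x\<in>Poly_Mapping.keys k. (if x \<in> W then 0 else Var x) ^ Poly_Mapping.lookup k x)
        = (\<Prod>x\<in>Poly_Mapping.keys k. Var x ^ Poly_Mapping.lookup k x :: ('a, 'b) mpoly)"
      by (intro prod.cong) auto
    with True show ?thesis unfolding * by (simp add: single_eq_prod_Var)
  next
    case False
    then obtain x where "x \<in> Poly_Mapping.keys k" "x \<in> W" by blast
    then have "(\<Prod>x\<in>Poly_Mapping.keys k. (if x \<in> W then 0 else Var x) ^ Poly_Mapping.lookup k x :: ('a, 'b) mpoly) = 0"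
      by (intro prod_zero bexI[of _ x]) (auto simp: in_keys_iff zero_power)
    with False show ?thesis unfolding * by simp
  qed
qed

text \<open>Each monomial is either kept unchanged or sent to zero, so no cancellation can occur
  between different monomials.\<close>

lemma restrict_vars_eq_0_iff:
  fixes f :: "('x, 'k::field) mpoly"
  shows "restrict_vars W f = 0 \<longleftrightarrow> (\<forall>k\<in>Poly_Mapping.keys f. Poly_Mapping.keys k \<inter> W \<noteq> {})"
proof -
  have "restrict_vars W f = (\<Sum>k\<in>Poly_Mapping.keys f. restrict_vars W (Poly_Mapping.single k (Poly_Mapping.lookup f k)))"
    by (subst mpoly_expand[of f]) (rule subst_vars_sum)
  then have eq: "restrict_vars W f = (\<Sum>k\<in>Poly_Mapping.keys f.
      if Poly_Mapping.keys k \<inter> W = {} then Poly_Mapping.single k (Poly_Mapping.lookup f k) else 0)"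
    by (simp only: restrict_vars_single)
  show ?thesis
  proof
    assume "\<forall>k\<in>Poly_Mapping.keys f. Poly_Mapping.keys k \<inter> W \<noteq> {}"
    then show "restrict_vars W f = 0" unfolding eq by (intro sum.neutral) auto
  next
    assume 0: "restrict_vars W f = 0"
    show "\<forall>k\<in>Poly_Mapping.keys f. Poly_Mapping.keys k \<inter> W \<noteq> {}"
    proof (intro ballI notI)
      fix m assume m: "m \<in> Poly_Mapping.keys f" "Poly_Mapping.keys m \<inter> W = {}"
      have "Poly_Mapping.lookup (restrict_vars W f) m = (\<Sum>k\<in>Poly_Mapping.keys f. if k = m then Poly_Mapping.lookup f m else 0)"
        unfolding eq lookup_sum using m(2) by (intro sum.cong) (auto simp: lookup_single when_def)
      also have "\<dots> \<noteq> 0" using m(1) by (simp add: in_keys_iff)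
      finally show False using 0 by simp
    qed
  qed
qed

definition sqfree_monomial :: "'x set \<Rightarrow> 'x \<Rightarrow>\<^sub>0 nat"
  where "sqfree_monomial S = (\<Sum>x\<in>S. Poly_Mapping.single x 1)"

lemma lookup_sqfree_monomial: "finite S \<Longrightarrow> Poly_Mapping.lookup (sqfree_monomial S) x = (if x \<in> S then 1 else 0)"
  by (simp add: sqfree_monomial_def lookup_sum lookup_single when_def)

lemma keys_sqfree_monomial: "finite S \<Longrightarrow> Poly_Mapping.keys (sqfree_monomial S) = S"
  by (auto simp: in_keys_iff lookup_sqfree_monomial split: if_splits)

lemma prod_Var_eq_single: "(\<Prod>x\<in>S. Var x) = Poly_Mapping.single (sqfree_monomial S) (1::'k::field)"
  by (simp add: Var_def prod_single sqfree_monomial_def)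

lemma keys_add_nat: "Poly_Mapping.keys (m + n) = Poly_Mapping.keys m \<union> Poly_Mapping.keys (n :: 'x \<Rightarrow>\<^sub>0 nat)"
  by (auto simp: in_keys_iff lookup_add)

lemma ideal_mpoly_ring:
  fixes I :: "('x, 'k::field) mpoly set"
  assumes "ideal I (mpoly_ring Y)"
  shows "f \<in> I \<Longrightarrow> indets f \<subseteq> Y" "0 \<in> I" "f \<in> I \<Longrightarrow> g \<in> I \<Longrightarrow> f + g \<in> I"
    "indets f \<subseteq> Y \<Longrightarrow> g \<in> I \<Longrightarrow> f * g \<in> I"
    "(\<And>i. i \<in> A \<Longrightarrow> F i \<in> I) \<Longrightarrow> sum F A \<in> I"
proof -
  note mem = cring.ideal_membership[OF cring_mpoly_ring assms]
  show "f \<in> I \<Longrightarrow> indets f \<subseteq> Y" and 0: "0 \<in> I" and "indets f \<subseteq> Y \<Longrightarrow> g \<in> I \<Longrightarrow> f * g \<in> I"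
    using mem(1)[of f] mem(2) mem(5)[of f g] by simp_all
  have add: "f + g \<in> I" if "f \<in> I" "g \<in> I" for f g using mem(3)[of f g] that by simp
  then show "f \<in> I \<Longrightarrow> g \<in> I \<Longrightarrow> f + g \<in> I" .
  show "(\<And>i. i \<in> A \<Longrightarrow> F i \<in> I) \<Longrightarrow> sum F A \<in> I"
    by (induction A rule: infinite_finite_induct) (use 0 add in auto)
qed

lemma indets_prod_Var: "finite S \<Longrightarrow> indets (\<Prod>x\<in>S. Var x :: ('x, 'k::field) mpoly) = S"
  by (simp add: prod_Var_eq_single indets_def keys_sqfree_monomial)

text \<open>Membership in a monomial ideal is decided monomial by monomial, and a squarefree
  monomial divides another exactly if its support is contained in the other support. Ideal questions
  thus become questions about sets of variables.\<close>

lemma genideal_sqfree_monomials: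
  fixes F :: "'x set set"
  assumes F: "\<And>S. S \<in> F \<Longrightarrow> S \<subseteq> Y" and Y: "finite Y"
  shows "Idl\<^bsub>mpoly_ring Y\<^esub> ((\<lambda>S. \<Prod>x\<in>S. Var x) ` F) =
    {f :: ('x, 'k::field) mpoly. indets f \<subseteq> Y \<and> (\<forall>k\<in>Poly_Mapping.keys f. \<exists>S\<in>F. S \<subseteq> Poly_Mapping.keys k)}"
    (is "Idl\<^bsub>?R\<^esub> ?G = ?K")
proof -
  interpret R: cring ?R by (rule cring_mpoly_ring)
  have fin: "finite S" if "S \<in> F" for S using F[OF that] Y finite_subset by blast
  have G: "?G \<subseteq> carrier ?R"
  proof
    fix f :: "('x, 'k) mpoly" assume "f \<in> ?G"
    then obtain S where S: "S \<in> F" "f = (\<Prod>x\<in>S. Var x)" by blast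
    show "f \<in> carrier ?R" using F[OF S(1)] by (simp add: S(2) indets_prod_Var[OF fin[OF S(1)]])
  qed
  have "ideal ?K ?R"
  proof (rule R.ideal_intro)
    fix f g :: "('x, 'k) mpoly" assume fg: "f \<in> ?K" "g \<in> ?K"
    show "f \<oplus>\<^bsub>?R\<^esub> g \<in> ?K"
    proof -
      have "indets (f + g) \<subseteq> Y" using fg indets_add[of f g] by auto
      moreover have "\<exists>S\<in>F. S \<subseteq> Poly_Mapping.keys k" if "k \<in> Poly_Mapping.keys (f + g)" for k
        using fg that subsetD[OF keys_add[of f g], of k] by auto
      ultimately show ?thesis by simp
    qed
  next
    fix f g :: "('x, 'k) mpoly" assume f: "f \<in> carrier ?R" and g: "g \<in> ?K"
    have "\<exists>S\<in>F. S \<subseteq> Poly_Mapping.keys k" if "k \<in> Poly_Mapping.keys (f * g)" for k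
    proof -
      from that keys_mult[of f g] obtain m n where "n \<in> Poly_Mapping.keys g" "k = m + n" by blast
      moreover from this(1) g obtain S where "S \<in> F" "S \<subseteq> Poly_Mapping.keys n" by blast
      ultimately show ?thesis by (intro bexI[of _ S]) (auto simp: keys_add_nat)
    qed
    then show "f \<otimes>\<^bsub>?R\<^esub> g \<in> ?K" using f g indets_mult[of f g] by auto
  qed auto
  moreover have "?G \<subseteq> ?K"
  proof
    fix f :: "('x, 'k) mpoly" assume "f \<in> ?G"
    then obtain S where S: "S \<in> F" "f = (\<Prod>x\<in>S. Var x)" by blast
    have "Poly_Mapping.keys f = {sqfree_monomial S}" by (simp add: S(2) prod_Var_eq_single)
    moreover have "indets f \<subseteq> Y" unfolding S(2) indets_prod_Var[OF fin[OF S(1)]] by (rule F[OF S(1)])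
    ultimately show "f \<in> ?K" using S(1) keys_sqfree_monomial[OF fin[OF S(1)]] by auto
  qed
  ultimately have "Idl\<^bsub>?R\<^esub> ?G \<subseteq> ?K" by (rule R.genideal_minimal)
  moreover have "?K \<subseteq> Idl\<^bsub>?R\<^esub> ?G"
  proof
    fix f :: "('x, 'k) mpoly" assume f: "f \<in> ?K"
    note I = ideal_mpoly_ring[OF R.genideal_ideal[OF G]]
    have "Poly_Mapping.single k (Poly_Mapping.lookup f k) \<in> Idl\<^bsub>?R\<^esub> ?G" if k: "k \<in> Poly_Mapping.keys f" for k
    proof -
      from f k obtain S where S: "S \<in> F" "S \<subseteq> Poly_Mapping.keys k" by blast
      \<comment> \<open>Subtraction of exponents is truncated; it is exact here because every
        variable of \<open>S\<close> has positive exponent in \<open>k\<close>.\<close>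
      have "k = (k - sqfree_monomial S) + sqfree_monomial S"
        using S by (intro poly_mapping_eqI)
          (auto simp: lookup_add lookup_minus lookup_sqfree_monomial[OF fin[OF S(1)]] in_keys_iff)
      then have "Poly_Mapping.single k (Poly_Mapping.lookup f k) =
          Poly_Mapping.single (k - sqfree_monomial S) (Poly_Mapping.lookup f k) * (\<Prod>x\<in>S. Var x)"
        by (simp add: prod_Var_eq_single mult_single)
      moreover have "\<dots> \<in> Idl\<^bsub>?R\<^esub> ?G"
      proof (rule I(4))
        have "Poly_Mapping.keys (k - sqfree_monomial S) \<subseteq> Poly_Mapping.keys k"
          by (auto simp: in_keys_iff lookup_minus)
        then show "indets (Poly_Mapping.single (k - sqfree_monomial S) (Poly_Mapping.lookup f k)) \<subseteq> Y"
          using f k by (auto simp: indets_def split: if_splits)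
        show "(\<Prod>x\<in>S. Var x) \<in> Idl\<^bsub>?R\<^esub> ?G" using R.genideal_self[OF G] S(1) by blast
      qed
      ultimately show ?thesis by simp
    qed
    then show "f \<in> Idl\<^bsub>?R\<^esub> ?G" by (subst mpoly_expand[of f]) (rule I(5))
  qed
  ultimately show ?thesis by (rule subset_antisym)
qed

text \<open>The prime generated by the variables in \<open>W \<inter> Y\<close>, given as a kernel:
  this form yields primality and the description by supports directly. It serves both for
  \<open>P\<^sub>W\<close> and, over the jet variables, for \<open>Q\<^sub>W\<close>.\<close>

definition var_prime :: "'x set \<Rightarrow> 'x set \<Rightarrow> ('x, 'k::field) mpoly set"
  where "var_prime Y W = {f. indets f \<subseteq> Y \<and> restrict_vars W f = 0}"

text \<open>The integral domain instance for polynomials needs linearly ordered variables, so the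
  variables outside \<open>W\<close> are renamed to natural numbers.\<close>

lemma primeideal_var_prime:
  fixes Y :: "'x set"
  assumes "finite Y"
  shows "primeideal (var_prime Y W :: ('x, 'k::field) mpoly set) (mpoly_ring Y)"
proof -
  interpret R: cring "mpoly_ring Y :: ('x, 'k) mpoly ring" by (rule cring_mpoly_ring)
  from finite_imp_inj_to_nat_seg[OF assms] obtain \<iota> :: "'x \<Rightarrow> nat" where \<iota>: "inj_on \<iota> Y" by auto
  let ?\<epsilon> = "subst_vars (\<lambda>y. if y \<in> W then 0 else Var (\<iota> y)) :: ('x, 'k) mpoly \<Rightarrow> (nat, 'k) mpoly"
  have \<epsilon>: "?\<epsilon> f = 0 \<longleftrightarrow> restrict_vars W f = 0" if f: "indets f \<subseteq> Y" for f :: "('x, 'k) mpoly"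
  proof
    \<comment> \<open>The renaming is injective on \<open>Y\<close>, so substituting the inverse
      names recovers the restricted polynomial.\<close>
    have "subst_vars (\<lambda>n. Var (the_inv_into Y \<iota> n)) (?\<epsilon> f) = restrict_vars W f"
      unfolding subst_vars_comp using f
      by (rule subst_vars_cong) (simp add: the_inv_into_f_f[OF \<iota>])
    then show "?\<epsilon> f = 0 \<Longrightarrow> restrict_vars W f = 0" by auto
    have "subst_vars (\<lambda>y. Var (\<iota> y)) (restrict_vars W f) = ?\<epsilon> f"
      unfolding subst_vars_comp using f by (rule subst_vars_cong) simp
    then show "restrict_vars W f = 0 \<Longrightarrow> ?\<epsilon> f = 0" by auto
  qed
  let ?P = "var_prime Y W :: ('x, 'k) mpoly set"
  let ?R = "mpoly_ring Y :: ('x, 'k) mpoly ring"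
  show ?thesis
  proof (rule primeidealI)
    show "ideal ?P ?R"
    proof (rule R.ideal_intro)
      show "f \<oplus>\<^bsub>?R\<^esub> g \<in> ?P" if "f \<in> ?P" "g \<in> ?P" for f g
        using that indets_add[of f g] by (auto simp: var_prime_def)
      show "f \<otimes>\<^bsub>?R\<^esub> g \<in> ?P" if "f \<in> carrier ?R" "g \<in> ?P" for f g
        using that indets_mult[of f g] by (auto simp: var_prime_def)
    qed (auto simp: var_prime_def)
    show "carrier ?R \<noteq> ?P"
    proof
      assume "carrier ?R = ?P"
      then have "1 \<in> ?P" using R.one_closed by (simp del: R.one_closed mpoly_ring_simps(1) add: mpoly_ring_simps(4))
      then show False by (simp add: var_prime_def)
    qed
    fix f g :: "('x, 'k) mpoly"
    assume f: "f \<in> carrier ?R" and g: "g \<in> carrier ?R"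
      and "f \<otimes>\<^bsub>?R\<^esub> g \<in> ?P"
    then have "indets (f * g) \<subseteq> Y" "restrict_vars W (f * g) = 0" by (auto simp: var_prime_def)
    then have "?\<epsilon> (f * g) = 0" using \<epsilon> by blast
    then have "?\<epsilon> f = 0 \<or> ?\<epsilon> g = 0" by simp
    then show "f \<in> ?P \<or> g \<in> ?P" using f g \<epsilon> by (auto simp: var_prime_def)
  qed (rule R.is_cring)
qed

section \<open>Edge ideals and their jets\<close>

text \<open>Minimality is expressed by private edges: without \<open>x\<close> the edge meeting
  \<open>W\<close> only in \<open>x\<close> would be uncovered. These edges are what
  \<open>var_prime_regular\<close> uses.\<close>

definition minimal_cover :: "'x set \<Rightarrow> 'x set set \<Rightarrow> 'x set \<Rightarrow> bool"
  where "minimal_cover X E W \<longleftrightarrow> W \<subseteq> X \<and> (\<forall>e\<in>E. e \<inter> W \<noteq> {}) \<and> (\<forall>x\<in>W. \<exists>e\<in>E. e \<inter> W = {x})"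

text \<open>If \<open>S\<close> contained no edge, then \<open>X - S\<close> would be a cover, and a
  cover of least cardinality inside it would be minimal and disjoint from \<open>S\<close>. This is
  the combinatorial content of \<open>I(C) = \<Inter>\<^sub>W P\<^sub>W\<close>.\<close>

lemma edge_subset_if_meets_minimal_covers:
  assumes "finite X" "E \<subseteq> Pow X" and S: "\<And>W. minimal_cover X E W \<Longrightarrow> S \<inter> W \<noteq> {}"
  shows "\<exists>e\<in>E. e \<subseteq> S"
proof (rule ccontr)
  assume no: "\<not> (\<exists>e\<in>E. e \<subseteq> S)"
  define Q where "Q = (\<lambda>W. W \<subseteq> X - S \<and> (\<forall>e\<in>E. e \<inter> W \<noteq> {}))"
  have "Q (X - S)" using no assms(2) by (auto simp: Q_def)
  from ex_has_least_nat[of Q, OF this, of card] obtain W where W: "Q W" "\<And>V. Q V \<Longrightarrow> card W \<le> card V" by blast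
  have fW: "finite W" using W(1) assms(1) finite_subset by (auto simp: Q_def)
  have "\<exists>e\<in>E. e \<inter> W = {x}" if x: "x \<in> W" for x
  proof -
    have "\<not> Q (W - {x})" using W(2)[of "W - {x}"] card_Diff1_less[OF fW x] by auto
    then obtain e where "e \<in> E" "e \<inter> (W - {x}) = {}" using W(1) by (auto simp: Q_def)
    moreover from this W(1) have "e \<inter> W \<noteq> {}" by (simp add: Q_def)
    ultimately show ?thesis by (intro bexI[of _ e]) auto
  qed
  then have "minimal_cover X E W" using W(1) by (auto simp: minimal_cover_def Q_def)
  then show False using S W(1) by (auto simp: Q_def)
qed

text \<open>The partial derivative, read off from the substitution \<open>x \<mapsto> x + t\<close>.\<close>

definition mpoly_deriv :: "'x \<Rightarrow> ('x, 'k::field) mpoly \<Rightarrow> ('x, 'k) mpoly"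
  where "mpoly_deriv x f =
    Polynomial.coeff (mpoly_eval (\<lambda>c. [:Const c:]) (\<lambda>y. [:Var y, if y = x then 1 else 0:]) f) 1"

lemma mpoly_deriv_add: "mpoly_deriv x (f + g) = mpoly_deriv x f + mpoly_deriv x g"
  by (simp add: mpoly_deriv_def mpoly_eval_add Const_add)

lemma mpoly_deriv_mult: "mpoly_deriv x (f * g) = f * mpoly_deriv x g + g * mpoly_deriv x f"
proof -
  let ?T = "mpoly_eval (\<lambda>c. [:Const c:]) (\<lambda>y. [:Var y, if y = x then 1 else 0:]) :: ('a, 'b) mpoly \<Rightarrow> _"
  \<comment> \<open>At \<open>t = 0\<close> the shift is the identity; comparing coefficients of
    \<open>t\<close> in a product then gives the Leibniz rule.\<close>
  have coeff_0: "Polynomial.coeff (?T f) 0 = f" for f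
  proof -
    have "indets f \<subseteq> UNIV" by simp
    then show ?thesis
      by (induction rule: mpoly_induct)
        (simp_all add: mpoly_eval_Const mpoly_eval_Var mpoly_eval_add mpoly_eval_mult Const_add Const_mult coeff_mult)
  qed
  have "?T (f * g) = ?T f * ?T g" by (simp add: mpoly_eval_mult Const_add Const_mult)
  then show ?thesis by (simp add: mpoly_deriv_def coeff_mult coeff_0 mult.commute)
qed

lemma mpoly_deriv_Var: "mpoly_deriv x (Var y) = (if y = x then 1 else 0)"
  by (simp add: mpoly_deriv_def mpoly_eval_Var)

lemma mpoly_deriv_Const: "mpoly_deriv x (Const c) = 0"
  by (simp add: mpoly_deriv_def mpoly_eval_Const)

lemma indets_mpoly_deriv:
  assumes "indets f \<subseteq> X"
  shows "indets (mpoly_deriv x f) \<subseteq> X"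
proof -
  from assms have "indets f \<subseteq> X \<and> indets (mpoly_deriv x f) \<subseteq> X"
  proof (induction rule: mpoly_induct)
    case (add f g)
    then show ?case using indets_add[of f g] indets_add[of "mpoly_deriv x f" "mpoly_deriv x g"]
      by (auto simp: mpoly_deriv_add)
  next
    case (mult f g)
    then have "indets (f * mpoly_deriv x g) \<subseteq> X" "indets (g * mpoly_deriv x f) \<subseteq> X" "indets (f * g) \<subseteq> X"
      using indets_mult[of f "mpoly_deriv x g"] indets_mult[of g "mpoly_deriv x f"] indets_mult[of f g]
      by blast+
    then show ?case using indets_add[of "f * mpoly_deriv x g" "g * mpoly_deriv x f"]
      unfolding mpoly_deriv_mult by blast
  qed (auto simp: mpoly_deriv_Var mpoly_deriv_Const)
  then show ?thesis by blast
qed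

lemma derivation_mpoly_deriv: "cring.derivation (mpoly_ring X) (mpoly_deriv x)"
  by (simp add: cring.derivation_def[OF cring_mpoly_ring] indets_mpoly_deriv mpoly_deriv_add mpoly_deriv_mult)

lemma jet_coeff_Var: "jet_coeff s (Var x) j = (if j \<le> s then Var (x, j) else 0)"
  by (simp add: jet_coeff_def jet_subst_def mpoly_eval_Var coeff_sum)

text \<open>Setting \<open>t = 0\<close> leaves \<open>x \<mapsto> x\<^sub>0\<close>. This links jet
  coefficients with \<open>jet_proj\<close>.\<close>

lemma jet_coeff_at_0: "jet_coeff s f 0 = subst_vars (\<lambda>x. Var (x, 0)) f"
proof -
  have "indets f \<subseteq> UNIV" by simp
  then show ?thesis
  proof (induction rule: mpoly_induct)
    case (Const c)
    then show ?case by (simp add: jet_coeff_def jet_subst_def mpoly_eval_Const)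
  qed (simp_all add: jet_coeff_Var jet_coeff_add jet_coeff_mult)
qed

section \<open>Primes of polynomial rings and closed sets of spectra\<close>

lemma Spec_mpolyD:
  assumes "q \<in> Spec (mpoly_ring Y)"
  shows "primeideal q (mpoly_ring Y)" "ideal q (mpoly_ring Y)" "1 \<notin> q"
    "indets f \<subseteq> Y \<Longrightarrow> indets g \<subseteq> Y \<Longrightarrow> f * g \<in> q \<Longrightarrow> f \<in> q \<or> g \<in> q"
proof -
  show q: "primeideal q (mpoly_ring Y)" using assms by (simp add: Spec_def)
  note pr = cring.primeideal_props[OF cring_mpoly_ring q]
  show "ideal q (mpoly_ring Y)" "1 \<notin> q" using pr(1,2) by simp_all
  show "indets f \<subseteq> Y \<Longrightarrow> indets g \<subseteq> Y \<Longrightarrow> f * g \<in> q \<Longrightarrow> f \<in> q \<or> g \<in> q"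
    using pr(3)[of f g] by auto
qed

lemma prime_prod_Var:
  assumes q: "q \<in> Spec (mpoly_ring Y)" and S: "finite S" "S \<subseteq> Y" "(\<Prod>x\<in>S. Var x) \<in> q"
  shows "\<exists>x\<in>S. Var x \<in> q"
  using S
proof (induction S rule: finite_induct)
  case empty
  then show ?case using Spec_mpolyD(3)[OF q] by simp
next
  case (insert x S)
  then have "Var x \<in> q \<or> (\<Prod>x\<in>S. Var x) \<in> q"
    by (intro Spec_mpolyD(4)[OF q]) (simp_all add: indets_prod_Var)
  then show ?case using insert by auto
qed

lemma jet_proj_Spec:
  assumes q: "q \<in> Spec (mpoly_ring (jet_vars s X))"
  shows "jet_proj X q \<in> Spec (mpoly_ring X)"
proof -
  interpret R: cring "mpoly_ring X :: ('a, 'b) mpoly ring" by (rule cring_mpoly_ring)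
  note q' = Spec_mpolyD[OF q] and qi = ideal_mpoly_ring[OF Spec_mpolyD(2)[OF q]]
  have closed: "indets (subst_vars (\<lambda>x. Var (x, 0)) f) \<subseteq> jet_vars s X" if "indets f \<subseteq> X" for f :: "('a, 'b) mpoly"
    by (rule indets_subst_vars[OF that]) (auto simp: jet_vars_def)
  let ?R = "mpoly_ring X :: ('a, 'b) mpoly ring"
  let ?p = "jet_proj X q"
  have "primeideal ?p ?R"
  proof (rule primeidealI)
    show "ideal ?p ?R"
    proof (rule R.ideal_intro)
      show "f \<oplus>\<^bsub>?R\<^esub> g \<in> ?p" if "f \<in> ?p" "g \<in> ?p" for f g
        using that indets_add[of f g] qi(3) by (auto simp: jet_proj_def)
      show "f \<otimes>\<^bsub>?R\<^esub> g \<in> ?p" if "f \<in> carrier ?R" "g \<in> ?p" for f g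
        using that indets_mult[of f g] qi(4) closed by (auto simp: jet_proj_def)
    qed (use qi(2) in \<open>auto simp: jet_proj_def\<close>)
    have "1 \<notin> ?p" using q'(3) by (simp add: jet_proj_def)
    then show "carrier ?R \<noteq> ?p" by auto
    show "f \<in> ?p \<or> g \<in> ?p" if "f \<in> carrier ?R" "g \<in> carrier ?R" "f \<otimes>\<^bsub>?R\<^esub> g \<in> ?p" for f g
      using that q'(4) closed by (auto simp: jet_proj_def)
  qed (rule R.is_cring)
  then show ?thesis by (simp add: Spec_def)
qed

lemma topspace_zariski: "cring R \<Longrightarrow> topspace (zariski R) = Spec R"
proof -
  assume R: "cring R"
  interpret cring R by fact
  have "zero_locus R (carrier R) = {}"
    using primeideal_props(2) by (auto simp: zero_locus_def Spec_def)
  then have "openin (zariski R) (Spec R)" using openin_zariski[OF R, of "Spec R"] by auto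
  moreover have "openin (zariski R) U \<Longrightarrow> U \<subseteq> Spec R" for U using openin_zariski[OF R] by blast
  ultimately show ?thesis unfolding topspace_def by blast
qed

lemma closedin_zero_locus:
  assumes "cring R" "S \<subseteq> carrier R"
  shows "closedin (zariski R) (zero_locus R S)"
  unfolding closedin_def topspace_zariski[OF assms(1)] openin_zariski[OF assms(1)]
  using assms(2) by (auto simp: zero_locus_def)

section \<open>Points of the zero locus of an edge ideal, singular and nonsingular\<close>

lemma edge_ideal_eq:
  assumes "finite X" "E \<subseteq> Pow X"
  shows "edge_ideal X E =
    {f :: ('x, 'k::field) mpoly. indets f \<subseteq> X \<and> (\<forall>k\<in>Poly_Mapping.keys f. \<exists>e\<in>E. e \<subseteq> Poly_Mapping.keys k)}"
  unfolding edge_ideal_def Setcompr_eq_image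
  using assms by (intro genideal_sqfree_monomials) auto

lemma edge_monomials_closed:
  assumes "finite X" "E \<subseteq> Pow X"
  shows "{\<Prod>x\<in>e. Var x | e. e \<in> E} \<subseteq> carrier (mpoly_ring X :: ('x, 'k::field) mpoly ring)"
proof
  fix f :: "('x, 'k) mpoly" assume "f \<in> {\<Prod>x\<in>e. Var x | e. e \<in> E}"
  then obtain e where e: "e \<in> E" "f = (\<Prod>x\<in>e. Var x)" by blast
  then have "e \<subseteq> X" using assms(2) by blast
  then show "f \<in> carrier (mpoly_ring X)"
    using finite_subset[OF _ assms(1)] by (simp add: e(2) indets_prod_Var)
qed

lemma ideal_edge_ideal:
  assumes "finite X" "E \<subseteq> Pow X"
  shows "ideal (edge_ideal X E :: ('x, 'k::field) mpoly set) (mpoly_ring X)"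
  unfolding edge_ideal_def
  by (rule ring.genideal_ideal[OF cring.axioms(1)[OF cring_mpoly_ring] edge_monomials_closed[OF assms]])

lemma edge_monomial_in_edge_ideal:
  assumes "finite X" "E \<subseteq> Pow X" "e \<in> E"
  shows "(\<Prod>x\<in>e. Var x :: ('x, 'k::field) mpoly) \<in> edge_ideal X E"
  unfolding edge_ideal_def
  using ring.genideal_self[OF cring.axioms(1)[OF cring_mpoly_ring] edge_monomials_closed[OF assms(1,2)]] assms(3)
  by blast

lemma edge_ideal_subset_var_prime:
  assumes "finite X" "E \<subseteq> Pow X" "minimal_cover X E W"
  shows "edge_ideal X E \<subseteq> (var_prime X W :: ('x, 'k::field) mpoly set)"
proof
  fix f :: "('x, 'k) mpoly" assume "f \<in> edge_ideal X E"
  then have f: "indets f \<subseteq> X" "\<forall>k\<in>Poly_Mapping.keys f. \<exists>e\<in>E. e \<subseteq> Poly_Mapping.keys k"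
    by (simp_all add: edge_ideal_eq[OF assms(1,2)])
  have "Poly_Mapping.keys k \<inter> W \<noteq> {}" if k: "k \<in> Poly_Mapping.keys f" for k
  proof -
    from f(2) k obtain e where "e \<in> E" "e \<subseteq> Poly_Mapping.keys k" by blast
    moreover from this(1) have "e \<inter> W \<noteq> {}" using assms(3) by (simp add: minimal_cover_def)
    ultimately show ?thesis by blast
  qed
  then show "f \<in> var_prime X W" using f(1) by (simp add: var_prime_def restrict_vars_eq_0_iff)
qed

lemma var_prime_in_zero_locus:
  assumes "finite X" "E \<subseteq> Pow X" "minimal_cover X E W"
  shows "(var_prime X W :: ('x, 'k::field) mpoly set) \<in> zero_locus (mpoly_ring X) (edge_ideal X E)"
  using edge_ideal_subset_var_prime[OF assms]
  by (simp add: zero_locus_def Spec_def primeideal_var_prime[OF assms(1)])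

text \<open>The primes \<open>P\<^sub>W\<close> belong to the zero locus. If \<open>f\<close>
  vanishes at all of them, the support of each of its monomials meets every minimal cover and so
  contains an edge. Thus the reduced structure on \<open>Z\<close> is given by the edge ideal
  itself.\<close>

lemma vanishing_ideal_edge_ideal:
  assumes "finite X" "E \<subseteq> Pow X"
  shows "vanishing_ideal (mpoly_ring X) (zero_locus (mpoly_ring X) (edge_ideal X E)) =
    (edge_ideal X E :: ('x, 'k::field) mpoly set)" (is "?V = ?I")
proof
  show "?I \<subseteq> ?V"
    using ideal_mpoly_ring(1)[OF ideal_edge_ideal[OF assms]] by (auto simp: vanishing_ideal_def zero_locus_def)
  show "?V \<subseteq> ?I"
  proof
    fix f assume f: "f \<in> ?V"
    have "\<exists>e\<in>E. e \<subseteq> Poly_Mapping.keys k" if k: "k \<in> Poly_Mapping.keys f" for k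
    proof (rule edge_subset_if_meets_minimal_covers[OF assms])
      fix W assume "minimal_cover X E W"
      from var_prime_in_zero_locus[OF assms this] f have "f \<in> var_prime X W" by (auto simp: vanishing_ideal_def)
      then show "Poly_Mapping.keys k \<inter> W \<noteq> {}" using k by (auto simp: var_prime_def restrict_vars_eq_0_iff)
    qed
    then show "f \<in> ?I" using f by (simp add: edge_ideal_eq[OF assms] vanishing_ideal_def)
  qed
qed

lemma finite_jet_vars: "finite X \<Longrightarrow> finite (jet_vars s X)"
  by (simp add: jet_vars_def)

lemma restrict_vars_comp_jet:
  fixes s :: nat
  shows "restrict_vars (W \<times> {0..s}) (subst_vars (\<lambda>x. Var (x, 0)) f) =
    subst_vars (\<lambda>x. Var (x, 0)) (restrict_vars W f)"
proof -
  have eq: "(\<lambda>x. restrict_vars (W \<times> {0..s}) (Var (x, 0))) = (\<lambda>x. subst_vars (\<lambda>x. Var (x, 0)) (if x \<in> W then 0 else Var x))"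
    by auto
  show ?thesis unfolding subst_vars_comp eq by (rule refl)
qed

text \<open>\<open>Q\<^sub>W\<close> lies over \<open>P\<^sub>W\<close>: killing variables commutes
  with \<open>x \<mapsto> x\<^sub>0\<close>, and that map is injective, since forgetting the index
  inverts it.\<close>

lemma jet_proj_var_prime:
  "jet_proj X (var_prime (jet_vars s X) (W \<times> {0..s})) = (var_prime X W :: ('x, 'k::field) mpoly set)"
proof -
  have "subst_vars (\<lambda>x. Var (x, 0)) f \<in> var_prime (jet_vars s X) (W \<times> {0..s}) \<longleftrightarrow> f \<in> var_prime X W"
    if f: "indets f \<subseteq> X" for f :: "('x, 'k) mpoly"
  proof -
    have "indets (subst_vars (\<lambda>x. Var (x, 0)) f) \<subseteq> jet_vars s X"
      by (rule indets_subst_vars[OF f]) (auto simp: jet_vars_def)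
    moreover have "subst_vars (\<lambda>x. Var (x, 0 :: nat)) g = 0 \<longleftrightarrow> g = 0" for g :: "('x, 'k) mpoly"
    proof
      have "indets g \<subseteq> UNIV" by simp
      then have "subst_vars (\<lambda>y. Var (fst y)) (subst_vars (\<lambda>x. Var (x, 0 :: nat)) g) = g"
        by (induction rule: mpoly_induct) simp_all
      then show "subst_vars (\<lambda>x. Var (x, 0 :: nat)) g = 0 \<Longrightarrow> g = 0" by auto
    qed simp
    ultimately show ?thesis using f by (simp add: var_prime_def restrict_vars_comp_jet)
  qed
  moreover have "indets f \<subseteq> X" if "f \<in> var_prime X W" for f :: "('x, 'k) mpoly"
    using that by (simp add: var_prime_def)
  ultimately show ?thesis unfolding jet_proj_def mpoly_ring_simps(1) by blast
qed

text \<open>It suffices to treat jets of edge monomials. Each edge has a vertex \<open>w\<close> in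
  \<open>W\<close>, and every term of the product formula contains a jet coefficient of
  \<open>w\<close>.\<close>

lemma var_prime_in_jet_locus:
  assumes "finite X" "E \<subseteq> Pow X" "minimal_cover X E W"
  shows "(var_prime (jet_vars s X) (W \<times> {0..s}) :: ('x \<times> nat, 'k::field) mpoly set) \<in>
    zero_locus (mpoly_ring (jet_vars s X)) (jet_ideal s X (edge_ideal X E))"
proof -
  let ?J = "mpoly_ring (jet_vars s X) :: ('x \<times> nat, 'k) mpoly ring"
  let ?Q = "var_prime (jet_vars s X) (W \<times> {0..s}) :: ('x \<times> nat, 'k) mpoly set"
  interpret J: cring ?J by (rule cring_mpoly_ring)
  have Q: "?Q \<in> Spec ?J" using primeideal_var_prime[OF finite_jet_vars[OF assms(1)]] by (auto simp: Spec_def)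
  note Qi = Spec_mpolyD(2)[OF Q]
  let ?G = "{jet_coeff s f j | f j. f \<in> {\<Prod>x\<in>e. Var x :: ('x, 'k) mpoly | e. e \<in> E} \<and> j \<le> s}"
  have "?G \<subseteq> ?Q"
  proof
    fix g assume "g \<in> ?G"
    then obtain e j where e: "e \<in> E" and g: "g = jet_coeff s (\<Prod>x\<in>e. Var x) j" by blast
    have fe: "e \<subseteq> X" "finite e" using assms(2) e finite_subset[OF _ assms(1)] by blast+
    have "e \<inter> W \<noteq> {}" using assms(3) e by (simp add: minimal_cover_def)
    then obtain w where w: "w \<in> e" "w \<in> W" by blast
    let ?r = "\<Prod>x\<in>e - {w}. Var x :: ('x, 'k) mpoly"
    have "indets ?r \<subseteq> X" using fe by (auto simp: indets_prod_Var)
    then have r: "indets (jet_coeff s ?r i) \<subseteq> jet_vars s X" for i by (rule indets_jet_coeff)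
    have "jet_coeff s (Var w) i \<in> ?Q" for i
      using w fe by (auto simp: jet_coeff_Var var_prime_def jet_vars_def)
    then have "jet_coeff s ?r (j - i) * jet_coeff s (Var w) i \<in> ?Q" for i
      by (intro ideal_mpoly_ring(4)[OF Qi] r)
    then have "jet_coeff s (Var w) i * jet_coeff s ?r (j - i) \<in> ?Q" for i by (subst mult.commute)
    then have "jet_coeff s (Var w * ?r) j \<in> ?Q"
      unfolding jet_coeff_mult by (rule ideal_mpoly_ring(5)[OF Qi])
    then show "g \<in> ?Q" unfolding g prod.remove[OF fe(2) w(1)] .
  qed
  then have "Idl\<^bsub>?J\<^esub> ?G \<subseteq> ?Q" by (rule J.genideal_minimal[OF Qi])
  then have "jet_ideal s X (edge_ideal X E) \<subseteq> ?Q"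
    unfolding edge_ideal_def jet_ideal_genideal[OF edge_monomials_closed[OF assms(1,2)]] .
  with Q show ?thesis by (simp add: zero_locus_def)
qed

text \<open>The product of the variables outside \<open>W\<close> is not in \<open>P\<^sub>W\<close>
  and multiplies \<open>P\<^sub>W\<close> into the edge ideal, so \<open>regular_if_minimal\<close>
  applies.\<close>

lemma var_prime_regular:
  assumes fin: "finite X" and E: "E \<subseteq> Pow X" and W: "minimal_cover X E W"
  shows "(var_prime X W :: ('x, 'k::field) mpoly set) \<notin>
    sing_locus (mpoly_ring X) (zero_locus (mpoly_ring X) (edge_ideal X E))"
proof -
  let ?R = "mpoly_ring X :: ('x, 'k) mpoly ring"
  let ?I = "edge_ideal X E :: ('x, 'k) mpoly set"
  let ?P = "var_prime X W :: ('x, 'k) mpoly set"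
  interpret cring ?R by (rule cring_mpoly_ring)
  interpret quotient_at_prime ?R ?I ?P
    by (intro quotient_at_prime.intro quotient_at_prime_axioms.intro cring_mpoly_ring
      ideal_edge_ideal fin E primeideal_var_prime edge_ideal_subset_var_prime[OF fin E W])
  have "\<exists>u\<in>carrier ?R - ?P. u \<otimes>\<^bsub>?R\<^esub> a \<in> ?I" if a: "a \<in> ?P" for a
  proof (intro bexI)
    let ?m = "sqfree_monomial (X - W)"
    let ?u = "\<Prod>x\<in>X - W. Var x :: ('x, 'k) mpoly"
    have u: "?u = Poly_Mapping.single ?m 1" by (rule prod_Var_eq_single)
    have km: "Poly_Mapping.keys ?m = X - W" using fin by (simp add: keys_sqfree_monomial)
    have ui: "indets ?u \<subseteq> X" using fin by (simp add: indets_prod_Var)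
    have "restrict_vars W ?u \<noteq> 0"
      unfolding restrict_vars_eq_0_iff u by (simp add: km) blast
    then have "?u \<notin> ?P" unfolding var_prime_def by blast
    with ui show "?u \<in> carrier ?R - ?P" by simp
    have ai: "indets a \<subseteq> X" and ak: "\<forall>k\<in>Poly_Mapping.keys a. Poly_Mapping.keys k \<inter> W \<noteq> {}"
      using a unfolding var_prime_def restrict_vars_eq_0_iff by blast+
    have "\<exists>e\<in>E. e \<subseteq> Poly_Mapping.keys k" if "k \<in> Poly_Mapping.keys (?u * a)" for k
    proof -
      from subsetD[OF keys_mult that] obtain l n
        where n: "n \<in> Poly_Mapping.keys a" "k = l + n" and l: "l \<in> Poly_Mapping.keys ?u" by blast
      have "l = ?m" using l unfolding u by simp
      note n = n[unfolded this]
      from ak n(1) obtain x where x: "x \<in> Poly_Mapping.keys n" "x \<in> W" by blast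
      have "\<forall>x\<in>W. \<exists>e\<in>E. e \<inter> W = {x}" using W by (simp add: minimal_cover_def)
      \<comment> \<open>The private edge of \<open>x\<close> consists of \<open>x\<close> and
        vertices outside \<open>W\<close>, so its monomial divides the product.\<close>
      with x(2) obtain e where e: "e \<in> E" "e \<inter> W = {x}" by blast
      have "e \<subseteq> X" using e(1) E by blast
      have "e \<subseteq> (X - W) \<union> Poly_Mapping.keys n"
      proof
        fix y assume "y \<in> e"
        then show "y \<in> (X - W) \<union> Poly_Mapping.keys n" using \<open>e \<subseteq> X\<close> e(2) x(1) by (cases "y \<in> W") auto
      qed
      then have "e \<subseteq> Poly_Mapping.keys k" unfolding n(2) keys_add_nat km .
      with e(1) show ?thesis by blast
    qed
    moreover have "indets (?u * a) \<subseteq> X" using indets_mult[of ?u a] ui ai by blast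
    ultimately show "?u \<otimes>\<^bsub>?R\<^esub> a \<in> ?I" by (simp add: edge_ideal_eq[OF fin E])
  qed
  then have "regular_local_ring loc.A" by (rule regular_if_minimal)
  then show ?thesis
    unfolding sing_locus_def Spec_sing_def vanishing_ideal_edge_ideal[OF fin E] pbar_def by blast
qed

text \<open>At a nonsingular point \<open>p\<close> the local ring is smooth enough that one vertex of every edge vanishes
  identically near \<open>p\<close>: by the derivation test with \<open>\<partial>/\<partial>x\<close>, some edge contains \<open>x\<close> but no other
  variable from \<open>p\<close>.\<close>

lemma locally_zero_vertex:
  assumes fin: "finite X" and E: "E \<subseteq> Pow X"
    and pZ: "p \<in> zero_locus (mpoly_ring X) (edge_ideal X E)"
      "p \<notin> sing_locus (mpoly_ring X) (zero_locus (mpoly_ring X) (edge_ideal X E))"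
    and e: "e \<in> E"
  shows "\<exists>x\<in>e. \<exists>u. indets u \<subseteq> X \<and> u \<notin> p \<and> u * Var x \<in> (edge_ideal X E :: ('x, 'k::field) mpoly set)"
proof -
  let ?R = "mpoly_ring X :: ('x, 'k) mpoly ring"
  let ?I = "edge_ideal X E :: ('x, 'k) mpoly set"
  interpret cring ?R by (rule cring_mpoly_ring)
  have Ip: "?I \<subseteq> p" and pS: "p \<in> Spec ?R" using pZ(1) by (auto simp: zero_locus_def)
  note p' = Spec_mpolyD[OF pS] and pi = ideal_mpoly_ring[OF Spec_mpolyD(2)[OF pS]]
  interpret quotient_at_prime ?R ?I p
    by (intro quotient_at_prime.intro quotient_at_prime_axioms.intro cring_mpoly_ring
      ideal_edge_ideal fin E p'(1) Ip)
  have "pbar \<notin> Spec_sing B"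
    using pZ unfolding sing_locus_def vanishing_ideal_edge_ideal[OF fin E] pbar_def by blast
  then have "regular_local_ring loc.A"
    using pbar_prime unfolding Spec_sing_def Spec_def by blast
  from regular_imp_prime_without_tangents[OF this] obtain q
    where q: "primeideal q ?R" "?I \<subseteq> q" "q \<subseteq> p"
      and Dq: "\<forall>D x. cring.derivation ?R D \<longrightarrow> D ` ?I \<subseteq> p \<longrightarrow> x \<in> q \<longrightarrow> D x \<in> p"
    by (elim exE conjE)
  have finE: "finite e" "e \<subseteq> X" if "e \<in> E" for e
  proof -
    show "e \<subseteq> X" using that E by blast
    then show "finite e" using fin by (rule finite_subset)
  qed
  have qS: "q \<in> Spec ?R" using q(1) by (simp add: Spec_def)
  from prime_prod_Var[OF qS finE[OF e] subsetD[OF q(2) edge_monomial_in_edge_ideal[OF fin E e]]]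
  obtain x where x: "x \<in> e" "Var x \<in> q" by blast
  \<comment> \<open>Otherwise the derivation test would apply to the derivative by \<open>x\<close>,
    and since \<open>x\<close> lies in \<open>q\<close>, its derivative 1 would lie in
    \<open>p\<close>.\<close>
  have "\<exists>f\<in>?I. mpoly_deriv x f \<notin> p"
  proof (rule ccontr)
    assume "\<not> (\<exists>f\<in>?I. mpoly_deriv x f \<notin> p)"
    then have "mpoly_deriv x ` ?I \<subseteq> p" by blast
    then have "mpoly_deriv x (Var x) \<in> p"
      using Dq[rule_format, OF derivation_mpoly_deriv _ x(2)] by simp
    then show False using p'(3) by (simp add: mpoly_deriv_Var)
  qed
  then obtain f where f: "f \<in> ?I" "mpoly_deriv x f \<notin> p" by blast
  have deriv_sum: "mpoly_deriv x (sum F A) = (\<Sum>i\<in>A. mpoly_deriv x (F i))"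
    for F :: "('x \<Rightarrow>\<^sub>0 nat) \<Rightarrow> ('x, 'k) mpoly" and A
    using mpoly_deriv_Const[of x 0]
    by (induction A rule: infinite_finite_induct) (simp_all add: mpoly_deriv_add)
  have "mpoly_deriv x f = (\<Sum>k\<in>Poly_Mapping.keys f. mpoly_deriv x (Poly_Mapping.single k (Poly_Mapping.lookup f k)))"
    by (subst mpoly_expand[of f]) (rule deriv_sum)
  then have "\<exists>k\<in>Poly_Mapping.keys f. mpoly_deriv x (Poly_Mapping.single k (Poly_Mapping.lookup f k)) \<notin> p"
    using f(2) pi(5)[of "Poly_Mapping.keys f" "\<lambda>k. mpoly_deriv x (Poly_Mapping.single k (Poly_Mapping.lookup f k))"]
    by auto
  then obtain k where k: "k \<in> Poly_Mapping.keys f"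
    and kp: "mpoly_deriv x (Poly_Mapping.single k (Poly_Mapping.lookup f k)) \<notin> p" by blast
  have fk: "indets f \<subseteq> X" "\<exists>e\<in>E. e \<subseteq> Poly_Mapping.keys k"
    using f(1) k by (auto simp: edge_ideal_eq[OF fin E])
  \<comment> \<open>A further variable \<open>y\<close> from \<open>p\<close> dividing the monomial
    would still divide its derivative by \<open>x\<close>, which would then lie in
    \<open>p\<close>.\<close>
  have other: "Var y \<notin> p" if y: "y \<in> Poly_Mapping.keys k" "y \<noteq> x" for y
  proof
    assume yp: "Var y \<in> p"
    let ?g = "Poly_Mapping.single (k - Poly_Mapping.single y 1) (Poly_Mapping.lookup f k)"
    have "k = Poly_Mapping.single y 1 + (k - Poly_Mapping.single y 1)"
      using y(1) by (intro poly_mapping_eqI) (auto simp: lookup_add lookup_minus lookup_single when_def in_keys_iff)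
    then have "Poly_Mapping.single k (Poly_Mapping.lookup f k) = Var y * ?g"
      by (simp add: Var_def mult_single)
    then have eq: "mpoly_deriv x (Poly_Mapping.single k (Poly_Mapping.lookup f k)) = mpoly_deriv x ?g * Var y"
      using y(2) by (simp add: mpoly_deriv_mult mpoly_deriv_Var mult.commute)
    have "Poly_Mapping.keys (k - Poly_Mapping.single y 1) \<subseteq> Poly_Mapping.keys k"
      by (auto simp: in_keys_iff lookup_minus)
    then have "indets ?g \<subseteq> X"
      using fk(1) k by (auto simp: indets_def split: if_splits)
    then have "mpoly_deriv x ?g * Var y \<in> p" using yp by (intro pi(4) indets_mpoly_deriv)
    then show False using kp eq by simp
  qed
  from fk(2) obtain e' where e': "e' \<in> E" "e' \<subseteq> Poly_Mapping.keys k" by blast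
  \<comment> \<open>The prime \<open>p\<close> contains a vertex of \<open>e'\<close>, and only
    \<open>x\<close> is possible. The other vertices of \<open>e'\<close> multiply to the desired
    \<open>u\<close>; the edge \<open>e'\<close> may differ from \<open>e\<close>.\<close>
  have "\<exists>y\<in>e'. Var y \<in> p"
    by (rule prime_prod_Var[OF pS finE[OF e'(1)] subsetD[OF Ip edge_monomial_in_edge_ideal[OF fin E e'(1)]]])
  then have xe': "x \<in> e'" using other e'(2) by blast
  let ?u = "\<Prod>y\<in>e' - {x}. Var y :: ('x, 'k) mpoly"
  have fin': "finite (e' - {x})" "e' - {x} \<subseteq> X" using finE[OF e'(1)] by auto
  have "?u \<notin> p"
  proof
    assume "?u \<in> p"
    from prime_prod_Var[OF pS fin' this] show False using other e'(2) by blast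
  qed
  moreover have "?u * Var x = (\<Prod>y\<in>e'. Var y)"
    using finE[OF e'(1)] xe' by (simp add: prod.remove[of e' x] mult.commute)
  then have "?u * Var x \<in> ?I" using edge_monomial_in_edge_ideal[OF fin E e'(1)] by simp
  moreover have "indets ?u \<subseteq> X" using fin' by (simp add: indets_prod_Var)
  ultimately show ?thesis using x(1) by blast
qed

section \<open>Jets over nonsingular points and minimality of the generators\<close>

lemma jet_variables_vanish:
  fixes q :: "('x \<times> nat, 'k::field) mpoly set"
  assumes q: "q \<in> Spec (mpoly_ring (jet_vars s X))" and x: "x \<in> X" and u: "indets u \<subseteq> X" "u \<notin> jet_proj X q"
    and ux: "\<And>j. j \<le> s \<Longrightarrow> jet_coeff s (u * Var x) j \<in> q"
  shows "j \<le> s \<Longrightarrow> Var (x, j) \<in> q"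
proof (induction j rule: less_induct)
  case (less j)
  note qi = ideal_mpoly_ring[OF Spec_mpolyD(2)[OF q]]
  have ui: "indets (jet_coeff s u i) \<subseteq> jet_vars s X" for i by (rule indets_jet_coeff[OF u(1)])
  \<comment> \<open>The terms with \<open>i > 0\<close> involve only variables
    \<open>(x, j - i)\<close> of smaller index, already in \<open>q\<close>; the remaining term is
    the one with \<open>Var (x, j)\<close>.\<close>
  let ?r = "\<Sum>i\<in>{..j} - {0}. jet_coeff s u i * jet_coeff s (Var x) (j - i)"
  have "jet_coeff s (u * Var x) j = jet_coeff s u 0 * jet_coeff s (Var x) j + ?r"
    by (simp add: jet_coeff_mult sum.remove[of "{..j}" 0])
  then have split: "jet_coeff s u 0 * Var (x, j) = jet_coeff s (u * Var x) j + Const (-1) * ?r"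
    using less.prems by (simp add: jet_coeff_Var Const_def single_uminus)
  have "?r \<in> q"
  proof (rule qi(5))
    fix i assume i: "i \<in> {..j} - {0}"
    then have "Var (x, j - i) \<in> q" using less.IH[of "j - i"] less.prems by simp
    then have "jet_coeff s (Var x) (j - i) \<in> q" using qi(2) by (simp add: jet_coeff_Var)
    then show "jet_coeff s u i * jet_coeff s (Var x) (j - i) \<in> q" by (rule qi(4)[OF ui])
  qed
  then have "Const (-1) * ?r \<in> q" by (intro qi(4)) simp_all
  then have "jet_coeff s u 0 * Var (x, j) \<in> q" unfolding split by (intro qi(3) ux less.prems)
  moreover have "jet_coeff s u 0 \<notin> q" using u by (simp add: jet_proj_def jet_coeff_at_0)
  moreover have "indets (Var (x, j) :: ('x \<times> nat, 'k) mpoly) \<subseteq> jet_vars s X"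
    using x less.prems by (simp add: jet_vars_def)
  ultimately show ?case using Spec_mpolyD(4)[OF q ui] by blast
qed

text \<open>The first component recovers \<open>x\<close>, so the jet variables in the product are
  distinct and the monomial is squarefree.\<close>

lemma prod_Var_graph: "(\<Prod>x\<in>e. Var (x, i x)) = (\<Prod>y\<in>(\<lambda>x. (x, i x)) ` e. Var y)"
  by (subst prod.reindex) (auto intro: inj_onI)

text \<open>Graphs of index choices on the edges, so that functions agreeing on \<open>e\<close>
  give one and the same set. If \<open>E\<close> is a clutter, these sets form a clutter on the jet
  variables, and the ideal of the theorem is its edge ideal.\<close>

definition jet_edges :: "nat \<Rightarrow> 'x set set \<Rightarrow> ('x \<times> nat) set set"
  where "jet_edges s E = {(\<lambda>x. (x, i x)) ` e | e i. e \<in> E \<and> (\<forall>x\<in>e. i x \<le> s)}"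

lemma jet_edges_subset: "E \<subseteq> Pow X \<Longrightarrow> S \<in> jet_edges s E \<Longrightarrow> S \<subseteq> jet_vars s X"
  by (auto simp: jet_edges_def jet_vars_def)

text \<open>Projecting to vertices gives an inclusion of edges, hence equality; inclusion between
  graphs over the same edge then forces equal indices.\<close>

lemma jet_edges_antichain:
  assumes E: "\<forall>e\<in>E. \<forall>e'\<in>E. e \<subseteq> e' \<longrightarrow> e = e'"
    and S: "S \<in> jet_edges s E" "T \<in> jet_edges s E" "S \<subseteq> T"
  shows "S = T"
proof -
  from S(1) obtain e i where e: "S = (\<lambda>x. (x, i x)) ` e" "e \<in> E" unfolding jet_edges_def by blast
  from S(2) obtain e' i' where e': "T = (\<lambda>x. (x, i' x)) ` e'" "e' \<in> E" unfolding jet_edges_def by blast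
  have sub: "x \<in> e' \<and> i x = i' x" if "x \<in> e" for x using that S(3) unfolding e e' by auto
  then have "e \<subseteq> e'" by blast
  then have "e = e'" using E e(2) e'(2) by blast
  then show ?thesis unfolding e(1) e'(1) using sub by (intro image_cong) auto
qed

text \<open>A monomial dropped from the generators could only be recovered from one whose support is
  contained in its own, which the antichain condition excludes.\<close>

lemma minimal_generating_set_prod_Var:
  assumes "finite Y" and F: "\<And>S. S \<in> F \<Longrightarrow> S \<subseteq> Y"
    and anti: "\<And>S T. S \<in> F \<Longrightarrow> T \<in> F \<Longrightarrow> S \<subseteq> T \<Longrightarrow> S = T"
  shows "minimal_generating_set (mpoly_ring Y) (Idl\<^bsub>mpoly_ring Y\<^esub> ((\<lambda>S. \<Prod>x\<in>S. Var x) ` F))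
    ((\<lambda>S. \<Prod>x\<in>S. Var x :: ('x, 'k::field) mpoly) ` F)"
proof -
  let ?R = "mpoly_ring Y :: ('x, 'k) mpoly ring"
  let ?m = "\<lambda>S. \<Prod>x\<in>S. Var x :: ('x, 'k) mpoly"
  interpret ring ?R by (rule cring.axioms(1)[OF cring_mpoly_ring])
  have fin: "finite S" if "S \<in> F" for S using F[OF that] assms(1) by (rule finite_subset)
  have G: "?m ` F \<subseteq> carrier ?R"
  proof
    fix g assume "g \<in> ?m ` F"
    then obtain S where S: "S \<in> F" "g = ?m S" by blast
    then show "g \<in> carrier ?R" using F[OF S(1)] by (simp add: S(2) indets_prod_Var[OF fin[OF S(1)]])
  qed
  have "Idl\<^bsub>?R\<^esub> (?m ` F) \<noteq> Idl\<^bsub>?R\<^esub> H" if H: "H \<subset> ?m ` F" for H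
  proof
    assume eq: "Idl\<^bsub>?R\<^esub> (?m ` F) = Idl\<^bsub>?R\<^esub> H"
    from H obtain S where S: "S \<in> F" "?m S \<notin> H" by blast
    \<comment> \<open>Indexes \<open>H\<close> again by sets of variables, so that the description
      of monomial ideals applies to it too.\<close>
    define F' where "F' = {T \<in> F. ?m T \<in> H}"
    have HF: "H = ?m ` F'"
    proof
      show "?m ` F' \<subseteq> H" unfolding F'_def by blast
      show "H \<subseteq> ?m ` F'"
      proof
        fix h assume "h \<in> H"
        moreover from this H obtain T where "T \<in> F" "h = ?m T" by blast
        ultimately show "h \<in> ?m ` F'" unfolding F'_def by blast
      qed
    qed
    have F': "T \<subseteq> Y" if "T \<in> F'" for T using that F by (simp add: F'_def)
    have "?m S \<in> Idl\<^bsub>?R\<^esub> H" using genideal_self[OF G] S(1) eq by blast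
    then have "?m S \<in> Idl\<^bsub>?R\<^esub> (?m ` F')" by (simp only: HF)
    moreover have "Idl\<^bsub>?R\<^esub> (?m ` F') = {f. indets f \<subseteq> Y \<and>
        (\<forall>k\<in>Poly_Mapping.keys f. \<exists>T\<in>F'. T \<subseteq> Poly_Mapping.keys k)}"
      using F' assms(1) by (rule genideal_sqfree_monomials)
    ultimately have "\<forall>k\<in>Poly_Mapping.keys (?m S). \<exists>T\<in>F'. T \<subseteq> Poly_Mapping.keys k" by simp
    then have "\<exists>T\<in>F'. T \<subseteq> S"
      by (simp add: prod_Var_eq_single keys_sqfree_monomial[OF fin[OF S(1)]])
    then obtain T where T: "T \<in> F'" "T \<subseteq> S" by blast
    then have "T = S" using anti[of T S] S(1) by (simp add: F'_def)
    then show False using T(1) S(2) by (simp add: F'_def)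
  qed
  then show ?thesis using G unfolding minimal_generating_set_def by simp
qed

lemma principal_jets_edge_ideal:
  fixes X :: "'x set" and E :: "'x set set" and s :: nat
  assumes fin: "finite X" and E: "E \<subseteq> Pow X"
  shows "(principal_jets s X (edge_ideal X E) :: ('x \<times> nat, 'k::field) mpoly set) =
    Idl\<^bsub>mpoly_ring (jet_vars s X)\<^esub> ((\<lambda>S. \<Prod>y\<in>S. Var y) ` jet_edges s E)" (is "_ = Idl\<^bsub>?J\<^esub> ?G")
proof -
  let ?R = "mpoly_ring X :: ('x, 'k) mpoly ring"
  let ?I = "edge_ideal X E :: ('x, 'k) mpoly set"
  let ?Z = "zero_locus ?R ?I"
  let ?JZ = "zero_locus ?J (jet_ideal s X ?I)"
  let ?U = "?JZ - {q \<in> Spec ?J. jet_proj X q \<in> sing_locus ?R ?Z}"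
  let ?P = "principal_jets s X ?I"
  have P: "?P = vanishing_ideal ?J (zariski ?J closure_of ?U)"
    unfolding principal_jets_def Let_def vanishing_ideal_edge_ideal[OF fin E] ..
  interpret J: cring ?J by (rule cring_mpoly_ring)
  have fJ: "finite (jet_vars s X)" by (rule finite_jet_vars[OF fin])
  note jE = jet_edges_subset[OF E]
  have fS: "finite S" if "S \<in> jet_edges s E" for S using jE[OF that] fJ by (rule finite_subset)
  have GJ: "?G \<subseteq> carrier ?J"
  proof
    fix g assume "g \<in> ?G"
    then obtain S where S: "S \<in> jet_edges s E" "g = (\<Prod>y\<in>S. Var y)" by blast
    then show "g \<in> carrier ?J" using jE[OF S(1)] by (simp add: S(2) indets_prod_Var[OF fS[OF S(1)]])
  qed
  have US: "?U \<subseteq> Spec ?J" by (auto simp: zero_locus_def)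
  have IdlG: "Idl\<^bsub>?J\<^esub> ?G = {f. indets f \<subseteq> jet_vars s X \<and>
      (\<forall>k\<in>Poly_Mapping.keys f. \<exists>S\<in>jet_edges s E. S \<subseteq> Poly_Mapping.keys k)}"
    using jE fJ by (rule genideal_sqfree_monomials)
  show ?thesis
  proof
    show "?P \<subseteq> Idl\<^bsub>?J\<^esub> ?G"
    proof
      fix f assume f: "f \<in> ?P"
      have fi: "indets f \<subseteq> jet_vars s X" using f unfolding P vanishing_ideal_def by simp
      have "\<exists>S\<in>jet_edges s E. S \<subseteq> Poly_Mapping.keys k" if k: "k \<in> Poly_Mapping.keys f" for k
      proof -
        \<comment> \<open>Vanishing of \<open>f\<close> at \<open>Q\<^sub>W\<close> puts a jet
          variable over \<open>W\<close> into \<open>k\<close>. So the vertices occurring in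
          \<open>k\<close> contain an edge, and choosing for each of its vertices an index occurring
          in \<open>k\<close> gives a jet edge.\<close>
        have "fst ` Poly_Mapping.keys k \<inter> W \<noteq> {}" if W: "minimal_cover X E W" for W
        proof -
          let ?Q = "var_prime (jet_vars s X) (W \<times> {0..s}) :: ('x \<times> nat, 'k) mpoly set"
          have "?Q \<in> ?JZ" by (rule var_prime_in_jet_locus[OF fin E W])
          moreover have "jet_proj X ?Q \<notin> sing_locus ?R ?Z"
            unfolding jet_proj_var_prime by (rule var_prime_regular[OF fin E W])
          ultimately have "?Q \<in> ?U" by simp
          moreover have "?U \<subseteq> zariski ?J closure_of ?U"
            using US by (intro closure_of_subset) (simp only: topspace_zariski[OF J.is_cring])
          ultimately have "f \<in> ?Q" using f unfolding P vanishing_ideal_def by blast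
          then have "Poly_Mapping.keys k \<inter> W \<times> {0..s} \<noteq> {}"
            using k unfolding var_prime_def restrict_vars_eq_0_iff by blast
          then show ?thesis by force
        qed
        from edge_subset_if_meets_minimal_covers[OF fin E this]
        obtain e where e: "e \<in> E" "e \<subseteq> fst ` Poly_Mapping.keys k" by blast
        then have "\<forall>x\<in>e. \<exists>j. (x, j) \<in> Poly_Mapping.keys k" by force
        then obtain i where i: "\<forall>x\<in>e. (x, i x) \<in> Poly_Mapping.keys k" by metis
        have "Poly_Mapping.keys k \<subseteq> jet_vars s X" using fi k by (auto simp: indets_def)
        then have "\<forall>x\<in>e. i x \<le> s" using i by (auto simp: jet_vars_def)
        then have "(\<lambda>x. (x, i x)) ` e \<in> jet_edges s E" using e(1) unfolding jet_edges_def by blast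
        then show ?thesis using i by (intro bexI[of _ "(\<lambda>x. (x, i x)) ` e"]) auto
      qed
      with fi show "f \<in> Idl\<^bsub>?J\<^esub> ?G" by (simp add: IdlG)
    qed
    have "?U \<subseteq> zero_locus ?J ?G"
    proof
      fix q assume q: "q \<in> ?U"
      then have qS: "q \<in> Spec ?J" and Jq: "jet_ideal s X ?I \<subseteq> q" and sing: "jet_proj X q \<notin> sing_locus ?R ?Z"
        by (auto simp: zero_locus_def)
      have jq: "jet_coeff s f j \<in> q" if f: "f \<in> ?I" "j \<le> s" for f j
      proof -
        have "{jet_coeff s f j | f j. f \<in> ?I \<and> j \<le> s} \<subseteq> carrier ?J"
          using ideal_mpoly_ring(1)[OF ideal_edge_ideal[OF fin E]] indets_jet_coeff by fastforce
        from J.genideal_self[OF this] have "jet_coeff s f j \<in> jet_ideal s X ?I"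
          unfolding jet_ideal_def using f by blast
        then show ?thesis using Jq by blast
      qed
      \<comment> \<open>The coefficients of index 0 already show that the projection of
        \<open>q\<close> is a point of \<open>Z\<close>.\<close>
      have "?I \<subseteq> jet_proj X q"
        using jq[of _ 0] ideal_mpoly_ring(1)[OF ideal_edge_ideal[OF fin E]]
        by (auto simp: jet_proj_def jet_coeff_at_0)
      then have pZ: "jet_proj X q \<in> ?Z" using jet_proj_Spec[OF qS] by (simp add: zero_locus_def)
      have "g \<in> q" if "g \<in> ?G" for g
      proof -
        from that obtain e i where e: "e \<in> E" "\<forall>x\<in>e. i x \<le> s" and g: "g = (\<Prod>y\<in>(\<lambda>x. (x, i x)) ` e. Var y)"
          unfolding jet_edges_def by blast
        from locally_zero_vertex[OF fin E pZ sing e(1)] obtain x u where x: "x \<in> e"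
          and u: "indets u \<subseteq> X" "u \<notin> jet_proj X q" "u * Var x \<in> ?I" by blast
        have eX: "e \<subseteq> X" using e(1) E by blast
        have fe: "finite e" using eX fin by (rule finite_subset)
        have "x \<in> X" using x eX by blast
        from jet_variables_vanish[OF qS this u(1,2) jq[OF u(3)], of "i x"]
        have xq: "Var (x, i x) \<in> q" using e(2) x by blast
        have "g = (\<Prod>z\<in>e - {x}. Var (z, i z)) * Var (x, i x)"
          unfolding g prod_Var_graph[symmetric] prod.remove[OF fe x] by (rule mult.commute)
        also have "\<dots> \<in> q"
        proof (rule ideal_mpoly_ring(4)[OF Spec_mpolyD(2)[OF qS] _ xq])
          show "indets (\<Prod>z\<in>e - {x}. Var (z, i z) :: ('x \<times> nat, 'k) mpoly) \<subseteq> jet_vars s X"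
            unfolding prod_Var_graph using fe eX e(2)
            by (subst indets_prod_Var) (auto simp: jet_vars_def)
        qed
        finally show ?thesis .
      qed
      with qS show "q \<in> zero_locus ?J ?G" unfolding zero_locus_def by blast
    qed
    \<comment> \<open>The zero locus of the monomials is closed, so the inclusion extends to the
      closure.\<close>
    then have cl: "zariski ?J closure_of ?U \<subseteq> zero_locus ?J ?G"
      by (rule closure_of_minimal[OF _ closedin_zero_locus[OF J.is_cring GJ]])
    show "Idl\<^bsub>?J\<^esub> ?G \<subseteq> ?P"
    proof
      fix f assume f: "f \<in> Idl\<^bsub>?J\<^esub> ?G"
      have "f \<in> q" if "q \<in> zariski ?J closure_of ?U" for q
      proof -
        have "q \<in> Spec ?J" "?G \<subseteq> q" using that cl unfolding zero_locus_def by blast+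
        then have "Idl\<^bsub>?J\<^esub> ?G \<subseteq> q" by (intro J.genideal_minimal Spec_mpolyD(2))
        then show ?thesis using f by blast
      qed
      moreover have "f \<in> carrier ?J" by (rule J.ideal_membership(1)[OF J.genideal_ideal[OF GJ] f])
      ultimately show "f \<in> ?P" unfolding P vanishing_ideal_def by blast
    qed
  qed
qed

theorem corollary6p8:
  fixes X :: "'x set" and E :: "'x set set" and s :: nat
  assumes "finite X" and "clutter X E"
  shows "minimal_generating_set (mpoly_ring (jet_vars s X))
           (principal_jets s X (edge_ideal X E) :: ('x \<times> nat, 'k::field) mpoly set)
           {\<Prod>x\<in>e. Var (x, i x) | e i. e \<in> E \<and> (\<forall>x\<in>e. 0 \<le> i x \<and> i x \<le> s)}"
proof -
  have E: "E \<subseteq> Pow X" and anti: "\<forall>e\<in>E. \<forall>e'\<in>E. e \<subseteq> e' \<longrightarrow> e = e'"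
    using assms(2) by (auto simp: clutter_def)
  have "{\<Prod>x\<in>e. Var (x, i x) | e i. e \<in> E \<and> (\<forall>x\<in>e. 0 \<le> i x \<and> i x \<le> s)} =
      (\<lambda>S. \<Prod>y\<in>S. Var y :: ('x \<times> nat, 'k) mpoly) ` jet_edges s E"
    unfolding jet_edges_def prod_Var_graph by auto
  then show ?thesis
    unfolding principal_jets_edge_ideal[OF assms(1) E]
    using minimal_generating_set_prod_Var[OF finite_jet_vars[OF assms(1)] jet_edges_subset[OF E] jet_edges_antichain[OF anti]]
    by simp
qed

end
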